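(* Let $(\overline{M},g)$ be a compact surface with interior $M$ and boundary $\partial M$, and let $(u_0,\phi)$ be an admissible Cauchy-Dirichlet pair. Assume in addition that there exists $T_3>0$ such that for $t\ge T_3$ the function $\phi$ depends only on $t$, i.e. $\phi=\phi(t)$, and $$\phi'(t)\ge3\phi(t)+1\quad\text{for }t\ge T_3 .$$ Let $u$ be the solution of the Cauchy-Dirichlet problem $$u_t=e^{-2u}(\Delta_g u-K_g)-1\ \text{ in } M\times[0,\infty),\qquad u=\phi\ \text{ on }\partial M\times[0,\infty),\qquad u|_{t=0}=u_0\ \text{ in } M$$ (which exists for all time, is unique, and converges locally uniformly in $C^2$ in $M$ to $u_{LN}$). Then there exist constants $C>0$ and $T_4\ge T_3$ such that the geodesic curvature of $\partial M$ with respect to $e^{2u}g$ satisfies $$k_{e^{2u}g}=e^{-u}\Big(\frac{\partial u}{\partial n_g}+k_g\Big)\ \ge\ \phi(t)^{\frac13}-1-C\,e^{-\phi(t)}\quad\text{on }\partial M\times[T_4,\infty).$$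
   Context: $(\overline{M},g)$ is a smooth compact Riemannian surface with boundary $\partial M$ (possibly with several components) and interior $M$; $K_g$ is its Gauss curvature, $n_g$ the outward unit normal along $\partial M$, $k_g$ the geodesic curvature of $\partial M$ (sign convention: the Euclidean unit disk has $k=1$); $\alpha\in(0,1)$ is fixed. $C^{k+\alpha,\frac{k+\alpha}{2}}$ denotes the usual parabolic Hölder spaces. Low-speed increasing function: $\xi\in C^1([0,\infty))$ with $\xi>0$, $\lim_{t\to\infty}\xi(t)=\infty$, and such that there are constants $T>0$ and $0<\tau<1$ with $\xi'(t)\le\tau$ for all $t\ge T$. Admissible Cauchy-Dirichlet pair $(u_0,\phi)$: $u_0\in C^{2+\alpha}(\overline{M})$; $\phi\in C^{2+\alpha,1+\frac{\alpha}{2}}(\partial M\times[0,T'])$ for all $T'>0$; for $x\in\partial M$, $u_0(x)=\phi(x,0)$ and $\phi_t(x,0)=e^{-2u_0(x)}(\Delta_g u_0(x)-K_g(x))-1$; $\phi_t\ge0$ on $\partial M\times[T,\infty)$ for some $T>0$; and there are $T_1>0$ and a low-speed increasing function $\xi$ with $\phi(x,t)\ge\log(\xi(t))$ on $\partial M\times[T_1,\infty)$. For such a pair the Cauchy-Dirichlet problem has a unique solution $u$ that lies in $C^{2+\alpha,1+\frac{\alpha}{2}}(\overline{M}\times[0,T'])$ for all $T'>0$, and $u(\cdot,t)\to u_{LN}$ locally uniformly in $C^2$ in $M$. The Loewner-Nirenberg solution $u_{LN}$ is the unique solution of $\Delta_g u-K_g=e^{2u}$ in $M$ with $u(p)\to+\infty$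 as $p\to\partial M$. *)

theory Defs
  imports "HOL-Analysis.Analysis"
begin

section \<open>Differentiability and Hoelder regularity up to the boundary\<close>

text \<open>
  The sets \<open>W\<close> below are relatively open subsets of a closed half-plane, or open subsets
  of the line.  All derivatives are Frechet derivatives within \<open>W\<close> (unique for such sets),
  so they are one-sided at boundary points.
\<close>

primrec Ck_on :: "nat \<Rightarrow> 'v::euclidean_space set \<Rightarrow> ('v \<Rightarrow> 'w::real_normed_vector) \<Rightarrow> bool" where
  "Ck_on 0 W f \<longleftrightarrow> continuous_on W f"
| "Ck_on (Suc k) W f \<longleftrightarrow> f differentiable_on W \<and>
     (\<forall>b\<in>Basis. Ck_on k W (\<lambda>x. frechet_derivative f (at x within W) b))"

definition smooth_on :: "'v::euclidean_space set \<Rightarrow> ('v \<Rightarrow> 'w::real_normed_vector) \<Rightarrow> bool" where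
  "smooth_on W f \<longleftrightarrow> (\<forall>k. Ck_on k W f)"

definition dir_deriv ::
    "'v::euclidean_space set \<Rightarrow> 'v \<Rightarrow> ('v \<Rightarrow> real) \<Rightarrow> 'v \<Rightarrow> real" where
  "dir_deriv W b f x = frechet_derivative f (at x within W) b"

definition holder_on :: "real \<Rightarrow> 'v::euclidean_space set \<Rightarrow> ('v \<Rightarrow> real) \<Rightarrow> bool" where
  "holder_on a K f \<longleftrightarrow>
     (\<exists>C. \<forall>x\<in>K. \<forall>y\<in>K. \<bar>f x - f y\<bar> \<le> C * dist x y powr a)"

definition C2_holder_on :: "real \<Rightarrow> 'v::euclidean_space set \<Rightarrow> ('v \<Rightarrow> real) \<Rightarrow> bool" where
  "C2_holder_on a W f \<longleftrightarrow> Ck_on 2 W f \<and>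
     (\<forall>K. compact K \<and> K \<subseteq> W \<longrightarrow>
        (\<forall>b\<in>Basis. \<forall>b'\<in>Basis. holder_on a K (dir_deriv W b' (dir_deriv W b f))))"

definition parabolic_holder_on ::
    "real \<Rightarrow> 'v::euclidean_space set \<Rightarrow> real set \<Rightarrow> ('v \<Rightarrow> real \<Rightarrow> real) \<Rightarrow> bool" where
  "parabolic_holder_on a K I f \<longleftrightarrow>
     (\<exists>C. \<forall>x\<in>K. \<forall>y\<in>K. \<forall>s\<in>I. \<forall>t\<in>I.
        \<bar>f x s - f y t\<bar> \<le> C * (dist x y powr a + \<bar>s - t\<bar> powr (a / 2)))"

text \<open>
  The space \<open>C\<^sup>2\<^sup>+\<^sup>a\<close> in space and \<open>C\<^sup>1\<^sup>+\<^sup>a\<^sup>/\<^sup>2\<close> in time, in the sense of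
  Ladyzhenskaya, Solonnikov and Ural'ceva, locally in \<open>W\<close> and up to both ends of \<open>[0,T]\<close>: the second space
  derivatives and the time derivative are Hoelder for the parabolic distance with exponent \<open>a\<close>,
  and the first space derivatives are Hoelder in time with exponent \<open>(1 + a)/2\<close>.
\<close>

definition C2_parabolic_holder_on ::
    "real \<Rightarrow> 'v::euclidean_space set \<Rightarrow> real \<Rightarrow> ('v \<Rightarrow> real \<Rightarrow> real) \<Rightarrow> bool" where
  "C2_parabolic_holder_on a W T f \<longleftrightarrow>
     (\<forall>t\<in>{0..T}. Ck_on 2 W (\<lambda>x. f x t)) \<and>
     (\<forall>x\<in>W. f x differentiable_on {0..T}) \<and>
     (\<forall>K. compact K \<and> K \<subseteq> W \<longrightarrow>
        parabolic_holder_on a K {0..T}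
          (\<lambda>x t. vector_derivative (f x) (at t within {0..T})) \<and>
        (\<forall>b\<in>Basis. \<forall>b'\<in>Basis. parabolic_holder_on a K {0..T}
          (\<lambda>x t. dir_deriv W b' (dir_deriv W b (\<lambda>z. f z t)) x)) \<and>
        (\<forall>b\<in>Basis. \<exists>C. \<forall>x\<in>K. \<forall>s\<in>{0..T}. \<forall>t\<in>{0..T}.
          \<bar>dir_deriv W b (\<lambda>z. f z s) x - dir_deriv W b (\<lambda>z. f z t) x\<bar>
            \<le> C * \<bar>s - t\<bar> powr ((1 + a) / 2)))"


section \<open>Compact Riemannian surfaces with boundary\<close>

text \<open>
  A surface is a topological space \<open>X\<close> with an atlas \<open>A\<close> of charts (domain and coordinate
  map) into the closed upper half-plane; \<open>A\<close> need not be maximal.  A metric \<open>G\<close> is given by its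
  coefficient matrices \<open>G c y\<close> at the point with coordinates \<open>y\<close> in the chart \<open>c\<close>.
\<close>

type_synonym 'a chart = "'a set \<times> ('a \<Rightarrow> real^2)"
type_synonym 'a metric_coeffs = "'a chart \<Rightarrow> real^2 \<Rightarrow> real^2^2"

definition half_plane :: "(real^2) set" where
  "half_plane = {y. 0 \<le> y $ 2}"

definition chart_range :: "'a chart \<Rightarrow> (real^2) set" where
  "chart_range c = snd c ` fst c"

definition chart_inv :: "'a chart \<Rightarrow> real^2 \<Rightarrow> 'a" where
  "chart_inv c = inv_into (fst c) (snd c)"

definition is_chart :: "'a topology \<Rightarrow> 'a chart \<Rightarrow> bool" where
  "is_chart X c \<longleftrightarrow> openin X (fst c) \<and> openin (top_of_set half_plane) (chart_range c) \<and>
     homeomorphic_map (subtopology X (fst c)) (top_of_set (chart_range c)) (snd c)"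

definition smooth_atlas :: "'a topology \<Rightarrow> 'a chart set \<Rightarrow> bool" where
  "smooth_atlas X A \<longleftrightarrow> (\<forall>c\<in>A. is_chart X c) \<and> (\<Union>c\<in>A. fst c) = topspace X \<and>
     (\<forall>c\<in>A. \<forall>d\<in>A. smooth_on (snd c ` (fst c \<inter> fst d)) (snd d \<circ> chart_inv c))"

definition riemannian_metric :: "'a chart set \<Rightarrow> 'a metric_coeffs \<Rightarrow> bool" where
  "riemannian_metric A G \<longleftrightarrow>
     (\<forall>c\<in>A. smooth_on (chart_range c) (G c) \<and>
        (\<forall>y\<in>chart_range c. transpose (G c y) = G c y \<and>
           (\<forall>v. v \<noteq> 0 \<longrightarrow> 0 < v \<bullet> (G c y *v v)))) \<and>
     (\<forall>c\<in>A. \<forall>d\<in>A. \<forall>p\<in>fst c \<inter> fst d. \<forall>v w.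
        let D = frechet_derivative (snd d \<circ> chart_inv c)
                  (at (snd c p) within snd c ` (fst c \<inter> fst d))
        in v \<bullet> (G c (snd c p) *v w) = D v \<bullet> (G d (snd d p) *v D w))"

definition compact_riemannian_surface ::
    "'a topology \<Rightarrow> 'a chart set \<Rightarrow> 'a metric_coeffs \<Rightarrow> bool" where
  "compact_riemannian_surface X A G \<longleftrightarrow>
     compact_space X \<and> Hausdorff_space X \<and> smooth_atlas X A \<and> riemannian_metric A G"

definition surface_boundary :: "'a chart set \<Rightarrow> 'a set" where
  "surface_boundary A = {p. \<exists>c\<in>A. p \<in> fst c \<and> snd c p $ 2 = 0}"

definition surface_interior :: "'a topology \<Rightarrow> 'a chart set \<Rightarrow> 'a set" where
  "surface_interior X A = topspace X - surface_boundary A"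


section \<open>Curvature, Laplacian and normal derivative\<close>

text \<open>In this section \<open>g\<close> is the coefficient matrix of a metric on a coordinate domain \<open>W\<close>.\<close>

abbreviation partial :: "(real^2) set \<Rightarrow> 2 \<Rightarrow> (real^2 \<Rightarrow> real) \<Rightarrow> real^2 \<Rightarrow> real" where
  "partial W i \<equiv> dir_deriv W (axis i 1)"

definition christoffel ::
    "(real^2) set \<Rightarrow> (real^2 \<Rightarrow> real^2^2) \<Rightarrow> 2 \<Rightarrow> 2 \<Rightarrow> 2 \<Rightarrow> real^2 \<Rightarrow> real" where
  "christoffel W g k i j y = (1/2) * (\<Sum>l\<in>UNIV. matrix_inv (g y) $ k $ l *
     (partial W i (\<lambda>z. g z $ j $ l) y + partial W j (\<lambda>z. g z $ i $ l) y
        - partial W l (\<lambda>z. g z $ i $ j) y))"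

text \<open>
  The \<open>l\<close>-th coefficient of \<open>R(e\<^sub>i,e\<^sub>j)e\<^sub>k\<close> for the coordinate fields \<open>e\<^sub>i\<close>, with
  \<open>R(X,Y)Z = \<nabla>\<^sub>X\<nabla>\<^sub>YZ - \<nabla>\<^sub>Y\<nabla>\<^sub>XZ - \<nabla>\<^bsub>[X,Y]\<^esub>Z\<close>; the Gauss curvature is
  \<open>g(R(e\<^sub>1,e\<^sub>2)e\<^sub>2,e\<^sub>1) / det g\<close>, so the round unit sphere has curvature \<open>1\<close>.
\<close>

definition riemann ::
    "(real^2) set \<Rightarrow> (real^2 \<Rightarrow> real^2^2) \<Rightarrow> 2 \<Rightarrow> 2 \<Rightarrow> 2 \<Rightarrow> 2 \<Rightarrow> real^2 \<Rightarrow> real" where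
  "riemann W g l i j k y =
     partial W i (christoffel W g l j k) y - partial W j (christoffel W g l i k) y +
     (\<Sum>m\<in>UNIV. christoffel W g m j k y * christoffel W g l i m y
        - christoffel W g m i k y * christoffel W g l j m y)"

definition gauss_coord :: "(real^2) set \<Rightarrow> (real^2 \<Rightarrow> real^2^2) \<Rightarrow> real^2 \<Rightarrow> real" where
  "gauss_coord W g y = (\<Sum>l\<in>UNIV. g y $ 1 $ l * riemann W g l 1 2 2 y) / det (g y)"

definition laplace_coord ::
    "(real^2) set \<Rightarrow> (real^2 \<Rightarrow> real^2^2) \<Rightarrow> (real^2 \<Rightarrow> real) \<Rightarrow> real^2 \<Rightarrow> real" where
  "laplace_coord W g f y = 1 / sqrt (det (g y)) * (\<Sum>i\<in>UNIV. partial W i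
     (\<lambda>z. \<Sum>j\<in>UNIV. sqrt (det (g z)) * matrix_inv (g z) $ i $ j * partial W j f z) y)"

text \<open>
  The unit field \<open>-\<nabla>y\<^sub>2/|\<nabla>y\<^sub>2|\<close>; along the boundary line \<open>y\<^sub>2 = 0\<close> it is the outward unit
  normal, since the surface lies in \<open>y\<^sub>2 \<ge> 0\<close>.
\<close>

definition normal_coord :: "(real^2 \<Rightarrow> real^2^2) \<Rightarrow> real^2 \<Rightarrow> real^2" where
  "normal_coord g y =
     (\<chi> i. - (matrix_inv (g y) $ i $ 2) / sqrt (matrix_inv (g y) $ 2 $ 2))"

text \<open>
  The geodesic curvature \<open>g(\<nabla>\<^sub>Tn,T) = -g(\<nabla>\<^sub>TT,n)\<close> of the line \<open>y\<^sub>2 = 0\<close>, where \<open>n\<close> is the outward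
  unit normal and \<open>T = e\<^sub>1/|e\<^sub>1|\<close> the unit tangent; it equals \<open>1\<close> for the Euclidean unit disk.
\<close>

definition geodesic_coord :: "(real^2) set \<Rightarrow> (real^2 \<Rightarrow> real^2^2) \<Rightarrow> real^2 \<Rightarrow> real" where
  "geodesic_coord W g y = (\<Sum>k\<in>UNIV. g y $ 1 $ k *
     (partial W 1 (\<lambda>z. normal_coord g z $ k) y +
      (\<Sum>m\<in>UNIV. christoffel W g k 1 m y * normal_coord g y $ m))) / g y $ 1 $ 1"

text \<open>The coordinate expressions are invariant, so any chart around the point may be used.\<close>

definition chart_at :: "'a chart set \<Rightarrow> 'a \<Rightarrow> 'a chart" where
  "chart_at A p = (SOME c. c \<in> A \<and> p \<in> fst c)"

definition gauss_curvature :: "'a chart set \<Rightarrow> 'a metric_coeffs \<Rightarrow> 'a \<Rightarrow> real" where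
  "gauss_curvature A G p =
     (let c = chart_at A p in gauss_coord (chart_range c) (G c) (snd c p))"

definition laplacian :: "'a chart set \<Rightarrow> 'a metric_coeffs \<Rightarrow> ('a \<Rightarrow> real) \<Rightarrow> 'a \<Rightarrow> real" where
  "laplacian A G f p =
     (let c = chart_at A p in laplace_coord (chart_range c) (G c) (f \<circ> chart_inv c) (snd c p))"

definition normal_derivative ::
    "'a chart set \<Rightarrow> 'a metric_coeffs \<Rightarrow> ('a \<Rightarrow> real) \<Rightarrow> 'a \<Rightarrow> real" where
  "normal_derivative A G f p =
     (let c = chart_at A p in \<Sum>i\<in>UNIV. normal_coord (G c) (snd c p) $ i *
        partial (chart_range c) i (f \<circ> chart_inv c) (snd c p))"

definition geodesic_curvature :: "'a chart set \<Rightarrow> 'a metric_coeffs \<Rightarrow> 'a \<Rightarrow> real" where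
  "geodesic_curvature A G p =
     (let c = chart_at A p in geodesic_coord (chart_range c) (G c) (snd c p))"

text \<open>The metric \<open>e\<^sup>2\<^sup>wg\<close>.\<close>

definition conformal_metric :: "('a \<Rightarrow> real) \<Rightarrow> 'a metric_coeffs \<Rightarrow> 'a metric_coeffs" where
  "conformal_metric w G c y = exp (2 * w (chart_inv c y)) *\<^sub>R G c y"


section \<open>The Cauchy-Dirichlet problem\<close>

text \<open>
  On a compact surface, lying in a Hoelder space is equivalent to lying in it locally in
  every chart.  The charts of the boundary are the restrictions of the charts to \<open>y\<^sub>2 = 0\<close>.
\<close>

definition C2_holder :: "'a chart set \<Rightarrow> real \<Rightarrow> ('a \<Rightarrow> real) \<Rightarrow> bool" where
  "C2_holder A a f \<longleftrightarrow> (\<forall>c\<in>A. C2_holder_on a (chart_range c) (f \<circ> chart_inv c))"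

definition C2_parabolic_holder ::
    "'a chart set \<Rightarrow> real \<Rightarrow> real \<Rightarrow> ('a \<Rightarrow> real \<Rightarrow> real) \<Rightarrow> bool" where
  "C2_parabolic_holder A a T u \<longleftrightarrow>
     (\<forall>c\<in>A. C2_parabolic_holder_on a (chart_range c) T (\<lambda>y. u (chart_inv c y)))"

definition C2_parabolic_holder_boundary ::
    "'a chart set \<Rightarrow> real \<Rightarrow> real \<Rightarrow> ('a \<Rightarrow> real \<Rightarrow> real) \<Rightarrow> bool" where
  "C2_parabolic_holder_boundary A a T \<phi> \<longleftrightarrow>
     (\<forall>c\<in>A. C2_parabolic_holder_on a {s::real. vector [s, 0] \<in> chart_range c} T
        (\<lambda>s. \<phi> (chart_inv c (vector [s, 0]))))"

definition time_deriv :: "('a \<Rightarrow> real \<Rightarrow> real) \<Rightarrow> 'a \<Rightarrow> real \<Rightarrow> real" where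
  "time_deriv u p t = vector_derivative (u p) (at t within {0..})"

definition low_speed_increasing :: "(real \<Rightarrow> real) \<Rightarrow> bool" where
  "low_speed_increasing \<xi> \<longleftrightarrow>
     Ck_on 1 {0..} \<xi> \<and> (\<forall>t\<ge>0. 0 < \<xi> t) \<and> filterlim \<xi> at_top at_top \<and>
     (\<exists>T>0. \<exists>\<tau>. 0 < \<tau> \<and> \<tau> < 1 \<and>
        (\<forall>t\<ge>T. vector_derivative \<xi> (at t within {0..}) \<le> \<tau>))"

definition admissible_pair ::
    "'a chart set \<Rightarrow> 'a metric_coeffs \<Rightarrow> real \<Rightarrow>
     ('a \<Rightarrow> real) \<Rightarrow> ('a \<Rightarrow> real \<Rightarrow> real) \<Rightarrow> bool" where
  "admissible_pair A G a u0 \<phi> \<longleftrightarrow>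
     C2_holder A a u0 \<and>
     (\<forall>T'>0. C2_parabolic_holder_boundary A a T' \<phi>) \<and>
     (\<forall>p\<in>surface_boundary A. u0 p = \<phi> p 0 \<and>
        time_deriv \<phi> p 0 =
          exp (- 2 * u0 p) * (laplacian A G u0 p - gauss_curvature A G p) - 1) \<and>
     (\<exists>T>0. \<forall>p\<in>surface_boundary A. \<forall>t\<ge>T. 0 \<le> time_deriv \<phi> p t) \<and>
     (\<exists>T\<^sub>1>0. \<exists>\<xi>. low_speed_increasing \<xi> \<and>
        (\<forall>p\<in>surface_boundary A. \<forall>t\<ge>T\<^sub>1. ln (\<xi> t) \<le> \<phi> p t))"

definition cauchy_dirichlet_solution ::
    "'a topology \<Rightarrow> 'a chart set \<Rightarrow> 'a metric_coeffs \<Rightarrow> real \<Rightarrow>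
     ('a \<Rightarrow> real) \<Rightarrow> ('a \<Rightarrow> real \<Rightarrow> real) \<Rightarrow> ('a \<Rightarrow> real \<Rightarrow> real) \<Rightarrow> bool" where
  "cauchy_dirichlet_solution X A G a u0 \<phi> u \<longleftrightarrow>
     (\<forall>T'>0. C2_parabolic_holder A a T' u) \<and>
     (\<forall>p\<in>surface_interior X A. \<forall>t\<ge>0. time_deriv u p t =
        exp (- 2 * u p t) * (laplacian A G (\<lambda>q. u q t) p - gauss_curvature A G p) - 1) \<and>
     (\<forall>p\<in>surface_boundary A. \<forall>t\<ge>0. u p t = \<phi> p t) \<and>
     (\<forall>p\<in>surface_interior X A. u p 0 = u0 p)"

end

theory Submission
  imports Defs
begin

text \<open>
  Put \<open>\<epsilon> = e\<^sup>-\<^sup>\<Phi>\<close>, where \<open>\<Phi>(t)\<close> is the common boundary value.  In a half-disc around a boundary point,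
  in the coordinates of a chart, let \<open>\<rho> \<ge> 0\<close> be a polynomial that vanishes on the edge of the half-disc.
  The function \<open>w = -(1/2) ln (\<epsilon>\<^sup>2 + 2\<epsilon>A\<rho>)\<close> with \<open>A = \<gamma>(\<surd>\<Phi> - \<surd>\<Phi>(T))\<close> and small \<open>\<gamma>\<close> is a supersolution:
  the growth of \<open>\<Phi>\<close> gives \<open>w\<^sub>t \<ge> \<Phi>'/4\<close>, while \<open>e\<^sup>-\<^sup>2\<^sup>w(\<Delta>w - K) - 1 \<le> \<Phi>/2\<close>.
  It equals \<open>\<Phi>\<close> on the edge and at the initial time, and \<open>u \<le> \<Phi>\<close> for large times by the maximum principle
  on the whole surface; hence \<open>u \<le> w\<close>, with equality on the boundary.  So
  \<open>e\<^sup>-\<^sup>u \<partial>u/\<partial>n\<close> dominates a multiple of \<open>A\<close>, which outgrows the cube root of \<open>\<Phi>\<close>.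

  The constants are uniform because the Laplacian, the normal derivative and the geodesic curvature do not
  depend on the chart.  Invariance of the Gauss curvature is not needed: the equation at \<open>t = 0\<close>
  expresses \<open>K\<close> through \<open>u\<close> and bounds it.
\<close>

section \<open>Derivatives within relatively open subsets of the half-plane\<close>

text \<open>The size of \<open>A\<close> is dictated by a quadratic term. With
  \<open>P = \<epsilon>^2 + 2 \<epsilon> A \<rho>\<close> one has \<open>exp (-2 w) = P\<close>, and
  \<open>P\<close> times the Laplacian of \<open>w\<close> equals \<open>- \<epsilon> A
  \<Delta>\<rho> + 2 (\<epsilon> A)^2 |\<nabla>\<rho>|^2 / P\<close>. Near the edge \<open>P\<close>
  is only of size \<open>\<epsilon>^2\<close>, so the last term is of order \<open>A^2\<close>. The
  growth of \<open>\<Phi>\<close> pays for it as long as \<open>A^2\<close> is at most a small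
  multiple of \<open>\<Phi>\<close>; this is the origin of the square root and of the small factor
  \<gamma>.

  \<open>A\<close> vanishes at the initial time because the only information there is
  \<open>u \<le> \<Phi>\<close>. The same inequality serves on the arc of the half-disc, where
  \<rho> vanishes too, so the comparison is purely local and asks for no distance function or collar
  of the boundary.

  On the boundary the gradient of \<open>w\<close> has size \<open>A / \<epsilon>\<close>, and the
  conformal factor \<open>exp (- u) = \<epsilon>\<close> cancels the denominator exactly. Since 1/3
  < 1/2, a cube root leaves room for every geometric constant and for the shift
  \<open>sqrt (\<Phi> T)\<close>.\<close>

abbreviation hopen :: "(real^2) set \<Rightarrow> bool" where
  "hopen W \<equiv> openin (top_of_set half_plane) W"

lemma hopenE:
  assumes "hopen W" "y \<in> W"
  obtains e where "e > 0" "ball y e \<inter> half_plane \<subseteq> W"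
  using assms unfolding openin_contains_ball by blast

lemma hopen_nonneg:
  assumes "hopen W" "y \<in> W"
  shows "0 \<le> y $ 2"
proof -
  have "W \<subseteq> half_plane" by (rule openin_imp_subset[OF assms(1)])
  with assms(2) show ?thesis by (auto simp: half_plane_def)
qed

lemma Basis_vec2: "(Basis :: (real^2) set) = {axis 1 1, axis 2 1}"
  by (auto simp: Basis_vec_def UNIV_2)

lemma vec2_expand: "(v::real^2) = v $ 1 *\<^sub>R axis 1 1 + v $ 2 *\<^sub>R axis 2 1"
  by (simp add: vec_eq_iff forall_2 axis_def)

lemma vec2_eqI: "v $ 1 = w $ 1 \<Longrightarrow> v $ 2 = w $ 2 \<Longrightarrow> v = (w :: 'b^2)"
  by (simp add: vec_eq_iff forall_2)

text \<open>A derivative within a set is unique once the set contains points \<open>y + d b\<close>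
  with arbitrarily small \<open>d\<close> for each basis vector \<open>b\<close>. Positive
  \<open>d\<close> never leaves the upper half-plane, so boundary points cause no trouble.\<close>

lemma hopen_derivative_unique:
  assumes W: "hopen W" and y: "y \<in> W"
    and "(f has_derivative F) (at y within W)" "(f has_derivative F') (at y within W)"
  shows "F = F'"
proof (rule frechet_derivative_unique_within[OF assms(3,4)])
  fix i :: "real^2" and e :: real
  assume i: "i \<in> Basis" and e: "e > 0"
  obtain r where r: "r > 0" "ball y r \<inter> half_plane \<subseteq> W" by (rule hopenE[OF W y])
  define d where "d = min e r / 2"
  have d: "0 < d" "d < e" "d < r" using e r by (auto simp: d_def)
  have "y + d *\<^sub>R i \<in> ball y r" using d i by (simp add: dist_norm)
  moreover have "y + d *\<^sub>R i \<in> half_plane"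
    using hopen_nonneg[OF W y] d i by (auto simp: half_plane_def Basis_vec2 axis_def)
  ultimately show "\<exists>d. 0 < \<bar>d\<bar> \<and> \<bar>d\<bar> < e \<and> y + d *\<^sub>R i \<in> W"
    using r d by (intro exI[of _ d]) auto
qed

lemma hopen_frechet_derivative:
  assumes "hopen W" "y \<in> W" "(f has_derivative F) (at y within W)"
  shows "frechet_derivative f (at y within W) = F"
  using assms hopen_derivative_unique frechet_derivative_works differentiableI by blast

lemma partial_eq:
  assumes "hopen W" "y \<in> W" "(f has_derivative F) (at y within W)"
  shows "partial W i f y = F (axis i 1)"
  using hopen_frechet_derivative[OF assms] by (simp add: dir_deriv_def)

lemma linear_vec2:
  fixes F :: "real^2 \<Rightarrow> 'b::real_vector"
  assumes "linear F"
  shows "F v = v $ 1 *\<^sub>R F (axis 1 1) + v $ 2 *\<^sub>R F (axis 2 1)"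
  by (subst vec2_expand[of v]) (simp add: linear_add[OF assms] linear_scale[OF assms])

lemma has_derivative_partials:
  assumes "hopen W" "y \<in> W" "f differentiable (at y within W)"
  shows "(f has_derivative (\<lambda>v. v $ 1 * partial W 1 f y + v $ 2 * partial W 2 f y)) (at y within W)"
proof -
  obtain F where F: "(f has_derivative F) (at y within W)"
    using assms(3) unfolding differentiable_def by blast
  have "F = (\<lambda>v. v $ 1 * partial W 1 f y + v $ 2 * partial W 2 f y)"
    unfolding partial_eq[OF assms(1,2) F]
    using linear_vec2[OF has_derivative_linear[OF F]] unfolding real_scaleR_def by (rule ext)
  with F show ?thesis by simp
qed

text \<open>Near \<open>y\<close> both sets coincide with the half-plane. Hence derivatives may be
  moved freely between a chart range, an overlap of charts and a half-disc.\<close>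

lemma at_within_hopen:
  assumes "hopen V" "hopen W" "V \<subseteq> W" "y \<in> V"
  shows "at y within V = at y within W"
proof -
  obtain e where e: "e > 0" "ball y e \<inter> half_plane \<subseteq> V" by (rule hopenE[OF assms(1,4)])
  have "V \<subseteq> half_plane" "W \<subseteq> half_plane"
    using assms(1,2) openin_imp_subset by blast+
  then show ?thesis
    using e assms(3) by (intro at_within_nhd[of y "ball y e"]) auto
qed

lemma at_within_hopen_interior:
  assumes "hopen W" "y \<in> W" "0 < y $ 2"
  shows "at y within W = at y" "\<exists>e>0. ball y e \<subseteq> W"
proof -
  obtain e where e: "e > 0" "ball y e \<inter> half_plane \<subseteq> W" by (rule hopenE[OF assms(1,2)])
  define r where "r = min e (y $ 2)"
  have "ball y r \<subseteq> half_plane"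
  proof
    fix z assume "z \<in> ball y r"
    then have "\<bar>y $ 2 - z $ 2\<bar> < y $ 2"
      using component_le_norm_cart[of "y - z" 2] by (auto simp: r_def dist_norm)
    then show "z \<in> half_plane" by (auto simp: half_plane_def)
  qed
  then have r: "r > 0" "ball y r \<subseteq> W" using e assms(3) by (auto simp: r_def)
  then show "\<exists>e>0. ball y e \<subseteq> W" by blast
  have "y \<in> interior W" using r by (meson centre_in_ball interior_maximal open_ball subsetD)
  then show "at y within W = at y" by (rule at_within_interior)
qed

section \<open>Regularity classes up to the boundary\<close>

lemma Ck_on_cong:
  fixes f g :: "'v::euclidean_space \<Rightarrow> 'w::real_normed_vector"
  assumes "\<And>x. x \<in> W \<Longrightarrow> f x = g x"
  shows "Ck_on k W f \<longleftrightarrow> Ck_on k W g"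
  using assms
proof (induction k arbitrary: f g)
  case 0
  then show ?case by (simp cong: continuous_on_cong)
next
  case (Suc k)
  have hd: "(f has_derivative F) (at x within W) \<longleftrightarrow> (g has_derivative F) (at x within W)"
    if "x \<in> W" for x F
    using Suc.prems that by (metis has_derivative_transform)
  have "frechet_derivative f (at x within W) = frechet_derivative g (at x within W)"
    if "x \<in> W" for x
    using hd[OF that] by (simp add: frechet_derivative_def)
  then have "Ck_on k W (\<lambda>x. frechet_derivative f (at x within W) b) \<longleftrightarrow>
      Ck_on k W (\<lambda>x. frechet_derivative g (at x within W) b)" for b
    by (intro Suc.IH) simp
  moreover have "f differentiable_on W \<longleftrightarrow> g differentiable_on W"
    using hd by (simp add: differentiable_on_def differentiable_def)
  ultimately show ?case by simp
qed

text \<open>Smoothness of metrics and transition maps is stated for matrix and vector valued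
  functions; applied to coordinate projections, this yields the scalar components used in all
  computations.\<close>

lemma Ck_on_bounded_linear:
  fixes f :: "real^2 \<Rightarrow> 'w::real_normed_vector"
  assumes "hopen W" "bounded_linear L" "Ck_on k W f"
  shows "Ck_on k W (\<lambda>x. L (f x))"
  using assms(3)
proof (induction k arbitrary: f)
  case 0
  then show ?case
    using assms(2) by (simp add: bounded_linear.continuous_on)
next
  case (Suc k)
  have hd: "((\<lambda>x. L (f x)) has_derivative (\<lambda>v. L (frechet_derivative f (at x within W) v))) (at x within W)"
    if "x \<in> W" for x
    using Suc.prems that
    by (intro bounded_linear.has_derivative[OF assms(2)])
       (simp add: differentiable_on_def frechet_derivative_works)
  have "Ck_on k W (\<lambda>x. frechet_derivative (\<lambda>x. L (f x)) (at x within W) b)" if "b \<in> Basis" for b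
  proof -
    have "Ck_on k W (\<lambda>x. L (frechet_derivative f (at x within W) b))"
      using Suc that by simp
    then show ?thesis
      by (subst Ck_on_cong[where g = "\<lambda>x. L (frechet_derivative f (at x within W) b)"])
         (simp_all add: hopen_frechet_derivative[OF assms(1) _ hd])
  qed
  moreover have "(\<lambda>x. L (f x)) differentiable_on W"
    using hd by (auto simp: differentiable_on_def differentiable_def)
  ultimately show ?case by simp
qed

lemma smooth_on_component:
  assumes "hopen W" "smooth_on W (f :: real^2 \<Rightarrow> real^'n)"
  shows "smooth_on W (\<lambda>x. f x $ i)"
  using assms Ck_on_bounded_linear[OF assms(1) bounded_linear_vec_nth]
  by (auto simp: smooth_on_def)

lemma smooth_on_component2:
  assumes "hopen W" "smooth_on W (f :: real^2 \<Rightarrow> real^'n^'m)"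
  shows "smooth_on W (\<lambda>x. f x $ i $ j)"
  unfolding smooth_on_def
proof
  fix k
  have "bounded_linear (\<lambda>x::real^'n^'m. x $ i $ j)"
    by (intro bounded_linear_compose[OF bounded_linear_vec_nth bounded_linear_vec_nth])
  from Ck_on_bounded_linear[OF assms(1) this] assms(2)
  show "Ck_on k W (\<lambda>x. f x $ i $ j)" by (simp add: smooth_on_def)
qed

lemma axis_Basis [simp]: "axis i (1::real) \<in> Basis"
  by (simp add: axis_in_Basis_iff)

lemma Ck2D:
  fixes f :: "real^2 \<Rightarrow> real"
  assumes "Ck_on 2 W f"
  shows "y \<in> W \<Longrightarrow> f differentiable (at y within W)"
    and "y \<in> W \<Longrightarrow> partial W i f differentiable (at y within W)"
    and "continuous_on W (partial W j (partial W i f))"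
    and "continuous_on W (partial W i f)" and "continuous_on W f"
proof -
  have f: "f differentiable_on W"
    and d: "\<And>i. Ck_on (Suc 0) W (partial W i f)"
    using assms by (auto simp: numeral_2_eq_2 dir_deriv_def[abs_def])
  then show "y \<in> W \<Longrightarrow> f differentiable (at y within W)" "continuous_on W f"
    by (auto simp: differentiable_on_def differentiable_imp_continuous_on)
  have "partial W i f differentiable_on W" using d[of i] by simp
  then show "y \<in> W \<Longrightarrow> partial W i f differentiable (at y within W)" "continuous_on W (partial W i f)"
    by (auto simp: differentiable_on_def differentiable_imp_continuous_on)
  show "continuous_on W (partial W j (partial W i f))"
    using d[of i] by (simp add: dir_deriv_def)
qed

section \<open>Restriction to segments and symmetry of second derivatives\<close>

lemma has_derivative_along:
  fixes f :: "'v::real_normed_vector \<Rightarrow> 'w::real_normed_vector"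
  assumes "(f has_derivative F) (at (y + s *\<^sub>R v) within W)" "\<And>s. s \<in> I \<Longrightarrow> y + s *\<^sub>R v \<in> W"
  shows "((\<lambda>s. f (y + s *\<^sub>R v)) has_derivative (\<lambda>r. F (r *\<^sub>R v))) (at s within I)"
proof -
  have g: "((\<lambda>s. y + s *\<^sub>R v) has_derivative (\<lambda>r. r *\<^sub>R v)) (at s within I)"
    by (auto intro!: derivative_eq_intros)
  have "(\<lambda>s. y + s *\<^sub>R v) ` I \<subseteq> W" using assms(2) by blast
  then show ?thesis
    by (intro has_derivative_in_compose[OF g has_derivative_subset[OF assms(1)]])
qed

lemma partial_increment:
  assumes "hopen W" "\<And>s. s \<in> {0..h} \<Longrightarrow> y + s *\<^sub>R axis i 1 \<in> W" "0 \<le> h"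
    and "\<And>z. z \<in> W \<Longrightarrow> f differentiable (at z within W)"
  shows "\<exists>s\<in>{0..h}. f (y + h *\<^sub>R axis i 1) - f y = h * partial W i f (y + s *\<^sub>R axis i 1)"
proof -
  have hd: "((\<lambda>s. f (y + s *\<^sub>R axis i 1)) has_derivative
      (\<lambda>r. r * partial W i f (y + s *\<^sub>R axis i 1))) (at s within {0..h})" if "s \<in> {0..h}" for s
  proof -
    let ?F = "frechet_derivative f (at (y + s *\<^sub>R axis i 1) within W)"
    have F: "(f has_derivative ?F) (at (y + s *\<^sub>R axis i 1) within W)"
      using assms(2,4) that frechet_derivative_works by blast
    have "?F (r *\<^sub>R axis i 1) = r * partial W i f (y + s *\<^sub>R axis i 1)" for r
      using linear_scale[OF has_derivative_linear[OF F]] by (simp add: dir_deriv_def)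
    with has_derivative_along[OF F, of "{0..h}"] assms(2) show ?thesis by simp
  qed
  from mvt_very_simple[OF assms(3) hd] show ?thesis by auto
qed

text \<open>The mean value theorem is used twice: in direction \<open>i\<close> for the difference
  of \<open>f\<close> on two opposite sides of the square, then in direction \<open>j\<close> for
  \<open>partial W i f\<close>. The left side is symmetric in \<open>i\<close> and \<open>j\<close>,
  the right side records the order of differentiation.\<close>

lemma square_increment:
  assumes W: "hopen W" and f: "Ck_on 2 W f" and h: "0 \<le> h"
    and inW: "\<And>s t. s \<in> {0..h} \<Longrightarrow> t \<in> {0..h} \<Longrightarrow> y + s *\<^sub>R axis i 1 + t *\<^sub>R axis j 1 \<in> W"
  shows "\<exists>s\<in>{0..h}. \<exists>t\<in>{0..h}.
    f (y + h *\<^sub>R axis i 1 + h *\<^sub>R axis j 1) - f (y + h *\<^sub>R axis j 1) - f (y + h *\<^sub>R axis i 1) + f y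
      = h * (h * partial W j (partial W i f) (y + s *\<^sub>R axis i 1 + t *\<^sub>R axis j 1))"
proof -
  let ?i = "axis i 1 :: real^2" and ?j = "axis j 1 :: real^2"
  let ?z = "y + h *\<^sub>R ?j"
  have z: "0 \<in> {0..h}" "h \<in> {0..h}" using h by auto
  have in1: "y + s *\<^sub>R ?i \<in> W" and in2: "?z + s *\<^sub>R ?i \<in> W" if "s \<in> {0..h}" for s
    using inW[OF that z(1)] inW[OF that z(2)] by (simp_all add: add.commute add.left_commute)
  have hd: "((\<lambda>s. f (x + s *\<^sub>R ?i)) has_derivative (\<lambda>r. r * partial W i f (x + s *\<^sub>R ?i))) (at s within {0..h})"
    if "s \<in> {0..h}" "\<And>s. s \<in> {0..h} \<Longrightarrow> x + s *\<^sub>R ?i \<in> W" for s x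
  proof -
    let ?F = "frechet_derivative f (at (x + s *\<^sub>R ?i) within W)"
    have F: "(f has_derivative ?F) (at (x + s *\<^sub>R ?i) within W)"
      using Ck2D(1)[OF f] that frechet_derivative_works by blast
    have "?F (r *\<^sub>R ?i) = r * partial W i f (x + s *\<^sub>R ?i)" for r
      using linear_scale[OF has_derivative_linear[OF F]] by (simp add: dir_deriv_def)
    with has_derivative_along[OF F, of "{0..h}"] that show ?thesis by simp
  qed
  have "((\<lambda>s. f (?z + s *\<^sub>R ?i) - f (y + s *\<^sub>R ?i)) has_derivative
      (\<lambda>r. r * partial W i f (?z + s *\<^sub>R ?i) - r * partial W i f (y + s *\<^sub>R ?i))) (at s within {0..h})"
    if "s \<in> {0..h}" for s
    by (intro has_derivative_diff hd that in1 in2)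
  from mvt_very_simple[OF h this] obtain s where s: "s \<in> {0..h}"
    and D1: "(f (?z + h *\<^sub>R ?i) - f (y + h *\<^sub>R ?i)) - (f ?z - f y)
      = h * (partial W i f (?z + s *\<^sub>R ?i) - partial W i f (y + s *\<^sub>R ?i))"
    by (auto simp: right_diff_distrib)
  have "\<exists>t\<in>{0..h}. partial W i f (y + s *\<^sub>R ?i + h *\<^sub>R ?j) - partial W i f (y + s *\<^sub>R ?i)
      = h * partial W j (partial W i f) (y + s *\<^sub>R ?i + t *\<^sub>R ?j)"
    by (intro partial_increment[OF W inW[OF s] h Ck2D(2)[OF f]])
  then obtain t where t: "t \<in> {0..h}" and D2: "partial W i f (?z + s *\<^sub>R ?i) - partial W i f (y + s *\<^sub>R ?i)
      = h * partial W j (partial W i f) (y + s *\<^sub>R ?i + t *\<^sub>R ?j)"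
    by (auto simp: add.commute add.left_commute)
  have "f (y + h *\<^sub>R ?i + h *\<^sub>R ?j) = f (?z + h *\<^sub>R ?i)"
    by (simp add: add.commute add.left_commute)
  with D1 D2 s t show ?thesis by (intro bexI[of _ s] bexI[of _ t]) simp_all
qed

text \<open>The double mean value theorem is applied on a square that extends into \<open>y\<^sub>2 \<ge> 0\<close>, so
  boundary points are covered as well.\<close>

lemma partial_commute:
  assumes W: "hopen W" and f: "Ck_on 2 W f" and y: "y \<in> W"
  shows "partial W i (partial W j f) y = partial W j (partial W i f) y"
proof (rule ccontr)
  let ?a = "partial W i (partial W j f)" and ?b = "partial W j (partial W i f)"
  assume ne: "?a y \<noteq> ?b y"
  obtain e where e: "e > 0" "ball y e \<inter> half_plane \<subseteq> W" by (rule hopenE[OF W y])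
  have in_W: "y + s *\<^sub>R axis k 1 + t *\<^sub>R axis l 1 \<in> W \<and> dist (y + s *\<^sub>R axis k 1 + t *\<^sub>R axis l 1) y \<le> 2 * h"
    if "s \<in> {0..h}" "t \<in> {0..h}" "2 * h < e" for s t h k l
  proof -
    have "norm (s *\<^sub>R axis k 1 + t *\<^sub>R axis l 1 :: real^2) \<le> \<bar>s\<bar> + \<bar>t\<bar>"
      using norm_triangle_ineq[of "s *\<^sub>R axis k 1 :: real^2" "t *\<^sub>R axis l 1"] by simp
    then have n: "norm (s *\<^sub>R axis k 1 + t *\<^sub>R axis l 1 :: real^2) \<le> 2 * h" using that by auto
    moreover have "dist (y + s *\<^sub>R axis k 1 + t *\<^sub>R axis l 1) y = norm (s *\<^sub>R axis k 1 + t *\<^sub>R axis l 1 :: real^2)"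
      by (simp add: dist_norm add.assoc)
    moreover have "0 \<le> (y + s *\<^sub>R axis k 1 + t *\<^sub>R axis l 1) $ 2"
      using that hopen_nonneg[OF W y] by (simp add: axis_def)
    ultimately show ?thesis
      using e that by (auto simp: half_plane_def dist_commute subset_iff)
  qed
  define d where "d = \<bar>?a y - ?b y\<bar> / 2"
  have d: "d > 0" using ne by (simp add: d_def)
  obtain r1 where r1: "r1 > 0" "\<And>z. z \<in> W \<Longrightarrow> dist z y < r1 \<Longrightarrow> dist (?a z) (?a y) < d"
    using Ck2D(3)[OF f] y d unfolding continuous_on_iff by meson
  obtain r2 where r2: "r2 > 0" "\<And>z. z \<in> W \<Longrightarrow> dist z y < r2 \<Longrightarrow> dist (?b z) (?b y) < d"
    using Ck2D(3)[OF f] y d unfolding continuous_on_iff by meson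
  \<comment> \<open>The square of side \<open>h\<close> stays within distance \<open>2 h\<close> of
    \<open>y\<close>, hence in \<open>W\<close> and where both mixed derivatives differ from their
    values at \<open>y\<close> by less than half the supposed discrepancy.\<close>
  define h where "h = min e (min r1 r2) / 4"
  have h: "0 < h" "2 * h < e" "2 * h < r1" "2 * h < r2" using e r1 r2 by (auto simp: h_def)
  note in_W' = in_W[OF _ _ h(2), THEN conjunct1]
  obtain s t where st: "s \<in> {0..h}" "t \<in> {0..h}" and 1:
    "f (y + h *\<^sub>R axis i 1 + h *\<^sub>R axis j 1) - f (y + h *\<^sub>R axis j 1) - f (y + h *\<^sub>R axis i 1) + f y
      = h * (h * ?b (y + s *\<^sub>R axis i 1 + t *\<^sub>R axis j 1))"
    using square_increment[OF W f less_imp_le[OF h(1)] in_W', of i j, simplified] by blast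
  obtain s' t' where st': "s' \<in> {0..h}" "t' \<in> {0..h}" and 2:
    "f (y + h *\<^sub>R axis j 1 + h *\<^sub>R axis i 1) - f (y + h *\<^sub>R axis i 1) - f (y + h *\<^sub>R axis j 1) + f y
      = h * (h * ?a (y + s' *\<^sub>R axis j 1 + t' *\<^sub>R axis i 1))"
    using square_increment[OF W f less_imp_le[OF h(1)] in_W', of j i, simplified] by blast
  have "f (y + h *\<^sub>R axis j 1 + h *\<^sub>R axis i 1) = f (y + h *\<^sub>R axis i 1 + h *\<^sub>R axis j 1)"
    by (simp add: add.commute add.left_commute)
  with 1 2 have "h * (h * ?a (y + s' *\<^sub>R axis j 1 + t' *\<^sub>R axis i 1)) = h * (h * ?b (y + s *\<^sub>R axis i 1 + t *\<^sub>R axis j 1))"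
    by linarith
  then have eq: "?a (y + s' *\<^sub>R axis j 1 + t' *\<^sub>R axis i 1) = ?b (y + s *\<^sub>R axis i 1 + t *\<^sub>R axis j 1)"
    using h(1) by simp
  have "dist (?a (y + s' *\<^sub>R axis j 1 + t' *\<^sub>R axis i 1)) (?a y) < d"
    using in_W[OF st' h(2), of j i] h by (intro r1) auto
  moreover have "dist (?b (y + s *\<^sub>R axis i 1 + t *\<^sub>R axis j 1)) (?b y) < d"
    using in_W[OF st h(2), of i j] h by (intro r2) auto
  ultimately have "\<bar>?a y - ?b y\<bar> < 2 * d"
    unfolding eq dist_real_def by linarith
  then show False by (simp add: d_def)
qed

section \<open>Metrics in coordinates\<close>

definition spd :: "real^2^2 \<Rightarrow> bool" where
  "spd M \<longleftrightarrow> transpose M = M \<and> (\<forall>v. v \<noteq> 0 \<longrightarrow> 0 < v \<bullet> (M *v v))"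

lemma inner_vec2: "(v::real^2) \<bullet> w = v $ 1 * w $ 1 + v $ 2 * w $ 2"
  by (simp add: inner_vec_def sum_2)

lemma axis2_nth [simp]:
  "axis (1::2) a $ 1 = a" "axis (1::2) a $ 2 = 0" "axis (2::2) a $ 1 = 0" "axis (2::2) a $ 2 = a"
  by (simp_all add: axis_def)

lemma mult_vec2_nth: "((M::real^2^2) *v v) $ i = M $ i $ 1 * v $ 1 + M $ i $ 2 * v $ 2"
  by (simp add: matrix_vector_mult_def sum_2)

lemma inner_axis_matrix: "axis i 1 \<bullet> ((M::real^2^2) *v axis j 1) = M $ i $ j"
  using exhaust_2[of i] exhaust_2[of j] by (auto simp: inner_vec2 mult_vec2_nth)

lemma spd_sym: "spd M \<Longrightarrow> M $ 2 $ 1 = M $ 1 $ 2"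
  unfolding spd_def transpose_def vec_eq_iff by auto

lemma spd_pos:
  assumes "spd M"
  shows "0 < M $ 1 $ 1" "0 < M $ 2 $ 2" "0 < det M"
proof -
  have pos: "0 < v \<bullet> (M *v v)" if "v \<noteq> 0" for v using assms that by (auto simp: spd_def)
  show M11: "0 < M $ 1 $ 1"
    using pos[of "axis 1 1"] by (simp add: inner_axis_matrix axis_eq_0_iff)
  show "0 < M $ 2 $ 2"
    using pos[of "axis 2 1"] by (simp add: inner_axis_matrix axis_eq_0_iff)
  \<comment> \<open>At this vector the quadratic form equals the first diagonal entry times the
    determinant.\<close>
  define v :: "real^2" where "v = vector [- M $ 1 $ 2, M $ 1 $ 1]"
  have "v $ 2 \<noteq> 0" using M11 by (simp add: v_def)
  then have "0 < v \<bullet> (M *v v)" by (intro pos) auto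
  also have "v \<bullet> (M *v v) = M $ 1 $ 1 * det M"
    using spd_sym[OF assms] by (simp add: v_def inner_vec2 mult_vec2_nth det_2 algebra_simps)
  finally show "0 < det M" using M11 by (simp add: zero_less_mult_iff)
qed

text \<open>This is the adjugate matrix. In the index type \<open>2\<close> the map
  \<open>i \<mapsto> 3 - i\<close> exchanges the two indices.\<close>

definition cof :: "real^2^2 \<Rightarrow> 2 \<Rightarrow> 2 \<Rightarrow> real" where
  "cof M i j = (if i = j then M $ (3 - i) $ (3 - i) else - M $ i $ j)"

lemma cof_simps [simp]:
  "cof M 1 1 = M $ 2 $ 2" "cof M 2 2 = M $ 1 $ 1" "cof M 1 2 = - M $ 1 $ 2" "cof M 2 1 = - M $ 2 $ 1"
proof -
  have "(3::2) - 1 = 2" "(3::2) - 2 = 1" by auto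
  then show "cof M 1 1 = M $ 2 $ 2" "cof M 2 2 = M $ 1 $ 1" "cof M 1 2 = - M $ 1 $ 2" "cof M 2 1 = - M $ 2 $ 1"
    by (simp_all add: cof_def)
qed

lemma matrix_inv_nth:
  assumes "det (M::real^2^2) \<noteq> 0"
  shows "matrix_inv M $ i $ j = cof M i j / det M"
proof -
  define B :: "real^2^2" where "B = (\<chi> i j. cof M i j / det M)"
  have inv: "M ** B = mat 1" "B ** M = mat 1"
    using assms
    by (simp_all add: vec_eq_iff forall_2 matrix_matrix_mult_def sum_2 mat_def B_def divide_simps)
       (simp_all add: det_2 algebra_simps)
  have "M ** matrix_inv M = mat 1 \<and> matrix_inv M ** M = mat 1"
    unfolding matrix_inv_def by (rule someI[of _ B]) (simp add: inv)
  then have "matrix_inv M = B"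
    using inv by (metis matrix_mul_assoc matrix_mul_lid matrix_mul_rid)
  then show ?thesis by (simp add: B_def)
qed

text \<open>One derivative of the coefficients is what the Laplacian, the normal and the geodesic
  curvature involve. Continuity of that derivative is supplied separately through
  \<open>Ck_on 2\<close> where bounds on compact sets are derived.\<close>

definition metric_on :: "(real^2) set \<Rightarrow> (real^2 \<Rightarrow> real^2^2) \<Rightarrow> bool" where
  "metric_on W g \<longleftrightarrow> hopen W \<and>
     (\<forall>y\<in>W. spd (g y) \<and> (\<forall>i j. (\<lambda>z. g z $ i $ j) differentiable (at y within W)))"

lemma metric_onD:
  assumes "metric_on W g"
  shows "hopen W" "y \<in> W \<Longrightarrow> spd (g y)"
    "y \<in> W \<Longrightarrow> (\<lambda>z. g z $ i $ j) differentiable (at y within W)"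
    "y \<in> W \<Longrightarrow> 0 < det (g y)"
  using assms spd_pos(3) by (auto simp: metric_on_def)

lemma partial_local:
  assumes "hopen U" "hopen W" "U \<subseteq> W" "y \<in> U" "\<And>z. z \<in> U \<Longrightarrow> \<phi> z = \<phi>' z"
  shows "partial W i \<phi> y = partial U i \<phi>' y"
proof -
  have "(\<phi> has_derivative F) (at y within U) \<longleftrightarrow> (\<phi>' has_derivative F) (at y within U)" for F
    using assms(4,5) by (metis has_derivative_transform)
  then show ?thesis
    by (simp add: dir_deriv_def frechet_derivative_def at_within_hopen[OF assms(1-4)])
qed

lemma partial_arith:
  assumes "hopen W" "y \<in> W" "p differentiable (at y within W)" "q differentiable (at y within W)"
  shows "partial W i (\<lambda>z. p z + q z) y = partial W i p y + partial W i q y"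
    and "partial W i (\<lambda>z. p z - q z) y = partial W i p y - partial W i q y"
    and "partial W i (\<lambda>z. p z * q z) y = partial W i p y * q y + p y * partial W i q y"
    and "partial W i (\<lambda>z. - p z) y = - partial W i p y"
    and "partial W i (\<lambda>z. c * p z) y = c * partial W i p y"
proof -
  let ?P = "frechet_derivative p (at y within W)" and ?Q = "frechet_derivative q (at y within W)"
  have P: "(p has_derivative ?P) (at y within W)" and Q: "(q has_derivative ?Q) (at y within W)"
    using assms(3,4) frechet_derivative_works by blast+
  note eq = partial_eq[OF assms(1,2)]
  show "partial W i (\<lambda>z. p z + q z) y = partial W i p y + partial W i q y"
    by (subst eq[OF has_derivative_add[OF P Q]]) (simp add: dir_deriv_def)
  show "partial W i (\<lambda>z. p z - q z) y = partial W i p y - partial W i q y"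
    by (subst eq[OF has_derivative_diff[OF P Q]]) (simp add: dir_deriv_def)
  show "partial W i (\<lambda>z. p z * q z) y = partial W i p y * q y + p y * partial W i q y"
    by (subst eq[OF has_derivative_mult[OF P Q]]) (simp add: dir_deriv_def)
  show "partial W i (\<lambda>z. - p z) y = - partial W i p y"
    by (subst eq[OF has_derivative_minus[OF P]]) (simp add: dir_deriv_def)
  show "partial W i (\<lambda>z. c * p z) y = c * partial W i p y"
    by (subst eq[OF has_derivative_mult_right[OF P]]) (simp add: dir_deriv_def)
qed

lemma partial_div_sqrt:
  assumes W: "hopen W" "y \<in> W" and p: "p differentiable (at y within W)"
    and q: "q differentiable (at y within W)" "0 < q y"
  shows "(\<lambda>z. p z / sqrt (q z)) differentiable (at y within W)"
    and "partial W i (\<lambda>z. p z / sqrt (q z)) y =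
      partial W i p y / sqrt (q y) - p y * partial W i q y / (2 * q y * sqrt (q y))"
proof -
  let ?P = "frechet_derivative p (at y within W)" and ?Q = "frechet_derivative q (at y within W)"
  have P: "(p has_derivative ?P) (at y within W)" and Q: "(q has_derivative ?Q) (at y within W)"
    using p q frechet_derivative_works by blast+
  have sq: "sqrt (q y) * sqrt (q y) = q y" "sqrt (q y) > 0" using q by auto
  have "((\<lambda>z. p z / sqrt (q z)) has_derivative
      (\<lambda>v. ?P v / sqrt (q y) - p y * ?Q v / (2 * q y * sqrt (q y)))) (at y within W)"
    by (rule derivative_eq_intros P Q refl | use sq in force)+
       (use sq q(2) in \<open>auto simp: fun_eq_iff field_simps power2_eq_square\<close>)
  then show "(\<lambda>z. p z / sqrt (q z)) differentiable (at y within W)"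
    "partial W i (\<lambda>z. p z / sqrt (q z)) y =
      partial W i p y / sqrt (q y) - p y * partial W i q y / (2 * q y * sqrt (q y))"
    using partial_eq[OF W] by (force simp: differentiable_def, fastforce simp: dir_deriv_def)
qed

section \<open>The Laplacian in divergence form and in expanded form\<close>

definition dens :: "(real^2 \<Rightarrow> real^2^2) \<Rightarrow> 2 \<Rightarrow> 2 \<Rightarrow> real^2 \<Rightarrow> real" where
  "dens g i j z = sqrt (det (g z)) * matrix_inv (g z) $ i $ j"

text \<open>The first-order coefficients of the Laplacian, classically the contraction
  \<open>- g^(ik) \<Gamma>^j_(ik)\<close>. At a spatial maximum they multiply a vanishing gradient,
  so only the second-order part matters there.\<close>

definition drift :: "(real^2) set \<Rightarrow> (real^2 \<Rightarrow> real^2^2) \<Rightarrow> 2 \<Rightarrow> real^2 \<Rightarrow> real" where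
  "drift W g j y = (\<Sum>i\<in>UNIV. partial W i (dens g i j) y) / sqrt (det (g y))"

lemma dens_eq:
  assumes "0 < det (g z)"
  shows "dens g i j z = cof (g z) i j / sqrt (det (g z))"
proof -
  have "sqrt (det (g z)) * sqrt (det (g z)) = det (g z)" using assms by simp
  then show ?thesis
    using assms by (simp add: dens_def matrix_inv_nth field_simps)
qed

lemma cof_differentiable:
  assumes "metric_on W g" "y \<in> W"
  shows "(\<lambda>z. cof (g z) i j) differentiable (at y within W)"
    and "(\<lambda>z. det (g z)) differentiable (at y within W)"
proof -
  show "(\<lambda>z. cof (g z) i j) differentiable (at y within W)"
    using metric_onD(3)[OF assms] exhaust_2[of i] exhaust_2[of j]
    by (auto intro!: derivative_intros)
  show "(\<lambda>z. det (g z)) differentiable (at y within W)"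
    unfolding det_2 using metric_onD(3)[OF assms] by (intro derivative_intros)
qed

lemma dens_partial:
  assumes "metric_on W g" "y \<in> W"
  shows "dens g i j differentiable (at y within W)"
    and "partial W k (dens g i j) y =
      partial W k (\<lambda>z. cof (g z) i j) y / sqrt (det (g y))
        - cof (g y) i j * partial W k (\<lambda>z. det (g z)) y / (2 * det (g y) * sqrt (det (g y)))"
proof -
  note W = metric_onD(1)[OF assms(1)]
  have eq: "dens g i j z = cof (g z) i j / sqrt (det (g z))" if "z \<in> W" for z
    using dens_eq metric_onD(4)[OF assms(1) that] by blast
  note d = partial_div_sqrt[OF W assms(2) cof_differentiable[OF assms] metric_onD(4)[OF assms]]
  obtain F where "((\<lambda>z. cof (g z) i j / sqrt (det (g z))) has_derivative F) (at y within W)"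
    using d(1) unfolding differentiable_def by blast
  then have "(dens g i j has_derivative F) (at y within W)"
    by (rule has_derivative_transform[rotated 2]) (use assms eq in auto)
  then show "dens g i j differentiable (at y within W)" by (rule differentiableI)
  show "partial W k (dens g i j) y =
      partial W k (\<lambda>z. cof (g z) i j) y / sqrt (det (g y))
        - cof (g y) i j * partial W k (\<lambda>z. det (g z)) y / (2 * det (g y) * sqrt (det (g y)))"
    using partial_local[OF W W order_refl assms(2), of "dens g i j", OF eq] d(2) by simp
qed

lemma laplace_coord_expand:
  assumes g: "metric_on W g" and y: "y \<in> W"
    and f: "\<And>j. partial W j f differentiable (at y within W)"
  shows "laplace_coord W g f y =
    (\<Sum>i\<in>UNIV. \<Sum>j\<in>UNIV. matrix_inv (g y) $ i $ j * partial W i (partial W j f) y)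
      + (\<Sum>j\<in>UNIV. drift W g j y * partial W j f y)"
proof -
  note W = metric_onD(1)[OF g]
  have s: "sqrt (det (g y)) > 0" using metric_onD(4)[OF g y] by simp
  have pr: "(\<lambda>z. dens g i j z * partial W j f z) differentiable (at y within W)" for i j
    by (intro differentiable_mult dens_partial g y f)
  have "partial W i (\<lambda>z. dens g i 1 z * partial W 1 f z + dens g i 2 z * partial W 2 f z) y
      = (\<Sum>j\<in>UNIV. partial W i (dens g i j) y * partial W j f y + dens g i j y * partial W i (partial W j f) y)" for i
    by (simp add: partial_arith(1)[OF W y pr pr] partial_arith(3)[OF W y dens_partial(1)[OF g y] f] sum_2)
  then show ?thesis
    using s unfolding laplace_coord_def drift_def dens_def[symmetric] sum_2
    by (simp add: dens_def add_divide_distrib ring_distribs mult.commute)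
qed

section \<open>Change of coordinates\<close>

definition transition ::
    "(real^2) set \<Rightarrow> (real^2) set \<Rightarrow> (real^2 \<Rightarrow> real^2) \<Rightarrow>
     (real^2 \<Rightarrow> real^2^2) \<Rightarrow> (real^2 \<Rightarrow> real^2^2) \<Rightarrow> bool" where
  "transition U V \<psi> g h \<longleftrightarrow> metric_on U g \<and> metric_on V h \<and> \<psi> ` U \<subseteq> V \<and> smooth_on U \<psi> \<and>
     (\<forall>y\<in>U. \<forall>v w. v \<bullet> (g y *v w) =
        frechet_derivative \<psi> (at y within U) v \<bullet>
          (h (\<psi> y) *v frechet_derivative \<psi> (at y within U) w))"

abbreviation jac :: "(real^2) set \<Rightarrow> (real^2 \<Rightarrow> real^2) \<Rightarrow> 2 \<Rightarrow> 2 \<Rightarrow> real^2 \<Rightarrow> real" where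
  "jac U \<psi> k i \<equiv> partial U i (\<lambda>z. \<psi> z $ k)"

lemma transitionD:
  assumes "transition U V \<psi> g h"
  shows "metric_on U g" "metric_on V h" "hopen U" "hopen V" "y \<in> U \<Longrightarrow> \<psi> y \<in> V"
    "Ck_on 2 U (\<lambda>z. \<psi> z $ k)" "y \<in> U \<Longrightarrow> \<psi> differentiable (at y within U)"
proof -
  show *: "metric_on U g" "metric_on V h" and "y \<in> U \<Longrightarrow> \<psi> y \<in> V"
    using assms by (auto simp: transition_def)
  show U: "hopen U" and "hopen V" using metric_onD(1) * by auto
  have s: "smooth_on U \<psi>" using assms by (auto simp: transition_def)
  from smooth_on_component[OF U this] show "Ck_on 2 U (\<lambda>z. \<psi> z $ k)" by (simp add: smooth_on_def)
  have "Ck_on (Suc 0) U \<psi>" using s by (simp only: smooth_on_def)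
  then show "y \<in> U \<Longrightarrow> \<psi> differentiable (at y within U)" by (simp add: differentiable_on_def)
qed

lemma jac_eq:
  assumes "transition U V \<psi> g h" "y \<in> U"
  shows "frechet_derivative \<psi> (at y within U) v $ k = v $ 1 * jac U \<psi> k 1 y + v $ 2 * jac U \<psi> k 2 y"
proof -
  note t = transitionD[OF assms(1)]
  let ?F = "frechet_derivative \<psi> (at y within U)"
  have F: "(\<psi> has_derivative ?F) (at y within U)"
    using t(7)[OF assms(2)] frechet_derivative_works by blast
  have Fk: "((\<lambda>z. \<psi> z $ k) has_derivative (\<lambda>v. ?F v $ k)) (at y within U)"
    using F by (rule bounded_linear.has_derivative[OF bounded_linear_vec_nth])
  have "(\<lambda>v. ?F v $ k) = (\<lambda>v. v $ 1 * jac U \<psi> k 1 y + v $ 2 * jac U \<psi> k 2 y)"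
    by (rule hopen_derivative_unique[OF t(3) assms(2) Fk has_derivative_partials[OF t(3) assms(2) differentiableI[OF Fk]]])
  then show ?thesis by (rule fun_cong)
qed

lemma transition_metric:
  assumes "transition U V \<psi> g h" "y \<in> U"
  shows "g y $ i $ j =
    jac U \<psi> 1 i y * (h (\<psi> y) $ 1 $ 1 * jac U \<psi> 1 j y + h (\<psi> y) $ 1 $ 2 * jac U \<psi> 2 j y) +
    jac U \<psi> 2 i y * (h (\<psi> y) $ 1 $ 2 * jac U \<psi> 1 j y + h (\<psi> y) $ 2 $ 2 * jac U \<psi> 2 j y)"
proof -
  let ?F = "frechet_derivative \<psi> (at y within U)"
  have sym: "h (\<psi> y) $ 2 $ 1 = h (\<psi> y) $ 1 $ 2"
    using transitionD(2,5)[OF assms(1)] assms(2) metric_onD(2) spd_sym by blast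
  have ax: "?F (axis i 1) $ k = jac U \<psi> k i y" for i k
    using exhaust_2[of i] by (auto simp: jac_eq[OF assms])
  have "g y $ i $ j = axis i 1 \<bullet> (g y *v axis j 1)"
    by (simp add: inner_axis_matrix)
  also have "\<dots> = ?F (axis i 1) \<bullet> (h (\<psi> y) *v ?F (axis j 1))"
    using assms by (auto simp: transition_def)
  finally show ?thesis
    by (simp add: inner_vec2 mult_vec2_nth ax sym)
qed

definition jdet :: "(real^2) set \<Rightarrow> (real^2 \<Rightarrow> real^2) \<Rightarrow> real^2 \<Rightarrow> real" where
  "jdet U \<psi> y = jac U \<psi> 1 1 y * jac U \<psi> 2 2 y - jac U \<psi> 1 2 y * jac U \<psi> 2 1 y"

text \<open>Taking determinants in the pull-back relation \<open>g = J^T h J\<close>. Positivity of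
  the metric then yields invertibility of the Jacobian at every point of the half-plane domain,
  boundary included.\<close>

lemma jdet_square:
  assumes "transition U V \<psi> g h" "y \<in> U"
  shows "det (g y) = (jdet U \<psi> y)\<^sup>2 * det (h (\<psi> y))" "jdet U \<psi> y \<noteq> 0"
proof -
  have sym: "h (\<psi> y) $ 2 $ 1 = h (\<psi> y) $ 1 $ 2"
    using transitionD(2,5)[OF assms(1)] assms(2) metric_onD(2) spd_sym by blast
  show *: "det (g y) = (jdet U \<psi> y)\<^sup>2 * det (h (\<psi> y))"
    unfolding det_2 transition_metric[OF assms] jdet_def sym by algebra
  have "0 < det (g y)" using metric_onD(4) transitionD(1)[OF assms(1)] assms(2) by blast
  with * show "jdet U \<psi> y \<noteq> 0" by auto
qed

lemma compose_partial:
  assumes t: "transition U V \<psi> g h" "y \<in> U"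
    and F: "F differentiable (at (\<psi> y) within V)"
  shows "(\<lambda>z. F (\<psi> z)) differentiable (at y within U)"
    and "partial U i (\<lambda>z. F (\<psi> z)) y =
      partial V 1 F (\<psi> y) * jac U \<psi> 1 i y + partial V 2 F (\<psi> y) * jac U \<psi> 2 i y"
proof -
  note tD = transitionD[OF t(1)]
  let ?J = "frechet_derivative \<psi> (at y within U)"
  have J: "(\<psi> has_derivative ?J) (at y within U)"
    using tD(7)[OF t(2)] frechet_derivative_works by blast
  have F': "(F has_derivative (\<lambda>v. v $ 1 * partial V 1 F (\<psi> y) + v $ 2 * partial V 2 F (\<psi> y))) (at (\<psi> y) within V)"
    by (rule has_derivative_partials[OF tD(4) tD(5)[OF t(2)] F])
  have "\<psi> ` U \<subseteq> V" using tD(5) by blast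
  with F' have "(F has_derivative (\<lambda>v. v $ 1 * partial V 1 F (\<psi> y) + v $ 2 * partial V 2 F (\<psi> y))) (at (\<psi> y) within \<psi> ` U)"
    by (rule has_derivative_subset)
  from has_derivative_in_compose[OF J this]
  have c: "((\<lambda>z. F (\<psi> z)) has_derivative (\<lambda>v. ?J v $ 1 * partial V 1 F (\<psi> y) + ?J v $ 2 * partial V 2 F (\<psi> y))) (at y within U)" .
  then show "(\<lambda>z. F (\<psi> z)) differentiable (at y within U)" by (rule differentiableI)
  show "partial U i (\<lambda>z. F (\<psi> z)) y =
      partial V 1 F (\<psi> y) * jac U \<psi> 1 i y + partial V 2 F (\<psi> y) * jac U \<psi> 2 i y"
    using exhaust_2[of i] by (auto simp: partial_eq[OF tD(3) t(2) c] jac_eq[OF t])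
qed

definition flux :: "(real^2) set \<Rightarrow> (real^2 \<Rightarrow> real^2^2) \<Rightarrow> (real^2 \<Rightarrow> real) \<Rightarrow> 2 \<Rightarrow> real^2 \<Rightarrow> real" where
  "flux W g f i z = (\<Sum>j\<in>UNIV. dens g i j z * partial W j f z)"

lemma laplace_coord_flux:
  "laplace_coord W g f y = (\<Sum>i\<in>UNIV. partial W i (flux W g f i) y) / sqrt (det (g y))"
  by (simp add: laplace_coord_def flux_def[abs_def] dens_def)

text \<open>The adjugate of the Jacobian matrix. Working with it instead of the inverse avoids
  dividing by the Jacobian determinant, and its columns are divergence free.\<close>

definition adj_jac :: "(real^2) set \<Rightarrow> (real^2 \<Rightarrow> real^2) \<Rightarrow> 2 \<Rightarrow> 2 \<Rightarrow> real^2 \<Rightarrow> real" where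
  "adj_jac U \<psi> i l z = (if i = 1 then (if l = 1 then jac U \<psi> 2 2 z else - jac U \<psi> 1 2 z)
     else (if l = 1 then - jac U \<psi> 2 1 z else jac U \<psi> 1 1 z))"

text \<open>The flux \<open>sqrt (det g) \<nabla>f\<close> is a vector density: it transforms by
  \<open>|det J| J^(-1)\<close>, which equals the sign of the determinant times the adjugate. The
  sign appears because charts may reverse orientation.\<close>

lemma flux_transform:
  assumes t: "transition U V \<psi> g h" "y \<in> U"
    and F: "F differentiable (at (\<psi> y) within V)"
  shows "flux U g (\<lambda>z. F (\<psi> z)) i y = sgn (jdet U \<psi> y) *
    (adj_jac U \<psi> i 1 y * flux V h F 1 (\<psi> y) + adj_jac U \<psi> i 2 y * flux V h F 2 (\<psi> y))"
proof -
  note tD = transitionD[OF t(1)]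
  define D where "D = jdet U \<psi> y"
  define H where "H = det (h (\<psi> y))"
  have H: "H > 0" using metric_onD(4)[OF tD(2) tD(5)[OF t(2)]] by (simp add: H_def)
  have D: "D \<noteq> 0" using jdet_square(2)[OF t] by (simp add: D_def)
  have g: "det (g y) = D\<^sup>2 * H" using jdet_square(1)[OF t] by (simp add: D_def H_def)
  have sg: "sqrt (det (g y)) = \<bar>D\<bar> * sqrt H" by (simp add: g real_sqrt_mult)
  have gp: "0 < det (g y)" using metric_onD(4)[OF tD(1) t(2)] .
  have sym: "h (\<psi> y) $ 2 $ 1 = h (\<psi> y) $ 1 $ 2"
    using metric_onD(2)[OF tD(2) tD(5)[OF t(2)]] spd_sym by blast
  define P where "P k = partial V k F (\<psi> y)" for k :: 2
  define S where "S = cof (g y) i 1 * (P 1 * jac U \<psi> 1 1 y + P 2 * jac U \<psi> 2 1 y)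
      + cof (g y) i 2 * (P 1 * jac U \<psi> 1 2 y + P 2 * jac U \<psi> 2 2 y)"
  define T where "T = adj_jac U \<psi> i 1 y * (cof (h (\<psi> y)) 1 1 * P 1 + cof (h (\<psi> y)) 1 2 * P 2)
      + adj_jac U \<psi> i 2 y * (cof (h (\<psi> y)) 2 1 * P 1 + cof (h (\<psi> y)) 2 2 * P 2)"
  have key: "S = D * T"
    using exhaust_2[of i]
  proof
    assume i: "i = 1"
    show ?thesis
      unfolding S_def T_def i cof_simps transition_metric[OF t] D_def jdet_def adj_jac_def sym
      by (simp add: algebra_simps)
  next
    assume i: "i = 2"
    show ?thesis
      unfolding S_def T_def i cof_simps transition_metric[OF t] D_def jdet_def adj_jac_def sym
      by (simp add: algebra_simps)
  qed
  have L: "flux U g (\<lambda>z. F (\<psi> z)) i y = S / (\<bar>D\<bar> * sqrt H)"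
    unfolding flux_def sum_2 compose_partial(2)[OF t F] dens_eq[of g y, OF gp] sg S_def P_def
    by (simp add: add_divide_distrib)
  have R: "adj_jac U \<psi> i 1 y * flux V h F 1 (\<psi> y) + adj_jac U \<psi> i 2 y * flux V h F 2 (\<psi> y) = T / sqrt H"
    unfolding flux_def sum_2 dens_eq[of h "\<psi> y", OF H[unfolded H_def]] T_def P_def H_def[symmetric]
    by (simp add: add_divide_distrib diff_divide_distrib ring_distribs)
  show ?thesis
    unfolding L R key D_def[symmetric] by (simp add: real_sgn_eq)
qed

text \<open>The divergence of the transformed flux consists of derivatives of the flux, which
  recombine with factor \<open>jdet\<close>, and derivatives of the adjugate, which cancel by the
  Piola identity.\<close>

lemma laplace_coord_invariant:
  assumes t: "transition U V \<psi> g h" and y: "y \<in> U"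
    and F: "Ck_on 2 V F"
  shows "laplace_coord U g (\<lambda>z. F (\<psi> z)) y = laplace_coord V h F (\<psi> y)"
proof -
  note tD = transitionD[OF t]
  note pr = Ck2D(2)[OF tD(6)]
  have dj: "jdet U \<psi> differentiable (at z within U)" if "z \<in> U" for z
    unfolding jdet_def[abs_def] by (intro derivative_intros pr that)
  then have "continuous_on U (jdet U \<psi>)"
    by (simp add: differentiable_imp_continuous_on differentiable_on_def)
  moreover have "jdet U \<psi> y \<noteq> 0" by (rule jdet_square(2)[OF t y])
  ultimately obtain e where e: "e > 0"
    "\<And>z. z \<in> U \<Longrightarrow> dist z y < e \<Longrightarrow> dist (jdet U \<psi> z) (jdet U \<psi> y) < \<bar>jdet U \<psi> y\<bar>"
    using y unfolding continuous_on_iff by (meson zero_less_abs_iff)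
  \<comment> \<open>On this neighbourhood the Jacobian determinant keeps its sign, so the sign is a
    constant that can be pulled out of the derivative.\<close>
  define U' where "U' = U \<inter> ball y e"
  have U': "hopen U'" "U' \<subseteq> U" "y \<in> U'"
    using tD(3) y e(1) by (auto simp: U'_def openin_Int_open)
  have sg: "sgn (jdet U \<psi> z) = sgn (jdet U \<psi> y)" if "z \<in> U'" for z
    using e(2)[of z] that by (auto simp: U'_def dist_commute dist_real_def sgn_if split: if_splits)
  define s where "s = sgn (jdet U \<psi> y)"
  have fl: "flux V h F l differentiable (at (\<psi> y) within V)" for l
    unfolding flux_def[abs_def] sum_2
    by (intro derivative_intros differentiable_mult dens_partial[OF tD(2)] Ck2D(2)[OF F] tD(5) y)
  note flc = compose_partial[OF t y fl]
  have aj_eq: "adj_jac U \<psi> 1 1 = jac U \<psi> 2 2" "adj_jac U \<psi> 1 2 = (\<lambda>z. - jac U \<psi> 1 2 z)"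
     "adj_jac U \<psi> 2 1 = (\<lambda>z. - jac U \<psi> 2 1 z)" "adj_jac U \<psi> 2 2 = jac U \<psi> 1 1"
    by (auto simp: adj_jac_def)
  have aj: "adj_jac U \<psi> i l differentiable (at y within U)" for i l
    using exhaust_2[of i] exhaust_2[of l] pr[OF y]
    by (auto simp: aj_eq intro!: differentiable_minus)
  note pa = partial_arith[OF tD(3) y]
  have pd: "(\<lambda>z. adj_jac U \<psi> i l z * flux V h F l (\<psi> z)) differentiable (at y within U)" for i l
    by (rule differentiable_mult[OF aj flc(1)])
  have sd: "(\<lambda>z. adj_jac U \<psi> i 1 z * flux V h F 1 (\<psi> z) + adj_jac U \<psi> i 2 z * flux V h F 2 (\<psi> z))
      differentiable (at y within U)" for i
    by (rule differentiable_add[OF pd pd])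
  have "partial U i (flux U g (\<lambda>z. F (\<psi> z)) i) y =
      partial U i (\<lambda>z. s * (adj_jac U \<psi> i 1 z * flux V h F 1 (\<psi> z) + adj_jac U \<psi> i 2 z * flux V h F 2 (\<psi> z))) y" for i
  proof -
    let ?R = "\<lambda>z. s * (adj_jac U \<psi> i 1 z * flux V h F 1 (\<psi> z) + adj_jac U \<psi> i 2 z * flux V h F 2 (\<psi> z))"
    have "partial U i (flux U g (\<lambda>z. F (\<psi> z)) i) y = partial U' i ?R y"
    proof (rule partial_local[OF U'(1) tD(3) U'(2,3)])
      fix z assume z: "z \<in> U'"
      then have zU: "z \<in> U" using U' by blast
      show "flux U g (\<lambda>z. F (\<psi> z)) i z = ?R z"
        by (simp add: flux_transform[OF t zU Ck2D(1)[OF F tD(5)[OF zU]]] sg[OF z] s_def)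
    qed
    also have "\<dots> = partial U i ?R y"
      by (rule partial_local[OF U'(1) tD(3) U'(2,3), symmetric]) simp
    finally show ?thesis .
  qed
  also have "\<And>i. partial U i (\<lambda>z. s * (adj_jac U \<psi> i 1 z * flux V h F 1 (\<psi> z) + adj_jac U \<psi> i 2 z * flux V h F 2 (\<psi> z))) y
     = s * (partial U i (adj_jac U \<psi> i 1) y * flux V h F 1 (\<psi> y) + adj_jac U \<psi> i 1 y * partial U i (\<lambda>z. flux V h F 1 (\<psi> z)) y
        + (partial U i (adj_jac U \<psi> i 2) y * flux V h F 2 (\<psi> y) + adj_jac U \<psi> i 2 y * partial U i (\<lambda>z. flux V h F 2 (\<psi> z)) y))"
    by (simp add: pa(5)[OF sd sd] pa(1)[OF pd pd] pa(3)[OF aj flc(1)])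
  finally have *: "\<And>i. partial U i (flux U g (\<lambda>z. F (\<psi> z)) i) y = s * (partial U i (adj_jac U \<psi> i 1) y * flux V h F 1 (\<psi> y) + adj_jac U \<psi> i 1 y * partial U i (\<lambda>z. flux V h F 1 (\<psi> z)) y
        + (partial U i (adj_jac U \<psi> i 2) y * flux V h F 2 (\<psi> y) + adj_jac U \<psi> i 2 y * partial U i (\<lambda>z. flux V h F 2 (\<psi> z)) y))" .
  \<comment> \<open>The Piola identity: each column of the adjugate of a Jacobian is divergence
    free, by symmetry of the second derivatives of the transition map.\<close>
  have piola: "partial U 1 (adj_jac U \<psi> 1 1) y + partial U 2 (adj_jac U \<psi> 2 1) y = 0"
    "partial U 1 (adj_jac U \<psi> 1 2) y + partial U 2 (adj_jac U \<psi> 2 2) y = 0"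
    using partial_commute[OF tD(3) tD(6) y, of 1 2 1] partial_commute[OF tD(3) tD(6) y, of 1 2 2]
    by (simp_all add: aj_eq pa(4)[OF pr[OF y] pr[OF y]])
  have "(\<Sum>i\<in>UNIV. partial U i (flux U g (\<lambda>z. F (\<psi> z)) i) y)
      = s * (jdet U \<psi> y * (partial V 1 (flux V h F 1) (\<psi> y) + partial V 2 (flux V h F 2) (\<psi> y)))"
  proof -
    have "(\<Sum>i\<in>UNIV. partial U i (flux U g (\<lambda>z. F (\<psi> z)) i) y) = s * (
        (partial U 1 (adj_jac U \<psi> 1 1) y + partial U 2 (adj_jac U \<psi> 2 1) y) * flux V h F 1 (\<psi> y)
        + (partial U 1 (adj_jac U \<psi> 1 2) y + partial U 2 (adj_jac U \<psi> 2 2) y) * flux V h F 2 (\<psi> y)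
        + jdet U \<psi> y * (partial V 1 (flux V h F 1) (\<psi> y) + partial V 2 (flux V h F 2) (\<psi> y)))"
      unfolding sum_2 * flc(2) jdet_def by (simp add: adj_jac_def algebra_simps)
    then show ?thesis by (simp add: piola)
  qed
  moreover have "s * jdet U \<psi> y = \<bar>jdet U \<psi> y\<bar>" by (simp add: s_def abs_sgn mult.commute)
  moreover have "sqrt (det (g y)) = \<bar>jdet U \<psi> y\<bar> * sqrt (det (h (\<psi> y)))"
    by (simp add: jdet_square(1)[OF t y] real_sqrt_mult)
  moreover have "\<bar>jdet U \<psi> y\<bar> \<noteq> 0" using jdet_square(2)[OF t y] by simp
  ultimately show ?thesis
    unfolding laplace_coord_flux sum_2 by (simp add: mult.assoc[symmetric])
qed

section \<open>Normal and geodesic curvature\<close>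

lemma normal_coord_eq:
  assumes "spd (g y)"
  shows "normal_coord g y $ i = - cof (g y) i 2 / sqrt (g y $ 1 $ 1 * det (g y))"
proof -
  note p = spd_pos[OF assms]
  have "sqrt (g y $ 1 $ 1 * det (g y)) = det (g y) * sqrt (g y $ 1 $ 1 / det (g y))"
    using p by (simp add: real_sqrt_mult real_sqrt_divide real_div_sqrt field_simps)
  then show ?thesis
    using p by (simp add: normal_coord_def matrix_inv_nth field_simps)
qed

lemma normal_coord_nth:
  assumes "spd (g y)"
  shows "normal_coord g y $ 1 = g y $ 1 $ 2 / sqrt (g y $ 1 $ 1 * det (g y))"
    and "normal_coord g y $ 2 = - g y $ 1 $ 1 / sqrt (g y $ 1 $ 1 * det (g y))"
  by (simp_all add: normal_coord_eq[of g y, OF assms])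

text \<open>Differentiating the orthogonality of the normal and \<open>e_1\<close> removes the
  derivatives of the normal, and lowering an index collapses the Christoffel symbols. What remains
  is first order in \<open>g\<close> and algebraic in the normal, which makes conformal change,
  change of chart and bounds tractable.\<close>

lemma geodesic_coord_eq:
  assumes g: "metric_on W g" and y: "y \<in> W"
  shows "geodesic_coord W g y = (\<Sum>m\<in>UNIV. normal_coord g y $ m *
    (partial W m (\<lambda>z. g z $ 1 $ 1) y / 2 - partial W 1 (\<lambda>z. g z $ 1 $ m) y)) / g y $ 1 $ 1"
proof -
  note W = metric_onD(1)[OF g]
  let ?n = "\<lambda>i z. normal_coord g z $ i"
  note gd = metric_onD(3)[OF g y]
  note pa = partial_arith[OF W y]
  have spd: "spd (g z)" if "z \<in> W" for z using metric_onD(2)[OF g that] .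
  have nd: "?n i differentiable (at y within W)" for i
  proof -
    have "(\<lambda>z. - cof (g z) i 2 / sqrt (g z $ 1 $ 1 * det (g z))) differentiable (at y within W)"
      using spd_pos[OF spd[OF y]]
      by (intro partial_div_sqrt(1)[OF W y] differentiable_minus differentiable_mult cof_differentiable[OF g y] gd) simp
    then obtain F where "((\<lambda>z. - cof (g z) i 2 / sqrt (g z $ 1 $ 1 * det (g z))) has_derivative F) (at y within W)"
      unfolding differentiable_def by blast
    then have "(?n i has_derivative F) (at y within W)"
      by (rule has_derivative_transform[rotated 2]) (use y normal_coord_eq spd in auto)
    then show ?thesis by (rule differentiableI)
  qed
  \<comment> \<open>The field \<open>normal_coord\<close> is orthogonal to \<open>e_1\<close> on all
    of \<open>W\<close>, not just on the boundary line, so the relation may be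
    differentiated.\<close>
  have "partial W 1 (\<lambda>z. g z $ 1 $ 1 * ?n 1 z + g z $ 1 $ 2 * ?n 2 z) y = partial W 1 (\<lambda>z. 0) y"
    by (rule partial_local[OF W W order_refl y]) (simp add: normal_coord_nth spd)
  also have "\<dots> = 0" by (rule partial_eq[OF W y has_derivative_const])
  finally have n0: "partial W 1 (\<lambda>z. g z $ 1 $ 1) y * ?n 1 y + g y $ 1 $ 1 * partial W 1 (?n 1) y
    + (partial W 1 (\<lambda>z. g z $ 1 $ 2) y * ?n 2 y + g y $ 1 $ 2 * partial W 1 (?n 2) y) = 0"
    by (simp add: pa(1)[OF differentiable_mult[OF gd nd] differentiable_mult[OF gd nd]] pa(3)[OF gd nd])
  have sym: "partial W i (\<lambda>z. g z $ 2 $ 1) y = partial W i (\<lambda>z. g z $ 1 $ 2) y" for i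
    by (rule partial_local[OF W W order_refl y]) (use spd spd_sym in blast)
  have inv: "g y $ 1 $ 1 * matrix_inv (g y) $ 1 $ 1 + g y $ 1 $ 2 * matrix_inv (g y) $ 2 $ 1 = 1"
    "g y $ 1 $ 1 * matrix_inv (g y) $ 1 $ 2 + g y $ 1 $ 2 * matrix_inv (g y) $ 2 $ 2 = 0"
    using spd_pos(3)[OF spd[OF y]]
    by (simp_all add: matrix_inv_nth divide_simps) (simp_all add: det_2 algebra_simps)
  \<comment> \<open>The first-kind symbol with both outer indices equal to 1 reduces to a single
    derivative of \<open>g_11\<close>, because the other two terms cancel by symmetry of the
    metric.\<close>
  have chr: "g y $ 1 $ 1 * christoffel W g 1 1 m y + g y $ 1 $ 2 * christoffel W g 2 1 m y
      = partial W m (\<lambda>z. g z $ 1 $ 1) y / 2" for m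
  proof -
    define Z where "Z l = partial W 1 (\<lambda>z. g z $ m $ l) y + partial W m (\<lambda>z. g z $ 1 $ l) y
        - partial W l (\<lambda>z. g z $ 1 $ m) y" for l
    have "g y $ 1 $ 1 * christoffel W g 1 1 m y + g y $ 1 $ 2 * christoffel W g 2 1 m y =
       ((g y $ 1 $ 1 * matrix_inv (g y) $ 1 $ 1 + g y $ 1 $ 2 * matrix_inv (g y) $ 2 $ 1) * Z 1
       + (g y $ 1 $ 1 * matrix_inv (g y) $ 1 $ 2 + g y $ 1 $ 2 * matrix_inv (g y) $ 2 $ 2) * Z 2) / 2"
      unfolding christoffel_def sum_2 Z_def[symmetric] by (simp add: field_simps)
    also have "\<dots> = Z 1 / 2" by (simp only: inv) simp
    also have "Z 1 = partial W m (\<lambda>z. g z $ 1 $ 1) y"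
      using exhaust_2[of m] sym by (auto simp: Z_def)
    finally show ?thesis .
  qed
  have "(\<Sum>k\<in>UNIV. g y $ 1 $ k * (partial W 1 (?n k) y + (\<Sum>m\<in>UNIV. christoffel W g k 1 m y * ?n m y)))
     = (g y $ 1 $ 1 * partial W 1 (?n 1) y + g y $ 1 $ 2 * partial W 1 (?n 2) y)
      + (g y $ 1 $ 1 * christoffel W g 1 1 1 y + g y $ 1 $ 2 * christoffel W g 2 1 1 y) * ?n 1 y
      + (g y $ 1 $ 1 * christoffel W g 1 1 2 y + g y $ 1 $ 2 * christoffel W g 2 1 2 y) * ?n 2 y"
    by (simp add: sum_2 algebra_simps)
  also have "\<dots> = (\<Sum>m\<in>UNIV. ?n m y * (partial W m (\<lambda>z. g z $ 1 $ 1) y / 2 - partial W 1 (\<lambda>z. g z $ 1 $ m) y))"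
    unfolding chr sum_2 using n0 by (simp add: algebra_simps)
  finally show ?thesis by (simp add: geodesic_coord_def)
qed

lemma spd_scale:
  assumes "spd M" "0 < c"
  shows "spd (c *\<^sub>R M)"
proof -
  have "transpose (c *\<^sub>R M) = c *\<^sub>R M"
    using assms(1) by (simp add: spd_def transpose_def vec_eq_iff)
  moreover have "v \<bullet> ((c *\<^sub>R M) *v v) = c * (v \<bullet> (M *v v))" for v
    by (simp add: inner_vec2 mult_vec2_nth algebra_simps)
  ultimately show ?thesis using assms by (simp add: spd_def)
qed

text \<open>In the formula of \<open>geodesic_coord_eq\<close> the conformal factor adds the terms
  \<open>\<partial>_m w g_11 - 2 \<partial>_1 w g_1m\<close>, contracted with the normal. The second
  contraction vanishes by orthogonality, and the first is the normal derivative of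
  \<open>w\<close>.\<close>

lemma geodesic_coord_conformal:
  assumes g: "metric_on W g" and y: "y \<in> W" and w: "\<And>z. z \<in> W \<Longrightarrow> w differentiable (at z within W)"
  shows "geodesic_coord W (\<lambda>z. exp (2 * w z) *\<^sub>R g z) y =
    exp (- w y) * ((\<Sum>i\<in>UNIV. normal_coord g y $ i * partial W i w y) + geodesic_coord W g y)"
proof -
  note W = metric_onD(1)[OF g]
  note gd = metric_onD(3)[OF g]
  let ?h = "\<lambda>z. exp (2 * w z) *\<^sub>R g z"
  have spd: "spd (g y)" using metric_onD(2)[OF g y] .
  have wd: "(w has_derivative (\<lambda>v. v $ 1 * partial W 1 w z + v $ 2 * partial W 2 w z)) (at z within W)"
    if "z \<in> W" for z by (rule has_derivative_partials[OF W that w[OF that]])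
  have hd: "((\<lambda>z. ?h z $ i $ j) has_derivative (\<lambda>v.
      exp (2 * w z) * (v $ 1 * (2 * partial W 1 w z * g z $ i $ j + partial W 1 (\<lambda>z. g z $ i $ j) z)
      + v $ 2 * (2 * partial W 2 w z * g z $ i $ j + partial W 2 (\<lambda>z. g z $ i $ j) z)))) (at z within W)"
    if z: "z \<in> W" for z i j
  proof -
    have "((\<lambda>z. exp (2 * w z) * g z $ i $ j) has_derivative (\<lambda>v.
      exp (2 * w z) * (v $ 1 * (2 * partial W 1 w z * g z $ i $ j + partial W 1 (\<lambda>z. g z $ i $ j) z)
      + v $ 2 * (2 * partial W 2 w z * g z $ i $ j + partial W 2 (\<lambda>z. g z $ i $ j) z)))) (at z within W)"
      by (rule derivative_eq_intros wd[OF z] has_derivative_partials[OF W z gd[OF z]] refl)+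
         (simp add: fun_eq_iff algebra_simps)
    then show ?thesis by simp
  qed
  have h: "metric_on W ?h"
    unfolding metric_on_def
  proof (intro conjI ballI allI W)
    fix z assume z: "z \<in> W"
    show "spd (?h z)" by (intro spd_scale metric_onD(2)[OF g z]) simp
    show "(\<lambda>z. ?h z $ i $ j) differentiable (at z within W)" for i j
      by (rule differentiableI[OF hd[OF z]])
  qed
  have p: "partial W k (\<lambda>z. ?h z $ i $ j) y =
      exp (2 * w y) * (2 * partial W k w y * g y $ i $ j + partial W k (\<lambda>z. g z $ i $ j) y)" for k i j
    unfolding partial_eq[OF W y hd[OF y]] using exhaust_2[of k] by auto
  note pos = spd_pos[OF spd]
  define s where "s = sqrt (g y $ 1 $ 1 * det (g y))"
  have s: "s > 0" using pos by (simp add: s_def)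
  have detc: "det (?h y) = (exp (2 * w y))\<^sup>2 * det (g y)"
    by (simp add: det_2 power2_eq_square algebra_simps)
  have E: "exp (2 * w y) = (exp (w y))\<^sup>2" by (simp add: exp_double)
  \<comment> \<open>The factor is \<open>exp (2 w)\<close> from \<open>g_11\<close> times
    \<open>exp (4 w)\<close> from the determinant; its root \<open>exp (3 w)\<close> against the
    numerator \<open>exp (2 w)\<close> scales the unit normal by \<open>exp (- w)\<close>.\<close>
  have "?h y $ 1 $ 1 * det (?h y) = ((exp (w y)) ^ 3)\<^sup>2 * (g y $ 1 $ 1 * det (g y))"
    unfolding detc unfolding vector_scaleR_component real_scaleR_def unfolding E
    by (simp add: power2_eq_square power3_eq_cube)
  then have sq: "sqrt (?h y $ 1 $ 1 * det (?h y)) = exp (w y) ^ 3 * s"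
    by (simp only: real_sqrt_mult s_def real_sqrt_abs) simp
  have n: "normal_coord g y $ 1 = g y $ 1 $ 2 / s" "normal_coord g y $ 2 = - g y $ 1 $ 1 / s"
    unfolding s_def by (simp_all add: normal_coord_nth spd)
  have nc: "normal_coord ?h y $ 1 = exp (- w y) * (g y $ 1 $ 2 / s)"
    "normal_coord ?h y $ 2 = exp (- w y) * (- g y $ 1 $ 1 / s)"
    unfolding normal_coord_nth[of ?h y, OF metric_onD(2)[OF h y]] sq
    unfolding vector_scaleR_component real_scaleR_def E
    using s by (simp_all add: exp_minus field_simps power2_eq_square power3_eq_cube)
  show ?thesis
    unfolding geodesic_coord_eq[OF g y] geodesic_coord_eq[OF h y] sum_2 p nc n
    using pos s by (simp add: field_simps)
qed

section \<open>First-order behaviour at the boundary line\<close>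

lemma partial_zero_on_boundary:
  assumes U: "hopen U" and y: "y \<in> U" "y $ 2 = 0" and f: "f differentiable (at y within U)"
    and z: "\<And>z. z \<in> U \<Longrightarrow> z $ 2 = 0 \<Longrightarrow> f z = 0"
  shows "partial U 1 f y = 0"
proof -
  obtain e where e: "e > 0" "ball y e \<inter> half_plane \<subseteq> U" by (rule hopenE[OF U y(1)])
  have in_U: "y + s *\<^sub>R axis 1 1 \<in> U" if "s \<in> {0..<e}" for s
    using e that y(2) by (auto simp: half_plane_def dist_norm intro!: subsetD[OF e(2)])
  have F: "(f has_derivative (\<lambda>v. v $ 1 * partial U 1 f y + v $ 2 * partial U 2 f y)) (at (y + 0 *\<^sub>R axis 1 1) within U)"
    using has_derivative_partials[OF U y(1) f] by simp
  have "((\<lambda>s. f (y + s *\<^sub>R axis 1 1)) has_derivative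
      (\<lambda>r. (r *\<^sub>R axis (1::2) 1) $ 1 * partial U 1 f y + (r *\<^sub>R axis (1::2) 1) $ 2 * partial U 2 f y)) (at 0 within {0..<e})"
    by (rule has_derivative_along[OF F in_U])
  then have "((\<lambda>s. f (y + s *\<^sub>R axis 1 1)) has_vector_derivative partial U 1 f y) (at 0 within {0..<e})"
    by (simp add: has_vector_derivative_def)
  moreover have "((\<lambda>s. f (y + s *\<^sub>R axis 1 1)) has_vector_derivative 0) (at 0 within {0..<e})"
    by (rule has_vector_derivative_transform[OF _ _ has_vector_derivative_const[of 0]])
       (use e z in_U y(2) in auto)
  moreover have "at 0 within {0..<e} \<noteq> bot"
    using e(1) by (simp add: trivial_limit_within islimpt_Ico)
  ultimately show ?thesis by (rule vector_derivative_unique_within[rotated])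
qed

text \<open>At a minimum the one-sided difference quotients along an inward direction are
  nonnegative. Applied to transition maps it shows that inward directions are preserved; applied
  with \<open>v = - n\<close> to the barrier comparison it yields the normal derivative
  estimate.\<close>

lemma directional_derivative_nonneg:
  fixes v :: "real^2"
  assumes U: "hopen U" and y: "y \<in> U" and f: "f differentiable (at y within U)"
    and z: "\<And>z. z \<in> U \<Longrightarrow> f y \<le> f z" and v: "0 \<le> v $ 2" "y $ 2 = 0 \<Longrightarrow> 0 < v $ 2"
  shows "0 \<le> v $ 1 * partial U 1 f y + v $ 2 * partial U 2 f y"
proof -
  obtain e where e: "e > 0" "ball y e \<inter> half_plane \<subseteq> U" by (rule hopenE[OF U y])
  define d where "d = e / (norm v + 1)"
  have n: "0 < norm v + 1" using norm_ge_zero[of v] by linarith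
  have d: "d > 0" using e n by (simp add: d_def)
  have in_U: "y + s *\<^sub>R v \<in> U" if s: "s \<in> {0..<d}" for s
  proof -
    have "s * norm v \<le> s * (norm v + 1)" using s by (intro mult_left_mono) auto
    also have "\<dots> < e" using s n by (auto simp: d_def pos_less_divide_eq)
    finally have "y + s *\<^sub>R v \<in> ball y e" using s by (simp add: dist_norm)
    moreover have "0 \<le> (y + s *\<^sub>R v) $ 2" using s v hopen_nonneg[OF U y] by simp
    ultimately show ?thesis using e by (auto simp: half_plane_def)
  qed
  have F: "(f has_derivative (\<lambda>v. v $ 1 * partial U 1 f y + v $ 2 * partial U 2 f y)) (at (y + 0 *\<^sub>R v) within U)"
    using has_derivative_partials[OF U y f] by simp
  let ?D = "v $ 1 * partial U 1 f y + v $ 2 * partial U 2 f y"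
  have "((\<lambda>s. f (y + s *\<^sub>R v)) has_derivative
      (\<lambda>r. (r *\<^sub>R v) $ 1 * partial U 1 f y + (r *\<^sub>R v) $ 2 * partial U 2 f y)) (at 0 within {0..<d})"
    by (rule has_derivative_along[OF F in_U])
  then have "((\<lambda>s. f (y + s *\<^sub>R v)) has_real_derivative ?D) (at 0 within {0..<d})"
    unfolding has_field_derivative_def by (rule has_derivative_eq_rhs) (simp add: fun_eq_iff algebra_simps)
  then have lim: "((\<lambda>s. (f (y + s *\<^sub>R v) - f (y + 0 *\<^sub>R v)) / (s - 0)) \<longlongrightarrow> ?D) (at 0 within {0..<d})"
    by (simp add: has_field_derivative_iff)
  have nb: "at 0 within {0..<d} \<noteq> bot"
    using d by (simp add: trivial_limit_within islimpt_Ico)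
  have ev: "\<forall>\<^sub>F s in at 0 within {0..<d}. 0 \<le> (f (y + s *\<^sub>R v) - f (y + 0 *\<^sub>R v)) / (s - 0)"
    using z in_U by (auto simp: eventually_at_filter intro!: always_eventually)
  show ?thesis by (rule tendsto_lowerbound[OF lim ev nb])
qed


text \<open>The second component of the transition map vanishes on the boundary line and is
  nonnegative elsewhere. So the Jacobian is upper triangular there with positive lower right entry;
  the tangential entry may have either sign, as charts need not be oriented.\<close>

lemma partial_boundary_transition:
  assumes t: "transition U V \<psi> g h" and y: "y \<in> U" "y $ 2 = 0"
    and b: "\<forall>z\<in>U. z $ 2 = 0 \<longrightarrow> \<psi> z $ 2 = 0"
  shows "jac U \<psi> 2 1 y = 0" "partial U 1 (jac U \<psi> 2 1) y = 0" "0 < jac U \<psi> 2 2 y" "jac U \<psi> 1 1 y \<noteq> 0"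
proof -
  note tD = transitionD[OF t]
  have 0: "jac U \<psi> 2 1 z = 0" if "z \<in> U" "z $ 2 = 0" for z
    by (rule partial_zero_on_boundary[OF tD(3) that Ck2D(1)[OF tD(6)]]) (use that b in auto)
  then show J21: "jac U \<psi> 2 1 y = 0" using y by blast
  show "partial U 1 (jac U \<psi> 2 1) y = 0"
    by (rule partial_zero_on_boundary[OF tD(3) y Ck2D(2)[OF tD(6)]]) (use y 0 in auto)
  have "0 \<le> axis (2::2) 1 $ 1 * jac U \<psi> 2 1 y + axis (2::2) 1 $ 2 * jac U \<psi> 2 2 y"
    by (rule directional_derivative_nonneg[OF tD(3) y(1) Ck2D(1)[OF tD(6)]])
       (use y b hopen_nonneg[OF tD(4) tD(5)] in auto)
  moreover have "jac U \<psi> 1 1 y * jac U \<psi> 2 2 y \<noteq> 0"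
    using jdet_square(2)[OF t y(1)] J21 by (simp add: jdet_def)
  ultimately show "0 < jac U \<psi> 2 2 y" "jac U \<psi> 1 1 y \<noteq> 0" by auto
qed

lemma normal_coord_transition:
  assumes t: "transition U V \<psi> g h" and y: "y \<in> U" "y $ 2 = 0"
    and b: "\<forall>z\<in>U. z $ 2 = 0 \<longrightarrow> \<psi> z $ 2 = 0"
  shows "normal_coord h (\<psi> y) $ k =
    jac U \<psi> k 1 y * normal_coord g y $ 1 + jac U \<psi> k 2 y * normal_coord g y $ 2"
proof -
  note tD = transitionD[OF t]
  note J = partial_boundary_transition[OF t y b]
  have gs: "spd (g y)" and hs: "spd (h (\<psi> y))"
    using metric_onD(2) tD y by blast+
  define a c d where "a = jac U \<psi> 1 1 y" and "c = jac U \<psi> 1 2 y" and "d = jac U \<psi> 2 2 y"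
  note ad = J(3,4)[folded a_def d_def]
  define H where "H = h (\<psi> y) $ 1 $ 1 * det (h (\<psi> y))"
  have H: "H > 0" using spd_pos[OF hs] by (simp add: H_def)
  have g11: "g y $ 1 $ 1 = a\<^sup>2 * h (\<psi> y) $ 1 $ 1"
    and g12: "g y $ 1 $ 2 = a * (h (\<psi> y) $ 1 $ 1 * c + h (\<psi> y) $ 1 $ 2 * d)"
    by (simp_all add: transition_metric[OF t y(1)] J(1) a_def[symmetric] c_def[symmetric] d_def[symmetric] power2_eq_square)
  have "det (g y) = (a * d)\<^sup>2 * det (h (\<psi> y))"
    by (simp add: jdet_square(1)[OF t y(1)] jdet_def J(1) a_def d_def)
  then have "g y $ 1 $ 1 * det (g y) = (a\<^sup>2 * d)\<^sup>2 * H"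
    by (simp add: g11 H_def power2_eq_square)
  \<comment> \<open>Positivity of \<open>d\<close> fixes the sign of the root; \<open>a\<close>
    enters only through its square, so the outward normal is insensitive to orientation.\<close>
  then have sq: "sqrt (g y $ 1 $ 1 * det (g y)) = a\<^sup>2 * d * sqrt H"
    using ad by (simp add: real_sqrt_mult)
  have "normal_coord h (\<psi> y) $ 1 = a * normal_coord g y $ 1 + c * normal_coord g y $ 2"
    "normal_coord h (\<psi> y) $ 2 = d * normal_coord g y $ 2"
    unfolding normal_coord_nth[of g y, OF gs] normal_coord_nth[of h "\<psi> y", OF hs]
    unfolding sq H_def[symmetric] unfolding g11 g12
    using ad H by (simp_all add: field_simps power2_eq_square)
  then show ?thesis
    using exhaust_2[of k] by (auto simp: a_def c_def d_def J(1))
qed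

text \<open>The derivatives of the pulled back metric contain second derivatives of the transition
  map. They cancel by symmetry of mixed derivatives, or are multiplied by the inner product of the
  normal with the tangent, which is zero.\<close>

lemma geodesic_coord_transition:
  assumes t: "transition U V \<psi> g h" and y: "y \<in> U" "y $ 2 = 0"
    and b: "\<forall>z\<in>U. z $ 2 = 0 \<longrightarrow> \<psi> z $ 2 = 0"
  shows "geodesic_coord U g y = geodesic_coord V h (\<psi> y)"
proof -
  note tD = transitionD[OF t]
  note J = partial_boundary_transition[OF t y b]
  note pa = partial_arith[OF tD(3) y(1)]
  have hs: "spd (h (\<psi> y))"
    using metric_onD(2) tD y by blast
  note jd = Ck2D(2)[OF tD(6) y(1)]
  note hc = compose_partial[OF t y(1) metric_onD(3)[OF tD(2) tD(5)[OF y(1)]]]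
  have pg: "partial U m (\<lambda>z. g z $ i $ j) y = partial U m (\<lambda>y.
    jac U \<psi> 1 i y * (h (\<psi> y) $ 1 $ 1 * jac U \<psi> 1 j y + h (\<psi> y) $ 1 $ 2 * jac U \<psi> 2 j y) +
    jac U \<psi> 2 i y * (h (\<psi> y) $ 1 $ 2 * jac U \<psi> 1 j y + h (\<psi> y) $ 2 $ 2 * jac U \<psi> 2 j y)) y" for m i j
    by (rule partial_local[OF tD(3) tD(3) order_refl y(1) transition_metric[OF t]])
  note dd = differentiable_add differentiable_mult jd hc(1)
  define a c d where "a = jac U \<psi> 1 1 y" and "c = jac U \<psi> 1 2 y" and "d = jac U \<psi> 2 2 y"
  define p q where "p = h (\<psi> y) $ 1 $ 1" and "q = h (\<psi> y) $ 1 $ 2"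
  have sym: "partial U 1 (jac U \<psi> k 2) y = partial U 2 (jac U \<psi> k 1) y" for k
    by (rule partial_commute[OF tD(3) tD(6) y(1)])
  define n1 n2 where "n1 = normal_coord g y $ 1" and "n2 = normal_coord g y $ 2"
  have perp: "p * (a * n1 + c * n2) + q * (d * n2) = 0"
  proof -
    have "p * normal_coord h (\<psi> y) $ 1 + q * normal_coord h (\<psi> y) $ 2 = 0"
      by (simp add: normal_coord_nth[of h "\<psi> y", OF hs] p_def q_def)
    then show ?thesis
      by (simp add: normal_coord_transition[OF t y b] J(1) a_def c_def d_def n1_def n2_def)
  qed
  have g11: "g y $ 1 $ 1 = a\<^sup>2 * p"
    by (simp add: transition_metric[OF t y(1)] J(1) a_def[symmetric] p_def[symmetric] power2_eq_square)
  \<comment> \<open>These are the second derivatives that occur: \<open>B2\<close> and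
    \<open>B3\<close> appear equally in half the normal derivative of \<open>g_11\<close> and in the
    tangential derivative of \<open>g_12\<close>, while \<open>B1\<close> multiplies exactly the
    left side of \<open>perp\<close>.\<close>
  define B1 B2 B3 where "B1 = partial U 1 (jac U \<psi> 1 1) y" and "B2 = partial U 2 (jac U \<psi> 1 1) y"
    and "B3 = partial U 2 (jac U \<psi> 2 1) y"
  have p11: "partial U m (\<lambda>z. g z $ 1 $ 1) y =
      2 * a * p * partial U m (jac U \<psi> 1 1) y + a\<^sup>2 * partial U m (\<lambda>z. h (\<psi> z) $ 1 $ 1) y
      + 2 * a * q * partial U m (jac U \<psi> 2 1) y" for m
    unfolding pg
    by (simp add: pa(1) pa(3) dd J(1) a_def p_def q_def algebra_simps power2_eq_square)
  have p12: "partial U 1 (\<lambda>z. g z $ 1 $ 2) y =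
      B1 * (p * c + q * d) + a * (partial U 1 (\<lambda>z. h (\<psi> z) $ 1 $ 1) y * c + p * B2
        + partial U 1 (\<lambda>z. h (\<psi> z) $ 1 $ 2) y * d + q * B3)"
    unfolding pg
    by (simp add: pa(1) pa(3) dd J(1,2) sym a_def c_def d_def p_def q_def B1_def B2_def B3_def algebra_simps)
  have hcp: "partial U 1 (\<lambda>z. h (\<psi> z) $ 1 $ j) y = a * partial V 1 (\<lambda>z. h z $ 1 $ j) (\<psi> y)"
    "partial U 2 (\<lambda>z. h (\<psi> z) $ 1 $ j) y =
      c * partial V 1 (\<lambda>z. h z $ 1 $ j) (\<psi> y) + d * partial V 2 (\<lambda>z. h z $ 1 $ j) (\<psi> y)" for j
    by (simp_all add: hc(2) J(1) a_def c_def d_def)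
  have ap: "a \<noteq> 0" "p > 0" using J(4) spd_pos(1)[OF hs] by (simp_all add: a_def p_def)
  define P1 P2 Q1 where "P1 = partial V 1 (\<lambda>z. h z $ 1 $ 1) (\<psi> y)"
    and "P2 = partial V 2 (\<lambda>z. h z $ 1 $ 1) (\<psi> y)" and "Q1 = partial V 1 (\<lambda>z. h z $ 1 $ 2) (\<psi> y)"
  have "n1 * (partial U 1 (\<lambda>z. g z $ 1 $ 1) y / 2 - partial U 1 (\<lambda>z. g z $ 1 $ 1) y)
      + n2 * (partial U 2 (\<lambda>z. g z $ 1 $ 1) y / 2 - partial U 1 (\<lambda>z. g z $ 1 $ 2) y)
     = a\<^sup>2 * ((a * n1 + c * n2) * (P1 / 2 - P1) + d * n2 * (P2 / 2 - Q1)) - B1 * (p * (a * n1 + c * n2) + q * (d * n2))"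
    unfolding p11 p12 hcp P1_def[symmetric] P2_def[symmetric] Q1_def[symmetric] J(2)
      B1_def[symmetric] B2_def[symmetric] B3_def[symmetric]
    by (simp add: J(2) field_simps power2_eq_square)
  also have "\<dots> = a\<^sup>2 * ((a * n1 + c * n2) * (P1 / 2 - P1) + d * n2 * (P2 / 2 - Q1))"
    unfolding perp by simp
  finally have eq: "n1 * (partial U 1 (\<lambda>z. g z $ 1 $ 1) y / 2 - partial U 1 (\<lambda>z. g z $ 1 $ 1) y)
      + n2 * (partial U 2 (\<lambda>z. g z $ 1 $ 1) y / 2 - partial U 1 (\<lambda>z. g z $ 1 $ 2) y)
     = a\<^sup>2 * ((a * n1 + c * n2) * (P1 / 2 - P1) + d * n2 * (P2 / 2 - Q1))" .
  have "geodesic_coord U g y =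
      a\<^sup>2 * ((a * n1 + c * n2) * (P1 / 2 - P1) + d * n2 * (P2 / 2 - Q1)) / (a\<^sup>2 * p)"
    unfolding geodesic_coord_eq[OF tD(1) y(1)] sum_2 n1_def[symmetric] n2_def[symmetric] eq g11 ..
  also have "\<dots> = ((a * n1 + c * n2) * (P1 / 2 - P1) + d * n2 * (P2 / 2 - Q1)) / p"
    using ap by simp
  also have "\<dots> = geodesic_coord V h (\<psi> y)"
    unfolding geodesic_coord_eq[OF tD(2) tD(5)[OF y(1)]] sum_2 normal_coord_transition[OF t y b]
      J(1) a_def c_def d_def n1_def n2_def P1_def P2_def Q1_def p_def by simp
  finally show ?thesis .
qed

section \<open>Charts of a surface\<close>

lemma metric_on_subset:
  assumes "metric_on W g" "hopen U" "U \<subseteq> W"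
  shows "metric_on U g"
  using assms unfolding metric_on_def by (meson differentiable_within_subset subsetD)

lemma laplace_coord_local:
  assumes "hopen U" "hopen W" "U \<subseteq> W" "y \<in> U" "\<And>z. z \<in> U \<Longrightarrow> f z = f' z"
  shows "laplace_coord W g f y = laplace_coord U g f' y"
proof -
  have "flux W g f i z = flux U g f' i z" if "z \<in> U" for i z
    unfolding flux_def using partial_local[OF assms(1-3) that assms(5)] by simp
  then have "partial W i (flux W g f i) y = partial U i (flux U g f' i) y" for i
    by (rule partial_local[OF assms(1-4)])
  then show ?thesis by (simp add: laplace_coord_flux)
qed

lemma geodesic_coord_local:
  assumes "metric_on W g" "hopen U" "U \<subseteq> W" "y \<in> U"
  shows "geodesic_coord W g y = geodesic_coord U g y"
proof -
  have yW: "y \<in> W" using assms by blast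
  have eq: "partial W i f y = partial U i f y" for i f
    by (rule partial_local[OF assms(2) metric_onD(1)[OF assms(1)] assms(3,4) refl])
  show ?thesis
    unfolding geodesic_coord_eq[OF assms(1) yW] geodesic_coord_eq[OF metric_on_subset[OF assms(1-3)] assms(4)] eq ..
qed

locale surface =
  fixes X :: "'a topology" and A :: "'a chart set" and G :: "'a metric_coeffs"
  assumes surface: "compact_riemannian_surface X A G"
begin

lemma
  assumes "c \<in> A"
  shows chart_open: "openin X (fst c)"
    and chart_range_hopen: "hopen (chart_range c)"
    and chart_homeo: "homeomorphic_map (subtopology X (fst c)) (top_of_set (chart_range c)) (snd c)"
    and chart_inj: "inj_on (snd c) (fst c)"
proof -
  have "is_chart X c" using surface assms by (auto simp: compact_riemannian_surface_def smooth_atlas_def)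
  then show *: "openin X (fst c)" "hopen (chart_range c)"
    "homeomorphic_map (subtopology X (fst c)) (top_of_set (chart_range c)) (snd c)"
    by (auto simp: is_chart_def)
  have "topspace (subtopology X (fst c)) = fst c"
    using openin_subset[OF *(1)] by auto
  with *(3) show "inj_on (snd c) (fst c)" by (simp add: homeomorphic_eq_everything_map)
qed

lemma chart_inv_left: "c \<in> A \<Longrightarrow> p \<in> fst c \<Longrightarrow> chart_inv c (snd c p) = p"
  unfolding chart_inv_def using chart_inj by (rule inv_into_f_f)

lemma chart_inv_right: "y \<in> chart_range c \<Longrightarrow> snd c (chart_inv c y) = y"
  unfolding chart_inv_def chart_range_def by (rule f_inv_into_f)

lemma chart_inv_in: "y \<in> chart_range c \<Longrightarrow> chart_inv c y \<in> fst c"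
  unfolding chart_inv_def chart_range_def by (rule inv_into_into)

lemma chart_range_in: "p \<in> fst c \<Longrightarrow> snd c p \<in> chart_range c"
  by (auto simp: chart_range_def)

lemma chart_subset_topspace: "c \<in> A \<Longrightarrow> fst c \<subseteq> topspace X"
  using chart_open openin_subset by blast

lemma chart_covers:
  assumes "p \<in> topspace X" obtains c where "c \<in> A" "p \<in> fst c"
proof -
  have "p \<in> (\<Union>c\<in>A. fst c)"
    using surface assms by (simp add: compact_riemannian_surface_def smooth_atlas_def)
  then show ?thesis using that by blast
qed

lemma chart_at:
  assumes "p \<in> topspace X" shows "chart_at A p \<in> A" "p \<in> fst (chart_at A p)"
proof -
  have "\<exists>c. c \<in> A \<and> p \<in> fst c" using chart_covers[OF assms] by metis
  from someI_ex[OF this] show "chart_at A p \<in> A" "p \<in> fst (chart_at A p)"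
    by (auto simp: chart_at_def)
qed

lemma chart_metric:
  assumes c: "c \<in> A" shows "metric_on (chart_range c) (G c)"
  unfolding metric_on_def
proof (intro conjI ballI allI)
  note r = surface[unfolded compact_riemannian_surface_def riemannian_metric_def]
  show W: "hopen (chart_range c)" by (rule chart_range_hopen[OF c])
  fix y assume y: "y \<in> chart_range c"
  show "spd (G c y)" using r c y by (auto simp: spd_def)
  have "smooth_on (chart_range c) (G c)" using r c by auto
  from smooth_on_component2[OF W this] have "Ck_on 2 (chart_range c) (\<lambda>x. G c x $ i $ j)" for i j
    by (simp add: smooth_on_def)
  from Ck2D(1)[OF this y] show "(\<lambda>z. G c z $ i $ j) differentiable (at y within chart_range c)" for i j .
qed

lemma chart_metric_Ck2:
  assumes c: "c \<in> A" shows "Ck_on 2 (chart_range c) (\<lambda>z. G c z $ i $ j)"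
proof -
  note r = surface[unfolded compact_riemannian_surface_def riemannian_metric_def]
  have "smooth_on (chart_range c) (G c)" using r c by auto
  from smooth_on_component2[OF chart_range_hopen[OF c] this] show ?thesis
    by (simp add: smooth_on_def)
qed

abbreviation overlap :: "'a chart \<Rightarrow> 'a chart \<Rightarrow> (real^2) set" where
  "overlap c d \<equiv> snd c ` (fst c \<inter> fst d)"

lemma overlap_hopen:
  assumes "c \<in> A" "openin X V"
  shows "hopen (snd c ` (fst c \<inter> V))" "snd c ` (fst c \<inter> V) \<subseteq> chart_range c"
proof -
  show "snd c ` (fst c \<inter> V) \<subseteq> chart_range c" by (auto simp: chart_range_def)
  have "openin (subtopology X (fst c)) (fst c \<inter> V)"
    using assms(2) by (auto simp: openin_subtopology)
  then have "openin (top_of_set (chart_range c)) (snd c ` (fst c \<inter> V))"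
    using chart_homeo[OF assms(1)] by (meson homeomorphic_imp_open_map open_map_def)
  then show "hopen (snd c ` (fst c \<inter> V))"
    using chart_range_hopen[OF assms(1)] openin_trans by blast
qed

lemma chart_transition:
  assumes c: "c \<in> A" and d: "d \<in> A"
  shows "transition (overlap c d) (chart_range d) (snd d \<circ> chart_inv c) (G c) (G d)"
  unfolding transition_def
proof (intro conjI ballI allI)
  note o = overlap_hopen[OF c chart_open[OF d]]
  show "metric_on (overlap c d) (G c)" by (rule metric_on_subset[OF chart_metric[OF c] o])
  show "metric_on (chart_range d) (G d)" by (rule chart_metric[OF d])
  show "(snd d \<circ> chart_inv c) ` overlap c d \<subseteq> chart_range d"
    using chart_inv_left[OF c] by (auto simp: chart_range_def)
  show "smooth_on (overlap c d) (snd d \<circ> chart_inv c)"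
    using surface c d by (auto simp: compact_riemannian_surface_def smooth_atlas_def)
  fix y v w assume "y \<in> overlap c d"
  then obtain p where p: "p \<in> fst c \<inter> fst d" "y = snd c p" by blast
  have "v \<bullet> (G c (snd c p) *v w) =
      frechet_derivative (snd d \<circ> chart_inv c) (at (snd c p) within overlap c d) v \<bullet>
      (G d (snd d p) *v frechet_derivative (snd d \<circ> chart_inv c) (at (snd c p) within overlap c d) w)"
    using surface c d p(1) unfolding compact_riemannian_surface_def riemannian_metric_def Let_def by blast
  then show "v \<bullet> (G c y *v w) =
      frechet_derivative (snd d \<circ> chart_inv c) (at y within overlap c d) v \<bullet>
      (G d ((snd d \<circ> chart_inv c) y) *v frechet_derivative (snd d \<circ> chart_inv c) (at y within overlap c d) w)"
    using p chart_inv_left[OF c] by simp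
qed

lemma overlap_compose:
  assumes "c \<in> A" "d \<in> A" "z \<in> overlap c d"
  shows "(f \<circ> chart_inv c) z = (f \<circ> chart_inv d) ((snd d \<circ> chart_inv c) z)"
  using assms(3) chart_inv_left[OF assms(1)] chart_inv_left[OF assms(2)] by auto

text \<open>The definition evaluates in a chart picked by choice, which may jump from point to
  point. Continuity bounds and maximum arguments live in one fixed chart, so the choice is
  eliminated here.\<close>

lemma laplacian_eq:
  assumes c: "c \<in> A" "p \<in> fst c" and f: "\<And>d. d \<in> A \<Longrightarrow> Ck_on 2 (chart_range d) (f \<circ> chart_inv d)"
  shows "laplacian A G f p = laplace_coord (chart_range c) (G c) (f \<circ> chart_inv c) (snd c p)"
proof -
  define d where "d = chart_at A p"
  have d: "d \<in> A" "p \<in> fst d"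
    using chart_at[of p] subsetD[OF chart_subset_topspace[OF c(1)] c(2)] by (simp_all add: d_def)
  let ?\<psi> = "snd d \<circ> chart_inv c"
  have y: "snd c p \<in> overlap c d" using c d by auto
  have "laplace_coord (chart_range c) (G c) (f \<circ> chart_inv c) (snd c p)
      = laplace_coord (overlap c d) (G c) (\<lambda>z. (f \<circ> chart_inv d) (?\<psi> z)) (snd c p)"
    by (rule laplace_coord_local[OF overlap_hopen(1)[OF c(1) chart_open[OF d(1)]] chart_range_hopen[OF c(1)]
          overlap_hopen(2)[OF c(1) chart_open[OF d(1)]] y overlap_compose[OF c(1) d(1)]])
  also have "\<dots> = laplace_coord (chart_range d) (G d) (f \<circ> chart_inv d) (?\<psi> (snd c p))"
    by (rule laplace_coord_invariant[OF chart_transition[OF c(1) d(1)] y f[OF d(1)]])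
  finally show ?thesis
    by (simp add: laplacian_def Let_def d_def[symmetric] chart_inv_left[OF c])
qed

lemma chart_nonneg: "c \<in> A \<Longrightarrow> p \<in> fst c \<Longrightarrow> 0 \<le> snd c p $ 2"
  by (rule hopen_nonneg[OF chart_range_hopen chart_range_in])

text \<open>If the point were interior in the chart \<open>d\<close>, the second coordinate of the
  transition to \<open>c\<close> would have an interior minimum there. Its gradient would vanish,
  contradicting invertibility of the Jacobian; this differentiable argument replaces invariance of
  domain.\<close>

lemma boundary_invariant:
  assumes c: "c \<in> A" "p \<in> fst c" and d: "d \<in> A" "p \<in> fst d" and 0: "snd c p $ 2 = 0"
  shows "snd d p $ 2 = 0"
proof (rule ccontr)
  let ?U = "overlap d c" and ?\<psi> = "snd c \<circ> chart_inv d" and ?y = "snd d p"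
  assume "snd d p $ 2 \<noteq> 0"
  with chart_nonneg[OF d] have pos: "0 < ?y $ 2" by simp
  note t = chart_transition[OF d(1) c(1)]
  note tD = transitionD[OF t]
  have y: "?y \<in> ?U" using c d by auto
  obtain e where e: "e > 0" "ball ?y e \<subseteq> ?U" using at_within_hopen_interior(2)[OF tD(3) y pos] by blast
  let ?D = "\<lambda>v::real^2. v $ 1 * jac ?U ?\<psi> 2 1 ?y + v $ 2 * jac ?U ?\<psi> 2 2 ?y"
  have "((\<lambda>z. ?\<psi> z $ 2) has_derivative ?D) (at ?y)"
    using has_derivative_partials[OF tD(3) y Ck2D(1)[OF tD(6) y]]
      at_within_hopen_interior(1)[OF tD(3) y pos] by simp
  moreover have "\<forall>z\<in>ball ?y e. ?\<psi> ?y $ 2 \<le> ?\<psi> z $ 2"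
    using 0 chart_inv_left[OF d] hopen_nonneg[OF tD(4) tD(5)] e(2) by auto
  ultimately have "?D = (\<lambda>v. 0)"
    using e(1) differential_zero_maxmin[of ?y "ball ?y e" "\<lambda>z. ?\<psi> z $ 2" ?D] by simp
  from fun_cong[OF this, of "axis 1 1"] fun_cong[OF this, of "axis 2 1"]
  have "jac ?U ?\<psi> 2 1 ?y = 0" "jac ?U ?\<psi> 2 2 ?y = 0" by simp_all
  then show False using jdet_square(2)[OF t y] by (simp add: jdet_def)
qed

lemma surface_boundary_iff:
  assumes "c \<in> A" "p \<in> fst c"
  shows "p \<in> surface_boundary A \<longleftrightarrow> snd c p $ 2 = 0"
  using assms boundary_invariant unfolding surface_boundary_def by blast

lemma surface_interior_iff:
  assumes "c \<in> A" "p \<in> fst c"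
  shows "p \<in> surface_interior X A \<longleftrightarrow> 0 < snd c p $ 2"
  using surface_boundary_iff[OF assms] chart_nonneg[OF assms]
    subsetD[OF chart_subset_topspace[OF assms(1)] assms(2)]
  by (auto simp: surface_interior_def)

lemma overlap_boundary:
  assumes "c \<in> A" "d \<in> A"
  shows "\<forall>z\<in>overlap c d. z $ 2 = 0 \<longrightarrow> (snd d \<circ> chart_inv c) z $ 2 = 0"
  using boundary_invariant[OF assms(1) _ assms(2)] chart_inv_left[OF assms(1)] by auto

lemma
  assumes c: "c \<in> A" "p \<in> fst c" and p: "p \<in> surface_boundary A"
  shows geodesic_curvature_eq: "geodesic_curvature A G p = geodesic_coord (chart_range c) (G c) (snd c p)"
    and normal_derivative_eq: "(\<And>d y. d \<in> A \<Longrightarrow> y \<in> chart_range d \<Longrightarrow> (f \<circ> chart_inv d) differentiable (at y within chart_range d)) \<Longrightarrow>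
      normal_derivative A G f p = (\<Sum>i\<in>UNIV. normal_coord (G c) (snd c p) $ i *
        partial (chart_range c) i (f \<circ> chart_inv c) (snd c p))"
proof -
  define d where "d = chart_at A p"
  have d: "d \<in> A" "p \<in> fst d"
    using chart_at[of p] subsetD[OF chart_subset_topspace[OF c(1)] c(2)] by (simp_all add: d_def)
  let ?\<psi> = "snd c \<circ> chart_inv d" and ?U = "overlap d c" and ?y = "snd d p"
  have y: "?y \<in> ?U" using c d by auto
  have y2: "?y $ 2 = 0" using surface_boundary_iff[OF d] p by simp
  note t = chart_transition[OF d(1) c(1)]
  note U = overlap_hopen[OF d(1) chart_open[OF c(1)]]
  note b = overlap_boundary[OF d(1) c(1)]
  have \<psi>y: "?\<psi> ?y = snd c p" using chart_inv_left[OF d] by simp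
  show "geodesic_curvature A G p = geodesic_coord (chart_range c) (G c) (snd c p)"
    using geodesic_coord_local[OF chart_metric[OF d(1)] U y] geodesic_coord_transition[OF t y y2 b] \<psi>y
    by (simp add: geodesic_curvature_def Let_def d_def[symmetric])
  assume f: "\<And>d y. d \<in> A \<Longrightarrow> y \<in> chart_range d \<Longrightarrow> (f \<circ> chart_inv d) differentiable (at y within chart_range d)"
  let ?F = "f \<circ> chart_inv c"
  have F: "?F differentiable (at (?\<psi> ?y) within chart_range c)"
    unfolding \<psi>y by (rule f[OF c(1) chart_range_in[OF c(2)]])
  have pd: "partial (chart_range d) i (f \<circ> chart_inv d) ?y =
      partial (chart_range c) 1 ?F (snd c p) * jac ?U ?\<psi> 1 i ?y
      + partial (chart_range c) 2 ?F (snd c p) * jac ?U ?\<psi> 2 i ?y" for i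
  proof -
    have "partial (chart_range d) i (f \<circ> chart_inv d) ?y = partial ?U i (\<lambda>z. ?F (?\<psi> z)) ?y"
      by (rule partial_local[OF U(1) chart_range_hopen[OF d(1)] U(2) y overlap_compose[OF d(1) c(1)]])
    also have "\<dots> = partial (chart_range c) 1 ?F (?\<psi> ?y) * jac ?U ?\<psi> 1 i ?y
      + partial (chart_range c) 2 ?F (?\<psi> ?y) * jac ?U ?\<psi> 2 i ?y"
      by (rule compose_partial(2)[OF t y F])
    finally show ?thesis unfolding \<psi>y .
  qed
  have "normal_coord (G c) (snd c p) $ k = jac ?U ?\<psi> k 1 ?y * normal_coord (G d) ?y $ 1
      + jac ?U ?\<psi> k 2 ?y * normal_coord (G d) ?y $ 2" for k
    using normal_coord_transition[OF t y y2 b] unfolding \<psi>y .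
  then show "normal_derivative A G f p = (\<Sum>i\<in>UNIV. normal_coord (G c) (snd c p) $ i *
        partial (chart_range c) i ?F (snd c p))"
    unfolding normal_derivative_def Let_def d_def[symmetric] pd sum_2 by (simp add: algebra_simps)
qed

text \<open>All terms are evaluated at \<open>p\<close> in the same chart
  \<open>chart_at A p\<close>, so the coordinate identity transfers directly.\<close>

lemma geodesic_curvature_conformal:
  assumes p: "p \<in> topspace X"
    and w: "\<And>c y. c \<in> A \<Longrightarrow> y \<in> chart_range c \<Longrightarrow> (w \<circ> chart_inv c) differentiable (at y within chart_range c)"
  shows "geodesic_curvature A (conformal_metric w G) p =
    exp (- w p) * (normal_derivative A G w p + geodesic_curvature A G p)"
proof -
  note c = chart_at[OF p]
  show ?thesis
    using geodesic_coord_conformal[OF chart_metric[OF c(1)] chart_range_in[OF c(2)] w[OF c(1)]]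
    by (simp add: geodesic_curvature_def normal_derivative_def Let_def conformal_metric_def[abs_def]
        chart_inv_left[OF c])
qed

end

section \<open>Bounds on compact sets\<close>

lemma continuous_on_coefficients:
  assumes g: "metric_on W g" and g2: "\<And>i j. Ck_on 2 W (\<lambda>z. g z $ i $ j)"
  shows "continuous_on W (\<lambda>z. matrix_inv (g z) $ i $ j)" and "continuous_on W (drift W g j)"
proof -
  note W = metric_onD(1)[OF g]
  have gc: "continuous_on W (\<lambda>z. g z $ i $ j)" for i j by (rule Ck2D(5)[OF g2])
  have pc: "continuous_on W (partial W k (\<lambda>z. g z $ i $ j))" for i j k by (rule Ck2D(4)[OF g2])
  have cc: "continuous_on W (\<lambda>z. cof (g z) i j)" for i j
    using exhaust_2[of i] exhaust_2[of j] gc by (auto intro!: continuous_on_minus)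
  have dc: "continuous_on W (\<lambda>z. det (g z))"
    unfolding det_2 by (intro continuous_intros gc)
  have d: "det (g z) \<noteq> 0" "0 < det (g z)" if "z \<in> W" for z using metric_onD(4)[OF g that] by auto
  show "continuous_on W (\<lambda>z. matrix_inv (g z) $ i $ j)"
  proof (subst continuous_on_cong[OF refl])
    show "continuous_on W (\<lambda>z. cof (g z) i j / det (g z))"
      using d by (intro continuous_intros cc dc) auto
  qed (simp add: matrix_inv_nth d)
  have dp: "continuous_on W (partial W k (\<lambda>z. det (g z)))" for k
  proof (subst continuous_on_cong[OF refl])
    fix y assume y: "y \<in> W"
    note gd = metric_onD(3)[OF g y]
    note pa = partial_arith[OF W y]
    show "partial W k (\<lambda>z. det (g z)) y =
      partial W k (\<lambda>z. g z $ 1 $ 1) y * g y $ 2 $ 2 + g y $ 1 $ 1 * partial W k (\<lambda>z. g z $ 2 $ 2) y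
      - (partial W k (\<lambda>z. g z $ 1 $ 2) y * g y $ 2 $ 1 + g y $ 1 $ 2 * partial W k (\<lambda>z. g z $ 2 $ 1) y)"
      unfolding det_2
      by (simp add: pa(2)[OF differentiable_mult[OF gd gd] differentiable_mult[OF gd gd]] pa(3)[OF gd gd])
  qed (intro continuous_intros gc pc)
  have cp: "continuous_on W (partial W k (\<lambda>z. cof (g z) i j))" for i j k
  proof -
    have neg: "continuous_on W (partial W k (\<lambda>z. - g z $ i $ j))" for i j
    proof (subst continuous_on_cong[OF refl])
      fix y assume y: "y \<in> W"
      show "partial W k (\<lambda>z. - g z $ i $ j) y = - partial W k (\<lambda>z. g z $ i $ j) y"
        by (rule partial_arith(4)[OF W y metric_onD(3)[OF g y] metric_onD(3)[OF g y]])
    qed (intro continuous_intros pc)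
    show ?thesis using exhaust_2[of i] exhaust_2[of j] pc neg by auto
  qed
  have "continuous_on W (partial W k (dens g i j))" for k i j
  proof (subst continuous_on_cong[OF refl dens_partial(2)[OF g]])
    show "continuous_on W (\<lambda>y. partial W k (\<lambda>z. cof (g z) i j) y / sqrt (det (g y)) -
         cof (g y) i j * partial W k (\<lambda>z. det (g z)) y / (2 * det (g y) * sqrt (det (g y))))"
      using d by (intro continuous_intros cc dc cp dp) auto
  qed
  then show "continuous_on W (drift W g j)"
    unfolding drift_def[abs_def] sum_2 using d by (intro continuous_intros dc) auto
qed

lemma continuous_on_laplace_coord:
  assumes g: "metric_on W g" and g2: "\<And>i j. Ck_on 2 W (\<lambda>z. g z $ i $ j)" and f: "Ck_on 2 W f"
  shows "continuous_on W (laplace_coord W g f)"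
  by (subst continuous_on_cong[OF refl laplace_coord_expand[OF g _ Ck2D(2)[OF f]]], assumption+)
     (intro continuous_intros continuous_on_coefficients[OF g g2] Ck2D(3,4)[OF f])

text \<open>Continuity in each variable does not give joint continuity; a Lipschitz bound in time
  that is uniform in space does. It turns the chartwise Hoelder regularity into continuity on
  space-time compacta.\<close>

lemma continuous_on_Times_Lipschitz:
  fixes f :: "'b::metric_space \<Rightarrow> real \<Rightarrow> real"
  assumes "\<And>t. t \<in> I \<Longrightarrow> continuous_on K (\<lambda>y. f y t)"
    and "\<And>y s t. y \<in> K \<Longrightarrow> s \<in> I \<Longrightarrow> t \<in> I \<Longrightarrow> \<bar>f y s - f y t\<bar> \<le> M * \<bar>s - t\<bar>"
  shows "continuous_on (K \<times> I) (\<lambda>z. f (fst z) (snd z))"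
  unfolding continuous_on_def
proof
  fix z assume z: "z \<in> K \<times> I"
  let ?F = "at z within K \<times> I"
  have fs: "(fst \<longlongrightarrow> fst z) ?F" "(snd \<longlongrightarrow> snd z) ?F"
    by (intro tendsto_fst tendsto_snd tendsto_ident_at)+
  have "((\<lambda>x. f (fst x) (snd z)) \<longlongrightarrow> f (fst z) (snd z)) ?F"
    using continuous_on_compose2[OF assms(1)[of "snd z"] continuous_on_fst[OF continuous_on_id], of "K \<times> I"] z
    by (auto simp: continuous_on_def)
  moreover have "((\<lambda>x. f (fst x) (snd x) - f (fst x) (snd z)) \<longlongrightarrow> 0) ?F"
  proof (rule Lim_null_comparison)
    show "\<forall>\<^sub>F x in ?F. norm (f (fst x) (snd x) - f (fst x) (snd z)) \<le> M * \<bar>snd x - snd z\<bar>"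
      using z assms(2) by (auto simp: eventually_at_filter intro!: always_eventually)
    show "((\<lambda>x. M * \<bar>snd x - snd z\<bar>) \<longlongrightarrow> 0) ?F"
      using tendsto_mult_left[OF tendsto_rabs[OF LIM_zero[OF fs(2)]], of M] by simp
  qed
  ultimately show "((\<lambda>x. f (fst x) (snd x)) \<longlongrightarrow> f (fst z) (snd z)) ?F"
    using tendsto_add by fastforce
qed

context surface
begin

text \<open>Uniformity of constants by compactness, packaged once: take a finite subcover and the
  maximum of its constants. The constant may be a bound or, as for the normal derivative, a time
  from which an estimate holds.\<close>

lemma local_to_global:
  fixes P :: "'a \<Rightarrow> real \<Rightarrow> bool"
  assumes loc: "\<And>p. p \<in> topspace X \<Longrightarrow> \<exists>U. openin X U \<and> p \<in> U \<and> (\<exists>C. \<forall>q\<in>U. P q C)"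
    and mono: "\<And>q C C'. P q C \<Longrightarrow> C \<le> C' \<Longrightarrow> P q C'"
  shows "\<exists>C. \<forall>q\<in>topspace X. P q C"
proof -
  define \<U> where "\<U> = {U. openin X U \<and> (\<exists>C. \<forall>q\<in>U. P q C)}"
  have "compact_space X" using surface by (simp add: compact_riemannian_surface_def)
  moreover have "\<forall>U\<in>\<U>. openin X U" "topspace X \<subseteq> \<Union>\<U>"
    unfolding \<U>_def using loc by (simp, blast)
  ultimately obtain \<F> where F: "finite \<F>" "\<F> \<subseteq> \<U>" "topspace X \<subseteq> \<Union>\<F>"
    unfolding compact_space_def compactin_def by meson
  have "\<exists>C. \<forall>q\<in>\<Union>\<F>. P q C" using F(1,2)
  proof (induction \<F>)
    case (insert U \<F>)
    then obtain C C' where "\<forall>q\<in>\<Union>\<F>. P q C" "\<forall>q\<in>U. P q C'" by (auto simp: \<U>_def)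
    then have "P q (max C C')" if "q \<in> \<Union>(insert U \<F>)" for q
      using that mono[of q C "max C C'"] mono[of q C' "max C C'"] by auto
    then show ?case by blast
  qed auto
  then show ?thesis using F(3) by blast
qed

text \<open>The radius is kept below 1 so that the cut-off polynomial \<open>rho\<close> is bounded
  by 1 on the half-disc.\<close>

lemma half_disc:
  assumes c: "c \<in> A" "p \<in> fst c"
  obtains r where "0 < r" "r \<le> 1" "cball (snd c p) r \<inter> half_plane \<subseteq> chart_range c"
proof -
  obtain e where e: "e > 0" "ball (snd c p) e \<inter> half_plane \<subseteq> chart_range c"
    by (rule hopenE[OF chart_range_hopen[OF c(1)] chart_range_in[OF c(2)]])
  have "cball (snd c p) (min 1 (e / 2)) \<subseteq> ball (snd c p) e" using e(1) by auto
  with e that[of "min 1 (e / 2)"] show ?thesis by auto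
qed

lemma compact_half_disc: "compact (cball y r \<inter> half_plane)"
proof -
  have "closed half_plane" unfolding half_plane_def by (intro closed_Collect_le continuous_intros)
  then show ?thesis by (intro compact_Int_closed) auto
qed

lemma openin_chart_ball:
  assumes c: "c \<in> A"
  shows "openin X {q \<in> fst c. snd c q \<in> ball y r}"
proof -
  have "continuous_map (subtopology X (fst c)) (top_of_set (chart_range c)) (snd c)"
    by (rule homeomorphic_imp_continuous_map[OF chart_homeo[OF c]])
  moreover have "openin (top_of_set (chart_range c)) (chart_range c \<inter> ball y r)" by auto
  ultimately have "openin (subtopology X (fst c))
      {q \<in> topspace (subtopology X (fst c)). snd c q \<in> chart_range c \<inter> ball y r}"
    by (rule openin_continuous_map_preimage)
  moreover have "{q \<in> topspace (subtopology X (fst c)). snd c q \<in> chart_range c \<inter> ball y r}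
      = {q \<in> fst c. snd c q \<in> ball y r}"
    using chart_subset_topspace[OF c] chart_range_in[of _ c] by auto
  ultimately show ?thesis using chart_open[OF c] openin_trans_full by metis
qed

lemma local_to_global_compact:
  fixes P :: "'a \<Rightarrow> real \<Rightarrow> bool"
  assumes loc: "\<And>c K. c \<in> A \<Longrightarrow> compact K \<Longrightarrow> K \<subseteq> chart_range c \<Longrightarrow>
      \<exists>C. \<forall>q\<in>fst c. snd c q \<in> K \<longrightarrow> P q C"
    and mono: "\<And>q C C'. P q C \<Longrightarrow> C \<le> C' \<Longrightarrow> P q C'"
  shows "\<exists>C. \<forall>q\<in>topspace X. P q C"
proof (rule local_to_global[OF _ mono])
  fix p assume "p \<in> topspace X"
  then obtain c where c: "c \<in> A" "p \<in> fst c" by (rule chart_covers)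
  obtain r where r: "0 < r" "cball (snd c p) r \<inter> half_plane \<subseteq> chart_range c"
    by (rule half_disc[OF c])
  obtain C where C: "\<forall>q\<in>fst c. snd c q \<in> cball (snd c p) r \<inter> half_plane \<longrightarrow> P q C"
    using loc[OF c(1) compact_half_disc r(2)] by blast
  have "\<forall>q\<in>{q \<in> fst c. snd c q \<in> ball (snd c p) r}. P q C"
    using C chart_nonneg[OF c(1)] by (auto simp: half_plane_def)
  then show "\<exists>U. openin X U \<and> p \<in> U \<and> (\<exists>C. \<forall>q\<in>U. P q C)"
    using openin_chart_ball[OF c(1)] c(2) r(1) by (intro exI[of _ "{q \<in> fst c. snd c q \<in> ball (snd c p) r}"]) auto
qed

end

section \<open>Functions in parabolic Hoelder classes\<close>

locale evolution = surface +
  fixes a :: real and u :: "'a \<Rightarrow> real \<Rightarrow> real"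
  assumes a_pos: "0 < a" and regular: "\<And>T. 0 < T \<Longrightarrow> C2_parabolic_holder A a T u"
begin

abbreviation loc_u :: "'a chart \<Rightarrow> real \<Rightarrow> real^2 \<Rightarrow> real" where
  "loc_u c t y \<equiv> u (chart_inv c y) t"

lemma loc_u_Ck2:
  assumes "c \<in> A" "0 \<le> t" shows "Ck_on 2 (chart_range c) (loc_u c t)"
  using regular[of "t + 1"] assms by (auto simp: C2_parabolic_holder_def C2_parabolic_holder_on_def)

lemma comp_loc_u: "(\<lambda>q. u q t) \<circ> chart_inv c = loc_u c t"
  by (simp add: fun_eq_iff)

lemma laplacian_u:
  assumes "c \<in> A" "p \<in> fst c" "0 \<le> t"
  shows "laplacian A G (\<lambda>q. u q t) p = laplace_coord (chart_range c) (G c) (loc_u c t) (snd c p)"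
  using laplacian_eq[OF assms(1,2), of "\<lambda>q. u q t"] loc_u_Ck2[OF _ assms(3)] by (simp only: comp_loc_u)

text \<open>\<open>time_deriv\<close> differentiates within all nonnegative times, the Hoelder class
  within \<open>{0..T}\<close>. The two agree strictly below \<open>T\<close>, which explains the
  half-open time intervals and the choice \<open>T = t + 1\<close> elsewhere.\<close>

lemma within_time:
  assumes "0 \<le> t" "t < T"
  shows "at t within {0..T} = at t within {0::real..}"
  using assms by (intro at_within_nhd[of t "{..<T}"]) auto

lemma u_time_derivative:
  assumes p: "p \<in> topspace X" and t: "0 \<le> t"
  shows "(u p has_real_derivative time_deriv u p t) (at t within {0..})"
proof -
  obtain c where c: "c \<in> A" "p \<in> fst c" by (rule chart_covers[OF p])
  have "(u (chart_inv c (snd c p))) differentiable_on {0..t + 1}"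
    using regular[of "t + 1"] c t chart_range_in[OF c(2)]
    by (simp add: C2_parabolic_holder_def C2_parabolic_holder_on_def)
  then have "u p differentiable (at t within {0..t + 1})"
    using t by (simp add: differentiable_on_def chart_inv_left[OF c])
  then have "u p differentiable (at t within {0..})" using within_time[of t "t + 1"] t by simp
  then have "(u p has_vector_derivative time_deriv u p t) (at t within {0..})"
    by (simp add: time_deriv_def vector_derivative_works)
  then show ?thesis by (simp add: has_real_derivative_iff_has_vector_derivative)
qed

text \<open>A Hoelder estimate against one base point at time 0 bounds the derivative on a bounded
  set of space-time.\<close>

lemma time_deriv_bounded:
  assumes c: "c \<in> A" and K: "compact K" "K \<subseteq> chart_range c" and T: "0 < T"
  shows "\<exists>M. \<forall>y\<in>K. \<forall>t\<in>{0..<T}. \<bar>time_deriv u (chart_inv c y) t\<bar> \<le> M"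
proof (cases "K = {}")
  case False
  then obtain x where x: "x \<in> K" by blast
  let ?f = "\<lambda>y t. vector_derivative (u (chart_inv c y)) (at t within {0..T})"
  have "parabolic_holder_on a K {0..T} ?f"
    using regular[OF T] c K by (simp add: C2_parabolic_holder_def C2_parabolic_holder_on_def)
  then obtain C where C: "\<And>x y s t. x \<in> K \<Longrightarrow> y \<in> K \<Longrightarrow> s \<in> {0..T} \<Longrightarrow> t \<in> {0..T} \<Longrightarrow>
      \<bar>?f x s - ?f y t\<bar> \<le> C * (dist x y powr a + \<bar>s - t\<bar> powr (a / 2))"
    unfolding parabolic_holder_on_def by meson
  obtain D where D: "\<And>y. y \<in> K \<Longrightarrow> dist x y \<le> D"
    using compact_imp_bounded[OF K(1)] unfolding bounded_any_center[where a = x] by blast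
  have "\<bar>time_deriv u (chart_inv c y) t\<bar> \<le> \<bar>?f x 0\<bar> + \<bar>C\<bar> * (D powr a + T powr (a / 2))"
    if y: "y \<in> K" and t: "t \<in> {0..<T}" for y t
  proof -
    have "\<bar>?f x 0 - ?f y t\<bar> \<le> C * (dist x y powr a + \<bar>0 - t\<bar> powr (a / 2))"
      using C[OF x y, of 0 t] t T by auto
    also have "\<dots> \<le> \<bar>C\<bar> * (dist x y powr a + \<bar>0 - t\<bar> powr (a / 2))"
      by (intro mult_right_mono) auto
    also have "\<dots> \<le> \<bar>C\<bar> * (D powr a + T powr (a / 2))"
      using D[OF y] t a_pos by (intro mult_left_mono add_mono powr_mono2) auto
    finally have "\<bar>?f y t\<bar> \<le> \<bar>?f x 0\<bar> + \<bar>C\<bar> * (D powr a + T powr (a / 2))" by linarith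
    then show ?thesis using within_time[of t T] t by (simp add: time_deriv_def)
  qed
  then show ?thesis by blast
qed auto

lemma u_Lipschitz:
  assumes c: "c \<in> A" and K: "compact K" "K \<subseteq> chart_range c" and T: "0 < T"
  shows "\<exists>M. \<forall>y\<in>K. \<forall>s\<in>{0..<T}. \<forall>t\<in>{0..<T}. \<bar>u (chart_inv c y) s - u (chart_inv c y) t\<bar> \<le> M * \<bar>s - t\<bar>"
proof -
  obtain M where M: "\<And>y t. y \<in> K \<Longrightarrow> t \<in> {0..<T} \<Longrightarrow> \<bar>time_deriv u (chart_inv c y) t\<bar> \<le> M"
    using time_deriv_bounded[OF assms] by blast
  have "\<bar>u (chart_inv c y) s - u (chart_inv c y) t\<bar> \<le> M * \<bar>s - t\<bar>"
    if y: "y \<in> K" and st: "s \<in> {0..<T}" "t \<in> {0..<T}" for y s t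
  proof -
    have p: "chart_inv c y \<in> topspace X"
      using chart_inv_in chart_subset_topspace[OF c] y K(2) by blast
    have "norm (u (chart_inv c y) s - u (chart_inv c y) t) \<le> M * norm (s - t)"
    proof (rule field_differentiable_bound[of "{0..<T}"])
      show "(u (chart_inv c y) has_field_derivative time_deriv u (chart_inv c y) z) (at z within {0..<T})"
        if "z \<in> {0..<T}" for z
        using that by (intro DERIV_subset[OF u_time_derivative[OF p]]) auto
    qed (use M y st in auto)
    then show ?thesis by simp
  qed
  then show ?thesis by blast
qed

lemma u_continuous:
  assumes c: "c \<in> A" and K: "compact K" "K \<subseteq> chart_range c" and T: "0 \<le> T0"
  shows "continuous_on (K \<times> {T0..T1}) (\<lambda>z. u (chart_inv c (fst z)) (snd z))"
proof -
  obtain M where M: "\<And>y s t. y \<in> K \<Longrightarrow> s \<in> {0..<max 0 T1 + 1} \<Longrightarrow> t \<in> {0..<max 0 T1 + 1} \<Longrightarrow>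
      \<bar>u (chart_inv c y) s - u (chart_inv c y) t\<bar> \<le> M * \<bar>s - t\<bar>"
  proof -
    have "0 < max 0 T1 + 1" by linarith
    from u_Lipschitz[OF c K this] show ?thesis using that by meson
  qed
  show ?thesis
  proof (rule continuous_on_Times_Lipschitz[where M = M])
    show "continuous_on K (loc_u c t)" if "t \<in> {T0..T1}" for t
      using Ck2D(5)[OF loc_u_Ck2[OF c]] K(2) T that continuous_on_subset by (metis atLeastAtMost_iff order_trans)
  qed (use T M in auto)
qed

text \<open>Continuity is known only in charts, so the extreme value theorem is not applied on the
  product of \<open>X\<close> with the time interval. If the supremum \<open>M\<close> were not
  attained, \<open>1 / (M - u)\<close> would be continuous in every chart, hence globally bounded,
  and \<open>u\<close> would stay a fixed distance below \<open>M\<close>.\<close>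

lemma u_attains_max:
  assumes ne: "topspace X \<noteq> {}" and T: "0 \<le> T0" "T0 \<le> T1"
  shows "\<exists>p\<in>topspace X. \<exists>t\<in>{T0..T1}. \<forall>q\<in>topspace X. \<forall>s\<in>{T0..T1}. u q s \<le> u p t"
proof (rule ccontr)
  assume not: "\<not> ?thesis"
  define S where "S = {u q s |q s. q \<in> topspace X \<and> s \<in> {T0..T1}}"
  have "\<exists>C. \<forall>q\<in>topspace X. \<forall>s\<in>{T0..T1}. u q s \<le> C"
  proof (rule local_to_global_compact)
    fix c K assume c: "c \<in> A" and K: "compact K" "K \<subseteq> chart_range c"
    have "compact ((\<lambda>z. u (chart_inv c (fst z)) (snd z)) ` (K \<times> {T0..T1}))"
      by (rule compact_continuous_image[OF u_continuous[OF c K T(1)]]) (use K compact_Times in auto)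
    from compact_imp_bounded[OF this] obtain C where
      "\<forall>x\<in>(\<lambda>z. u (chart_inv c (fst z)) (snd z)) ` (K \<times> {T0..T1}). norm x \<le> C"
      unfolding bounded_iff by blast
    then have "\<bar>u (chart_inv c (snd c q)) s\<bar> \<le> C" if "snd c q \<in> K" "s \<in> {T0..T1}" for q s
      using that by fastforce
    then have "\<forall>q\<in>fst c. snd c q \<in> K \<longrightarrow> (\<forall>s\<in>{T0..T1}. u q s \<le> C)"
      using chart_inv_left[OF c] by (metis abs_le_D1)
    then show "\<exists>C. \<forall>q\<in>fst c. snd c q \<in> K \<longrightarrow> (\<forall>s\<in>{T0..T1}. u q s \<le> C)" by blast
  qed force
  then obtain C where "\<And>q s. q \<in> topspace X \<Longrightarrow> s \<in> {T0..T1} \<Longrightarrow> u q s \<le> C" by blast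
  then have bdd: "bdd_above S" unfolding S_def by (intro bdd_aboveI[of _ C]) blast
  have neS: "S \<noteq> {}" 
  proof -
    obtain q where "q \<in> topspace X" using ne by blast
    then have "u q T0 \<in> S" using T by (auto simp: S_def)
    then show ?thesis by blast
  qed
  define M where "M = Sup S"
  have le: "u q s \<le> M" if "q \<in> topspace X" "s \<in> {T0..T1}" for q s
    unfolding M_def using that by (intro cSup_upper bdd) (auto simp: S_def)
  have lt: "u q s < M" if "q \<in> topspace X" "s \<in> {T0..T1}" for q s
    using not le that by (metis order_le_less)
  have "\<exists>C. \<forall>q\<in>topspace X. \<forall>s\<in>{T0..T1}. 1 / (M - u q s) \<le> C"
  proof (rule local_to_global_compact)
    fix c K assume c: "c \<in> A" and K: "compact K" "K \<subseteq> chart_range c"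
    have ne: "u (chart_inv c (fst z)) (snd z) \<noteq> M" if "z \<in> K \<times> {T0..T1}" for z
    proof -
      have "chart_inv c (fst z) \<in> topspace X"
        using that K(2) subsetD[OF chart_subset_topspace[OF c] chart_inv_in] by auto
      then show ?thesis using lt[of "chart_inv c (fst z)" "snd z"] that by auto
    qed
    have "continuous_on (K \<times> {T0..T1}) (\<lambda>z. 1 / (M - u (chart_inv c (fst z)) (snd z)))"
    proof (intro continuous_on_divide continuous_on_const continuous_on_diff u_continuous[OF c K T(1)] ballI)
      fix z assume "z \<in> K \<times> {T0..T1}"
      from ne[OF this] show "M - u (chart_inv c (fst z)) (snd z) \<noteq> 0" by linarith
    qed
    then have "compact ((\<lambda>z. 1 / (M - u (chart_inv c (fst z)) (snd z))) ` (K \<times> {T0..T1}))"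
      by (rule compact_continuous_image) (use K compact_Times in auto)
    from compact_imp_bounded[OF this] obtain C where
      "\<forall>x\<in>(\<lambda>z. 1 / (M - u (chart_inv c (fst z)) (snd z))) ` (K \<times> {T0..T1}). norm x \<le> C"
      unfolding bounded_iff by blast
    then have "\<bar>1 / (M - u (chart_inv c (snd c q)) s)\<bar> \<le> C" if "snd c q \<in> K" "s \<in> {T0..T1}" for q s
      using that by fastforce
    then have "\<forall>q\<in>fst c. snd c q \<in> K \<longrightarrow> (\<forall>s\<in>{T0..T1}. 1 / (M - u q s) \<le> C)"
      using chart_inv_left[OF c] by (metis abs_le_D1)
    then show "\<exists>C. \<forall>q\<in>fst c. snd c q \<in> K \<longrightarrow> (\<forall>s\<in>{T0..T1}. 1 / (M - u q s) \<le> C)" by blast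
  qed force
  then obtain C where C: "\<And>q s. q \<in> topspace X \<Longrightarrow> s \<in> {T0..T1} \<Longrightarrow> 1 / (M - u q s) \<le> C" by blast
  have Cp: "max C 1 > 0" by simp
  have "u q s \<le> M - 1 / max C 1" if "q \<in> topspace X" "s \<in> {T0..T1}" for q s
  proof -
    have "M - u q s > 0" using lt[OF that] by simp
    moreover have "1 / (M - u q s) \<le> max C 1" using C[OF that] by simp
    ultimately have "1 / max C 1 \<le> M - u q s" by (simp add: field_simps)
    then show ?thesis by simp
  qed
  then have "M \<le> M - 1 / max C 1"
    unfolding M_def by (intro cSup_least[OF neS]) (auto simp: S_def M_def)
  then show False using Cp by simp
qed

text \<open>The curvature enters the equation with a minus sign, and the comparison arguments bound
  \<open>u\<close> from above, so a lower bound is the relevant one.\<close>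

lemma gauss_curvature_bounded_below:
  assumes pde: "\<And>p. p \<in> surface_interior X A \<Longrightarrow> time_deriv u p 0 =
        exp (- 2 * u p 0) * (laplacian A G (\<lambda>q. u q 0) p - gauss_curvature A G p) - 1"
  shows "\<exists>B. \<forall>p\<in>topspace X. p \<in> surface_interior X A \<longrightarrow> - B \<le> gauss_curvature A G p"
proof (rule local_to_global_compact)
  fix c K assume c: "c \<in> A" and K: "compact K" "K \<subseteq> chart_range c"
  have cl: "continuous_on K (laplace_coord (chart_range c) (G c) (loc_u c 0))"
    using continuous_on_laplace_coord[OF chart_metric[OF c] chart_metric_Ck2[OF c] loc_u_Ck2[OF c order_refl]] K(2)
    by (rule continuous_on_subset)
  obtain L where L: "\<And>y. y \<in> K \<Longrightarrow> \<bar>laplace_coord (chart_range c) (G c) (loc_u c 0) y\<bar> \<le> L"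
    using compact_imp_bounded[OF compact_continuous_image[OF cl K(1)]] unfolding bounded_iff by auto
  have cu: "continuous_on K (loc_u c 0)"
    using Ck2D(5)[OF loc_u_Ck2[OF c order_refl]] K(2) by (rule continuous_on_subset)
  obtain D where D: "\<And>y. y \<in> K \<Longrightarrow> \<bar>loc_u c 0 y\<bar> \<le> D"
    using compact_imp_bounded[OF compact_continuous_image[OF cu K(1)]] unfolding bounded_iff by auto
  obtain M where M: "\<And>y t. y \<in> K \<Longrightarrow> t \<in> {0..<1} \<Longrightarrow> \<bar>time_deriv u (chart_inv c y) t\<bar> \<le> M"
    using time_deriv_bounded[OF c K zero_less_one] by meson
  have "- (L + exp (2 * D) * (M + 1)) \<le> gauss_curvature A G q"
    if q: "q \<in> fst c" "snd c q \<in> K" "q \<in> surface_interior X A" for q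
  proof -
    have inv: "chart_inv c (snd c q) = q" by (rule chart_inv_left[OF c q(1)])
    have td: "\<bar>time_deriv u q 0\<bar> \<le> M" using M[OF q(2), of 0] inv by simp
    have "exp (2 * u q 0) * exp (- 2 * u q 0) = 1" by (simp flip: exp_add)
    \<comment> \<open>Multiplying the equation by \<open>exp (2 u)\<close> isolates the curvature as
      the Laplacian of \<open>u\<close> minus \<open>exp (2 u) (u_t + 1)\<close>, and each of these
      terms is bounded on the compact set.\<close>
    then have "exp (2 * u q 0) * (time_deriv u q 0 + 1) = laplacian A G (\<lambda>q. u q 0) q - gauss_curvature A G q"
      unfolding pde[OF q(3)] by (simp add: mult.assoc[symmetric])
    moreover have "- L \<le> laplacian A G (\<lambda>q. u q 0) q"
      using L[OF q(2)] unfolding laplacian_u[OF c q(1) order_refl] by simp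
    moreover have "exp (2 * u q 0) * (time_deriv u q 0 + 1) \<le> exp (2 * D) * (M + 1)"
    proof -
      have "exp (2 * u q 0) * (time_deriv u q 0 + 1) \<le> exp (2 * u q 0) * (M + 1)"
        using td by (intro mult_left_mono) auto
      also have "\<dots> \<le> exp (2 * D) * (M + 1)"
        using td D[OF q(2)] inv by (intro mult_right_mono) auto
      finally show ?thesis .
    qed
    ultimately show ?thesis by linarith
  qed
  then show "\<exists>C. \<forall>q\<in>fst c. snd c q \<in> K \<longrightarrow> q \<in> surface_interior X A \<longrightarrow> - C \<le> gauss_curvature A G q"
    by blast
qed force

end

section \<open>The maximum principle\<close>

lemma second_derivative_max:
  fixes f :: "real \<Rightarrow> real"
  assumes d: "0 < d" and f: "\<And>s. \<bar>s\<bar> < d \<Longrightarrow> (f has_real_derivative f' s) (at s)"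
    and f': "(f' has_real_derivative m) (at 0)" and max: "\<And>s. \<bar>s\<bar> < d \<Longrightarrow> f s \<le> f 0"
  shows "f' 0 = 0" "m \<le> 0"
proof -
  show f0: "f' 0 = 0"
    using DERIV_local_max[OF f[of 0] d] d max by auto
  show "m \<le> 0"
  proof (rule ccontr)
    assume "\<not> m \<le> 0"
    then obtain e where e: "e > 0" "\<And>h. 0 < h \<Longrightarrow> h < e \<Longrightarrow> 0 < f' h"
      using DERIV_pos_inc_right[OF f'] f0 by auto
    define h where "h = min d e / 2"
    have h: "0 < h" "h < d" "h < e" using d e(1) by (auto simp: h_def)
    have "\<exists>z>0. z < h \<and> f h - f 0 = (h - 0) * f' z"
      using h by (intro MVT2 f) auto
    then obtain z where z: "0 < z" "z < h" "f h - f 0 = h * f' z" by auto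
    then have "0 < f h - f 0" using e(2)[of z] h by auto
    then show False using max[of h] h by auto
  qed
qed

text \<open>Only the past is compared: a maximum over a closed time interval may sit at its right
  end, where nothing is known about later times. The strict inequality \<open>T < t\<close> excludes
  the initial time.\<close>

lemma derivative_nonneg_at_right_end:
  fixes f :: "real \<Rightarrow> real"
  assumes f: "(f has_real_derivative D) (at t within S)" and T: "T < t" "{T..t} \<subseteq> S"
    and max: "\<And>s. s \<in> {T..t} \<Longrightarrow> f s \<le> f t"
  shows "0 \<le> D"
proof -
  have "(f has_real_derivative D) (at t within {T..<t})"
    using T by (intro DERIV_subset[OF f]) auto
  then have lim: "((\<lambda>s. (f s - f t) / (s - t)) \<longlongrightarrow> D) (at t within {T..<t})"
    by (simp add: has_field_derivative_iff)
  have ev: "\<forall>\<^sub>F s in at t within {T..<t}. 0 \<le> (f s - f t) / (s - t)"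
    using max by (auto simp: eventually_at_filter intro!: always_eventually divide_nonpos_nonpos)
  have "at t within {T..<t} \<noteq> bot"
    using T by (simp add: trivial_limit_within islimpt_Ico)
  from tendsto_lowerbound[OF lim ev this] show ?thesis .
qed

lemma Ck_on_subset:
  fixes f :: "real^2 \<Rightarrow> 'w::real_normed_vector"
  assumes "hopen U" "hopen W" "U \<subseteq> W" "Ck_on k W f"
  shows "Ck_on k U f"
  using assms(4)
proof (induction k arbitrary: f)
  case 0
  then show ?case using assms(3) continuous_on_subset by auto
next
  case (Suc k)
  have "f differentiable_on U"
    using Suc.prems assms(3) by (auto intro: differentiable_on_subset)
  moreover have "Ck_on k U (\<lambda>x. frechet_derivative f (at x within U) b)" if "b \<in> Basis" for b
  proof -
    have "Ck_on k U (\<lambda>x. frechet_derivative f (at x within W) b)"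
      using Suc that by simp
    then show ?thesis
      by (subst Ck_on_cong[where g = "\<lambda>x. frechet_derivative f (at x within W) b"])
         (simp_all add: at_within_hopen[OF assms(1-3)])
  qed
  ultimately show ?case by simp
qed

text \<open>The one-dimensional derivative tests hold along every line through \<open>y\<close>. The
  trace of \<open>M\<close> against the Hessian is then a positive combination of second derivatives
  along two lines, so no diagonalisation is involved.\<close>

lemma spatial_max:
  assumes U: "open U" "U \<subseteq> half_plane" and y: "y \<in> U"
    and f: "\<And>z. z \<in> U \<Longrightarrow> f differentiable (at z within U)"
    and f2: "\<And>j. partial U j f differentiable (at y within U)"
    and max: "\<And>z. z \<in> U \<Longrightarrow> f z \<le> f y" and M: "spd M"
  shows "partial U i f y = 0"
    and "(\<Sum>i\<in>UNIV. \<Sum>j\<in>UNIV. M $ i $ j * partial U i (partial U j f) y) \<le> 0"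
proof -
  have hU: "hopen U" using U by (auto simp: openin_open)
  obtain e where e: "e > 0" "ball y e \<subseteq> U" using U(1) y by (meson openE)
  have along: "v $ 1 * partial U 1 f y + v $ 2 * partial U 2 f y = 0 \<and>
      v $ 1 * (v $ 1 * partial U 1 (partial U 1 f) y + v $ 2 * partial U 2 (partial U 1 f) y)
      + v $ 2 * (v $ 1 * partial U 1 (partial U 2 f) y + v $ 2 * partial U 2 (partial U 2 f) y) \<le> 0"
    for v :: "real^2"
  proof -
    define d where "d = e / (norm v + 1)"
    have n: "0 < norm v + 1" using norm_ge_zero[of v] by linarith
    have d: "d > 0" using e n by (simp add: d_def)
    have in_U: "y + s *\<^sub>R v \<in> U" if s: "\<bar>s\<bar> < d" for s
    proof -
      have "\<bar>s\<bar> * norm v \<le> \<bar>s\<bar> * (norm v + 1)" by (intro mult_left_mono) auto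
      also have "\<dots> < e" using s n by (auto simp: d_def pos_less_divide_eq)
      finally show ?thesis using e(2) by (auto simp: dist_norm)
    qed
    have at: "at s within {- d<..<d} = at s" if "\<bar>s\<bar> < d" for s :: real
      using that by (intro at_within_open) auto
    have der: "((\<lambda>s. \<phi> (y + s *\<^sub>R v)) has_real_derivative
        (v $ 1 * partial U 1 \<phi> (y + s *\<^sub>R v) + v $ 2 * partial U 2 \<phi> (y + s *\<^sub>R v))) (at s)"
      if s: "\<bar>s\<bar> < d" and \<phi>: "\<phi> differentiable (at (y + s *\<^sub>R v) within U)" for s \<phi>
    proof -
      have "((\<lambda>s. \<phi> (y + s *\<^sub>R v)) has_derivative
          (\<lambda>r. (r *\<^sub>R v) $ 1 * partial U 1 \<phi> (y + s *\<^sub>R v) + (r *\<^sub>R v) $ 2 * partial U 2 \<phi> (y + s *\<^sub>R v)))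
          (at s within {- d<..<d})"
        by (rule has_derivative_along[OF has_derivative_partials[OF hU in_U[OF s] \<phi>]])
           (use in_U in auto)
      then show ?thesis
        unfolding has_field_derivative_def at[OF s]
        by (rule has_derivative_eq_rhs) (simp add: fun_eq_iff algebra_simps)
    qed
    let ?f' = "\<lambda>s. v $ 1 * partial U 1 f (y + s *\<^sub>R v) + v $ 2 * partial U 2 f (y + s *\<^sub>R v)"
    have f1: "((\<lambda>s. f (y + s *\<^sub>R v)) has_real_derivative ?f' s) (at s)" if "\<bar>s\<bar> < d" for s
      by (intro der f in_U that)
    have d2: "((\<lambda>s. partial U j f (y + s *\<^sub>R v)) has_real_derivative
        (v $ 1 * partial U 1 (partial U j f) y + v $ 2 * partial U 2 (partial U j f) y)) (at 0)" for j
      using der[of 0 "partial U j f"] f2 d by simp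
    have f2: "(?f' has_real_derivative
        (v $ 1 * (v $ 1 * partial U 1 (partial U 1 f) y + v $ 2 * partial U 2 (partial U 1 f) y)
      + v $ 2 * (v $ 1 * partial U 1 (partial U 2 f) y + v $ 2 * partial U 2 (partial U 2 f) y))) (at 0)"
      by (intro DERIV_add DERIV_cmult d2)
    have "f (y + s *\<^sub>R v) \<le> f (y + 0 *\<^sub>R v)" if "\<bar>s\<bar> < d" for s
      using max[OF in_U[OF that]] by simp
    from second_derivative_max[OF d f1 f2 this] show ?thesis by simp
  qed
  show "partial U i f y = 0"
    using along[of "axis 1 1"] along[of "axis 2 1"] exhaust_2[of i] by auto
  note pos = spd_pos[OF M]
  define m11 m12 where "m11 = M $ 1 $ 1" and "m12 = M $ 1 $ 2"
  \<comment> \<open>Completing the square: \<open>m11\<close> times the trace is the Hessian form at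
    \<open>p\<close> plus \<open>det M\<close> times the Hessian form at \<open>q\<close>.\<close>
  define p q :: "real^2" where "p = vector [m11, m12]" and "q = vector [0, 1]"
  define H where "H i j = partial U i (partial U j f) y" for i j
  have 1: "m11 * (m11 * H 1 1 + m12 * H 2 1) + m12 * (m11 * H 1 2 + m12 * H 2 2) \<le> 0"
    using along[of p] by (simp add: p_def H_def)
  have 2: "H 2 2 \<le> 0" using along[of q] by (simp add: q_def H_def)
  have "m11 * (\<Sum>i\<in>UNIV. \<Sum>j\<in>UNIV. M $ i $ j * H i j)
      = (m11 * (m11 * H 1 1 + m12 * H 2 1) + m12 * (m11 * H 1 2 + m12 * H 2 2)) + det M * H 2 2"
    by (simp add: sum_2 det_2 spd_sym[OF M] m11_def m12_def algebra_simps)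
  also have "\<dots> \<le> 0" using 1 2 pos(3) by (simp add: mult_nonneg_nonpos add_nonpos_nonpos)
  finally have "(\<Sum>i\<in>UNIV. \<Sum>j\<in>UNIV. M $ i $ j * H i j) \<le> 0"
    using pos(1) unfolding m11_def by (simp add: mult_le_0_iff)
  then show "(\<Sum>i\<in>UNIV. \<Sum>j\<in>UNIV. M $ i $ j * partial U i (partial U j f) y) \<le> 0"
    unfolding H_def .
qed

lemma spd_matrix_inv:
  assumes "spd M" shows "spd (matrix_inv M)"
proof -
  note p = spd_pos[OF assms]
  note d = p(3)[THEN less_imp_neq, symmetric]
  note s = spd_sym[OF assms]
  have "0 < v \<bullet> (matrix_inv M *v v)" if v: "v \<noteq> 0" for v
  proof -
    have pos: "0 < w \<bullet> (M *v w)" if "w \<noteq> 0" for w using assms that by (auto simp: spd_def)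
    \<comment> \<open>Rotating \<open>v\<close> by a quarter turn exchanges the form of the matrix
      with that of its adjugate, so the form of \<open>M\<close> at \<open>w\<close> is
      \<open>det M\<close> times the form of the inverse at \<open>v\<close>.\<close>
    define w :: "real^2" where "w = vector [v $ 2, - v $ 1]"
    have "w \<noteq> 0"
    proof
      assume "w = 0"
      then have "w $ 1 = 0" "w $ 2 = 0" by simp_all
      then have "v = 0" by (intro vec2_eqI) (simp_all add: w_def)
      with v show False by blast
    qed
    then have "0 < w \<bullet> (M *v w)" by (rule pos)
    also have "w \<bullet> (M *v w) = det M * (v \<bullet> (matrix_inv M *v v))"
      using d by (simp add: inner_vec2 mult_vec2_nth matrix_inv_nth w_def s field_simps)
    finally show ?thesis using p(3) by (simp add: zero_less_mult_iff)
  qed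
  moreover have "transpose (matrix_inv M) = matrix_inv M"
    by (simp add: transpose_def vec_eq_iff forall_2 matrix_inv_nth[OF d] s)
  ultimately show ?thesis by (simp add: spd_def)
qed

section \<open>Touching a logarithmic barrier from below\<close>

definition grad_sq :: "(real^2) set \<Rightarrow> (real^2 \<Rightarrow> real^2^2) \<Rightarrow> (real^2 \<Rightarrow> real) \<Rightarrow> real^2 \<Rightarrow> real" where
  "grad_sq W g f y = (\<Sum>i\<in>UNIV. \<Sum>j\<in>UNIV. matrix_inv (g y) $ i $ j * (partial W i f y * partial W j f y))"

text \<open>The function is \<open>v - w\<close> for \<open>w = - ln (k + 2 b \<rho>) / 2\<close>;
  in the application \<open>k = \<epsilon>^2\<close> and \<open>b = \<epsilon> A\<close>. The two
  factors 2 are chosen so that the gradient of \<open>w\<close> is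
  \<open>- (b / P) \<nabla>\<rho>\<close>. Both the interior comparison and the boundary derivative
  rest on it.\<close>

lemma log_barrier_partial:
  assumes U: "hopen U" and z: "z \<in> U" and v: "v differentiable (at z within U)"
    and \<rho>: "\<rho> differentiable (at z within U)" and P: "0 < k + 2 * b * \<rho> z"
  shows "(\<lambda>z. v z + ln (k + 2 * b * \<rho> z) / 2) differentiable (at z within U)"
    and "partial U j (\<lambda>z. v z + ln (k + 2 * b * \<rho> z) / 2) z =
      partial U j v z + b * partial U j \<rho> z / (k + 2 * b * \<rho> z)"
proof -
  note vd = has_derivative_partials[OF U z v] and \<rho>d = has_derivative_partials[OF U z \<rho>]
  have "((\<lambda>z. k + 2 * b * \<rho> z) has_derivative
      (\<lambda>w. 2 * b * (w $ 1 * partial U 1 \<rho> z + w $ 2 * partial U 2 \<rho> z))) (at z within U)"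
    by (rule derivative_eq_intros \<rho>d refl)+ simp
  note Pd = has_derivative_ln[OF P this]
  have d: "((\<lambda>z. v z + ln (k + 2 * b * \<rho> z) / 2) has_derivative
      (\<lambda>w. (w $ 1 * partial U 1 v z + w $ 2 * partial U 2 v z)
      + b * (w $ 1 * partial U 1 \<rho> z + w $ 2 * partial U 2 \<rho> z) / (k + 2 * b * \<rho> z))) (at z within U)"
    by (rule has_derivative_eq_rhs[OF has_derivative_add[OF vd
          bounded_linear.has_derivative[OF bounded_linear_divide Pd]]])
       (use P in \<open>auto simp: fun_eq_iff field_simps\<close>)
  then show "(\<lambda>z. v z + ln (k + 2 * b * \<rho> z) / 2) differentiable (at z within U)"
    by (rule differentiableI)
  show "partial U j (\<lambda>z. v z + ln (k + 2 * b * \<rho> z) / 2) z =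
      partial U j v z + b * partial U j \<rho> z / (k + 2 * b * \<rho> z)"
    unfolding partial_eq[OF U z d] using exhaust_2[of j] by auto
qed

text \<open>At a maximum of \<open>v - w\<close> the gradients agree and the Hessians are ordered,
  so the Laplacian of \<open>v\<close> is at most that of \<open>w\<close>. The right side is the
  Laplacian of \<open>w\<close>; its quadratic term comes from differentiating
  \<open>1 / P\<close>.\<close>

lemma laplace_touching:
  assumes U: "open U" "U \<subseteq> half_plane" and y: "y \<in> U" and g: "metric_on U g"
    and v: "Ck_on 2 U v" and \<rho>: "Ck_on 2 U \<rho>"
    and P: "\<And>z. z \<in> U \<Longrightarrow> 0 < k + 2 * b * \<rho> z"
    and max: "\<And>z. z \<in> U \<Longrightarrow> v z + ln (k + 2 * b * \<rho> z) / 2 \<le> v y + ln (k + 2 * b * \<rho> y) / 2"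
  shows "laplace_coord U g v y \<le> - (b / (k + 2 * b * \<rho> y)) * laplace_coord U g \<rho> y
    + 2 * (b / (k + 2 * b * \<rho> y))\<^sup>2 * grad_sq U g \<rho> y"
proof -
  have hU: "hopen U" by (rule metric_onD(1)[OF g])
  define P where "P z = k + 2 * b * \<rho> z" for z
  have Pp: "0 < P z" if "z \<in> U" for z using P[OF that] by (simp add: P_def)
  define f where "f z = v z + ln (P z) / 2" for z
  have d1: "(\<phi> has_derivative (\<lambda>w. w $ 1 * partial U 1 \<phi> z + w $ 2 * partial U 2 \<phi> z)) (at z within U)"
    if "z \<in> U" "\<phi> differentiable (at z within U)" for \<phi> z
    by (rule has_derivative_partials[OF hU that])
  note \<rho>d = d1[OF _ Ck2D(1)[OF \<rho>]]
  have Pd: "(P has_derivative (\<lambda>w. 2 * b * (w $ 1 * partial U 1 \<rho> z + w $ 2 * partial U 2 \<rho> z))) (at z within U)"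
    if "z \<in> U" for z
    unfolding P_def[abs_def] by (rule derivative_eq_intros \<rho>d[OF that that] refl)+ simp
  note lb = log_barrier_partial[OF hU _ Ck2D(1)[OF v] Ck2D(1)[OF \<rho>] P]
  have fd: "f differentiable (at z within U)" if "z \<in> U" for z
    unfolding f_def[abs_def] P_def by (rule lb(1)[OF that that that that])
  have fp: "partial U j f z = partial U j v z + b * partial U j \<rho> z / P z" if "z \<in> U" for j z
    unfolding f_def[abs_def] P_def by (rule lb(2)[OF that that that that])
  define F where "F j z = partial U j v z + b * partial U j \<rho> z / P z" for j z
  have Fd: "(F j has_derivative (\<lambda>w. (w $ 1 * partial U 1 (partial U j v) y + w $ 2 * partial U 2 (partial U j v) y)
      + (b * (w $ 1 * partial U 1 (partial U j \<rho>) y + w $ 2 * partial U 2 (partial U j \<rho>) y) / P y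
      - b * partial U j \<rho> y * (2 * b * (w $ 1 * partial U 1 \<rho> y + w $ 2 * partial U 2 \<rho> y)) / (P y)\<^sup>2))) (at y within U)" for j
    unfolding F_def[abs_def]
    using Pp[OF y]
    by (intro has_derivative_eq_rhs[OF has_derivative_add[OF d1[OF y Ck2D(2)[OF v y]]
          has_derivative_divide'[OF has_derivative_mult_right[OF d1[OF y Ck2D(2)[OF \<rho> y]]] Pd[OF y]]]])
       (auto simp: fun_eq_iff field_simps power2_eq_square)
  have fd2: "partial U j f differentiable (at y within U)" for j
    by (rule differentiableI, rule has_derivative_transform[OF y _ Fd]) (simp add: fp F_def)
  have f2: "partial U i (partial U j f) y = partial U i (partial U j v) y + b / P y * partial U i (partial U j \<rho>) y
      - 2 * (b / P y)\<^sup>2 * (partial U i \<rho> y * partial U j \<rho> y)" for i j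
  proof -
    have "partial U i (partial U j f) y = partial U i (F j) y"
      by (rule partial_local[OF hU hU order_refl y]) (simp add: fp F_def)
    also have "\<dots> = partial U i (partial U j v) y + b / P y * partial U i (partial U j \<rho>) y
      - 2 * (b / P y)\<^sup>2 * (partial U i \<rho> y * partial U j \<rho> y)"
      unfolding partial_eq[OF hU y Fd] using exhaust_2[of i] Pp[OF y]
      by (auto simp: field_simps power2_eq_square)
    finally show ?thesis .
  qed
  have fmax: "f z \<le> f y" if "z \<in> U" for z using max[OF that] by (simp add: f_def P_def)
  note sm = spatial_max[OF U y fd fd2 fmax spd_matrix_inv[OF metric_onD(2)[OF g y]]]
  have v1: "partial U j v y = - (b / P y) * partial U j \<rho> y" for j
    using sm(1)[of j] fp[OF y, of j] by simp
  have "laplace_coord U g v y + (b / P y) * laplace_coord U g \<rho> y - 2 * (b / P y)\<^sup>2 * grad_sq U g \<rho> y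
      = (\<Sum>i\<in>UNIV. \<Sum>j\<in>UNIV. matrix_inv (g y) $ i $ j * partial U i (partial U j f) y)"
    unfolding laplace_coord_expand[OF g y Ck2D(2)[OF v y]] laplace_coord_expand[OF g y Ck2D(2)[OF \<rho> y]]
      f2 v1 grad_sq_def sum_2 by (simp add: algebra_simps)
  also have "\<dots> \<le> 0" by (rule sm(2))
  finally show ?thesis by (simp add: P_def)
qed

section \<open>The barrier\<close>

text \<open>For a centre on the boundary line this is \<open>y_2 (r^2 - |y - y0|^2)\<close>: zero on
  the flat side and on the arc, positive inside. Its derivative in the inward direction on the flat
  side is \<open>r^2 - |y - y0|^2\<close>, which is positive there up to the arc.\<close>

definition rho :: "real^2 \<Rightarrow> real \<Rightarrow> real^2 \<Rightarrow> real" where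
  "rho y\<^sub>0 r y = y $ 2 * (r\<^sup>2 - (y $ 1 - y\<^sub>0 $ 1)\<^sup>2 - (y $ 2)\<^sup>2)"

lemma rho_derivatives:
  assumes W: "hopen W"
  shows "Ck_on 2 W (rho y\<^sub>0 r)"
    and "y \<in> W \<Longrightarrow> partial W 1 (rho y\<^sub>0 r) y = - 2 * y $ 2 * (y $ 1 - y\<^sub>0 $ 1)"
    and "y \<in> W \<Longrightarrow> partial W 2 (rho y\<^sub>0 r) y = r\<^sup>2 - (y $ 1 - y\<^sub>0 $ 1)\<^sup>2 - 3 * (y $ 2)\<^sup>2"
proof -
  let ?f1 = "\<lambda>y::real^2. - 2 * y $ 2 * (y $ 1 - y\<^sub>0 $ 1)"
  let ?f2 = "\<lambda>y::real^2. r\<^sup>2 - (y $ 1 - y\<^sub>0 $ 1)\<^sup>2 - 3 * (y $ 2)\<^sup>2"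
  have nth: "((\<lambda>y::real^2. y $ i) has_derivative (\<lambda>w. w $ i)) (at y within W)" for i y
    by (rule bounded_linear_imp_has_derivative[OF bounded_linear_vec_nth])
  have d: "(rho y\<^sub>0 r has_derivative (\<lambda>w. w $ 1 * ?f1 y + w $ 2 * ?f2 y)) (at y within W)" for y
    unfolding rho_def[abs_def]
    by (rule derivative_eq_intros nth refl)+ (simp add: fun_eq_iff algebra_simps power2_eq_square)
  have d1: "(?f1 has_derivative (\<lambda>w. w $ 1 * (- 2 * y $ 2) + w $ 2 * (- 2 * (y $ 1 - y\<^sub>0 $ 1)))) (at y within W)" for y
    by (rule derivative_eq_intros nth refl)+ (simp add: fun_eq_iff algebra_simps)
  have d2: "(?f2 has_derivative (\<lambda>w. w $ 1 * (- 2 * (y $ 1 - y\<^sub>0 $ 1)) + w $ 2 * (- 6 * y $ 2))) (at y within W)" for y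
    by (rule derivative_eq_intros nth refl)+ (simp add: fun_eq_iff algebra_simps)
  show p1: "partial W 1 (rho y\<^sub>0 r) y = ?f1 y" if "y \<in> W" for y
    unfolding partial_eq[OF W that d] by simp
  show p2: "partial W 2 (rho y\<^sub>0 r) y = ?f2 y" if "y \<in> W" for y
    unfolding partial_eq[OF W that d] by simp
  have C1: "Ck_on (Suc 0) W h"
    if h: "\<And>y. (h has_derivative (\<lambda>w. w $ 1 * a y + w $ 2 * b y)) (at y within W)"
      and c: "continuous_on W a" "continuous_on W b" for h :: "real^2 \<Rightarrow> real" and a b
  proof -
    have "continuous_on W (\<lambda>x. frechet_derivative h (at x within W) e)" if "e \<in> Basis" for e
      by (subst continuous_on_cong[OF refl, where g = "\<lambda>y. e $ 1 * a y + e $ 2 * b y"])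
         (auto simp: hopen_frechet_derivative[OF W _ h] intro!: continuous_intros c)
    then show ?thesis using h by (auto simp: differentiable_on_def differentiable_def)
  qed
  have "Ck_on (Suc 0) W (\<lambda>x. frechet_derivative (rho y\<^sub>0 r) (at x within W) b)" if b: "b \<in> Basis" for b
  proof -
    from b consider "b = axis 1 1" | "b = axis 2 1" by (auto simp: Basis_vec2)
    then show ?thesis
    proof cases
      case 1
      have "Ck_on (Suc 0) W ?f1" by (rule C1[OF d1]) (intro continuous_intros)+
      moreover have "Ck_on (Suc 0) W (\<lambda>x. frechet_derivative (rho y\<^sub>0 r) (at x within W) b) = Ck_on (Suc 0) W ?f1"
        by (rule Ck_on_cong) (use p1 1 in \<open>simp add: dir_deriv_def\<close>)
      ultimately show ?thesis by simp
    next
      case 2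
      have "Ck_on (Suc 0) W ?f2" by (rule C1[OF d2]) (intro continuous_intros)+
      moreover have "Ck_on (Suc 0) W (\<lambda>x. frechet_derivative (rho y\<^sub>0 r) (at x within W) b) = Ck_on (Suc 0) W ?f2"
        by (rule Ck_on_cong) (use p2 2 in \<open>simp add: dir_deriv_def\<close>)
      ultimately show ?thesis by simp
    qed
  qed
  moreover have "rho y\<^sub>0 r differentiable_on W" using d by (auto simp: differentiable_on_def differentiable_def)
  ultimately show "Ck_on 2 W (rho y\<^sub>0 r)" by (simp add: numeral_2_eq_2)
qed

lemma dist_vec2: "(dist (y::real^2) z)\<^sup>2 = (y $ 1 - z $ 1)\<^sup>2 + (y $ 2 - z $ 2)\<^sup>2"
  unfolding dist_norm power2_norm_eq_inner inner_vec2 by (simp add: power2_eq_square)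

text \<open>The third claim is the use of \<open>rho\<close> as a cut-off: a point where it is
  nonzero lies in the interior of the surface and off the arc, so the equation and the spatial
  derivative tests apply.\<close>

lemma rho_bounds:
  assumes y0: "y\<^sub>0 $ 2 = 0" and r: "0 < r" "r \<le> 1" and y: "y \<in> cball y\<^sub>0 r \<inter> half_plane"
  shows "0 \<le> rho y\<^sub>0 r y" "rho y\<^sub>0 r y \<le> 1" "rho y\<^sub>0 r y \<noteq> 0 \<Longrightarrow> 0 < y $ 2 \<and> dist y y\<^sub>0 < r"
proof -
  have y2: "0 \<le> y $ 2" and d: "dist y y\<^sub>0 \<le> r" using y by (auto simp: half_plane_def dist_commute)
  have rho: "rho y\<^sub>0 r y = y $ 2 * (r\<^sup>2 - (dist y y\<^sub>0)\<^sup>2)"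
    by (simp add: rho_def dist_vec2 y0 algebra_simps)
  have "(dist y y\<^sub>0)\<^sup>2 \<le> r\<^sup>2" "0 \<le> (dist y y\<^sub>0)\<^sup>2" "r\<^sup>2 \<le> 1"
    using r power_mono[OF d, of 2] power_le_one[of r 2] by simp_all
  then have f: "0 \<le> r\<^sup>2 - (dist y y\<^sub>0)\<^sup>2" "r\<^sup>2 - (dist y y\<^sub>0)\<^sup>2 \<le> 1"
    by linarith+
  have "\<bar>y $ 2 - y\<^sub>0 $ 2\<bar> \<le> r"
    using component_le_norm_cart[of "y - y\<^sub>0" 2] d by (simp add: dist_norm)
  then have "y $ 2 \<le> 1" using r y0 by simp
  with f y2 show "0 \<le> rho y\<^sub>0 r y" "rho y\<^sub>0 r y \<le> 1"
    unfolding rho by (auto intro: mult_le_one)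
  assume "rho y\<^sub>0 r y \<noteq> 0"
  then show "0 < y $ 2 \<and> dist y y\<^sub>0 < r"
    using y2 d unfolding rho by (auto simp: order_le_less)
qed

text \<open>Writing \<open>\<epsilon> = e\<^sup>-\<^sup>\<Phi>\<close> and \<open>A = \<gamma>(\<surd>\<Phi> - d)\<close>, the second hypothesis on \<open>\<gamma>\<close> says \<open>dA/d\<Phi> \<le> (\<epsilon> + A)/2\<close>:
  it lets \<open>A\<close> start from zero although \<open>\<Phi>'\<close> has no upper bound.\<close>

lemma barrier_time_derivative:
  assumes \<Phi>: "(\<Phi> has_real_derivative D) (at t within S)" "0 < \<Phi> t" "0 \<le> D"
    and A: "0 \<le> \<gamma> * (sqrt (\<Phi> t) - d)" "\<gamma> / sqrt (\<Phi> t) \<le> exp (- \<Phi> t) + \<gamma> * (sqrt (\<Phi> t) - d)"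
    and \<rho>: "0 \<le> \<rho>" "\<rho> \<le> 1"
  shows "\<exists>W. ((\<lambda>s. ln ((exp (- \<Phi> s))\<^sup>2 + 2 * (exp (- \<Phi> s) * (\<gamma> * (sqrt (\<Phi> s) - d))) * \<rho>) / 2)
    has_real_derivative W) (at t within S) \<and> W \<le> - D / 4"
proof -
  define e where "e = exp (- \<Phi> t)"
  define B where "B = \<gamma> * (sqrt (\<Phi> t) - d)"
  define P where "P = e\<^sup>2 + 2 * (e * B) * \<rho>"
  define Q where "Q = 2 * e * (- e * D) + 2 * (- e * D * B + e * (\<gamma> * (D / (2 * sqrt (\<Phi> t))))) * \<rho>"
  have e: "e > 0" by (simp add: e_def)
  have B: "0 \<le> B" "\<gamma> / sqrt (\<Phi> t) \<le> e + B" using A by (simp_all add: B_def e_def)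
  have P: "P > 0" unfolding P_def using e B \<rho> by (intro add_pos_nonneg) auto
  have sq: "((\<lambda>s. sqrt (\<Phi> s)) has_real_derivative D / (2 * sqrt (\<Phi> t))) (at t within S)"
    by (rule DERIV_cong[OF DERIV_chain2[OF DERIV_real_sqrt[OF \<Phi>(2)] \<Phi>(1)]]) (simp add: field_simps)
  have "((\<lambda>s. (exp (- \<Phi> s))\<^sup>2 + 2 * (exp (- \<Phi> s) * (\<gamma> * (sqrt (\<Phi> s) - d))) * \<rho>) has_real_derivative Q) (at t within S)"
    unfolding Q_def B_def e_def
    by (rule sq derivative_eq_intros \<Phi>(1) refl)+ (use \<Phi>(2) in \<open>simp add: field_simps\<close>)
  then have "((\<lambda>s. ln ((exp (- \<Phi> s))\<^sup>2 + 2 * (exp (- \<Phi> s) * (\<gamma> * (sqrt (\<Phi> s) - d))) * \<rho>)) has_real_derivative Q / P) (at t within S)"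
    using P by (intro DERIV_cong[OF DERIV_chain2[OF DERIV_ln_divide]]) (simp_all add: P_def B_def e_def)
  from DERIV_cdivide[OF this, of 2]
  have der: "((\<lambda>s. ln ((exp (- \<Phi> s))\<^sup>2 + 2 * (exp (- \<Phi> s) * (\<gamma> * (sqrt (\<Phi> s) - d))) * \<rho>) / 2)
      has_real_derivative Q / P / 2) (at t within S)" .
  \<comment> \<open>The first two terms are the decay due to \<epsilon>, the last is due to the
    growth of \<open>A\<close>. The hypothesis on \<gamma> lets the last term consume at most half
    of the decay; the other half is \<open>D P / 2\<close> or more, whence the final
    quarter.\<close>
  have "Q = D * (- 2 * e\<^sup>2 - 2 * \<rho> * (e * B) + \<rho> * e * (\<gamma> / sqrt (\<Phi> t)))"
    using \<Phi>(2) by (simp add: Q_def field_simps power2_eq_square)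
  also have "\<dots> \<le> D * (- e\<^sup>2 - \<rho> * (e * B))"
  proof (rule mult_left_mono[OF _ \<Phi>(3)])
    have "\<rho> * e * (\<gamma> / sqrt (\<Phi> t)) \<le> \<rho> * e * (e + B)"
      using B(2) \<rho> e by (intro mult_left_mono) auto
    also have "\<dots> \<le> e\<^sup>2 + \<rho> * (e * B)"
      using mult_left_le_one_le[of "e\<^sup>2" \<rho>] \<rho> by (simp add: algebra_simps power2_eq_square)
    finally show "- 2 * e\<^sup>2 - 2 * \<rho> * (e * B) + \<rho> * e * (\<gamma> / sqrt (\<Phi> t)) \<le> - e\<^sup>2 - \<rho> * (e * B)"
      by (simp only: diff_conv_add_uminus)
  qed
  also have "\<dots> \<le> D * (- P / 2)"
  proof (rule mult_left_mono[OF _ \<Phi>(3)])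
    have "0 \<le> e\<^sup>2" by simp
    then show "- e\<^sup>2 - \<rho> * (e * B) \<le> - P / 2" unfolding P_def by (simp add: field_simps)
  qed
  finally have "Q / P / 2 \<le> - D / 4" using P by (simp add: field_simps)
  with der show ?thesis by blast
qed

text \<open>Two regimes. Up to \<open>p\<^sub>0 + 4\<close> the number \<gamma> itself is below
  \<open>exp (- p)\<close>. Beyond that, \<open>4 \<le> p - p\<^sub>0 \<le> 2 sqrt p (sqrt p - sqrt
  p\<^sub>0)\<close> makes the gap of the roots at least \<open>1 / sqrt p\<close>.\<close>

lemma amplitude_growth:
  assumes p: "1 \<le> p\<^sub>0" "p\<^sub>0 \<le> p" and \<gamma>: "0 < \<gamma>" "\<gamma> \<le> exp (- p\<^sub>0 - 4)"
  shows "\<gamma> / sqrt p \<le> exp (- p) + \<gamma> * (sqrt p - sqrt p\<^sub>0)"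
proof (cases "p \<le> p\<^sub>0 + 4")
  case True
  have "\<gamma> / sqrt p \<le> \<gamma> / 1" using p \<gamma> by (intro divide_left_mono) auto
  also have "\<dots> \<le> exp (- p)" using \<gamma>(2) True by (simp add: order_trans)
  also have "\<dots> \<le> exp (- p) + \<gamma> * (sqrt p - sqrt p\<^sub>0)" using p \<gamma> by simp
  finally show ?thesis .
next
  case False
  have s: "0 < sqrt p" "0 < sqrt p\<^sub>0" "sqrt p\<^sub>0 \<le> sqrt p" using p by auto
  have "4 \<le> p - p\<^sub>0" using False by simp
  also have "p - p\<^sub>0 = (sqrt p - sqrt p\<^sub>0) * (sqrt p + sqrt p\<^sub>0)"
    using p by (simp add: algebra_simps)
  also have "\<dots> \<le> (sqrt p - sqrt p\<^sub>0) * (2 * sqrt p)" using s by (intro mult_left_mono) auto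
  finally have "1 \<le> (sqrt p - sqrt p\<^sub>0) * sqrt p" by linarith
  then have "1 / sqrt p \<le> sqrt p - sqrt p\<^sub>0" using s by (simp only: pos_divide_le_eq)
  then have "\<gamma> * (1 / sqrt p) \<le> \<gamma> * (sqrt p - sqrt p\<^sub>0)" using \<gamma> by (intro mult_left_mono) auto
  then show ?thesis by (simp add: add_increasing)
qed

text \<open>Any positive factor and any shift are absorbed because 1/3 < 1/2. With
  \<open>x = s^6\<close> the claim becomes the polynomial inequality
  \<open>s^2 \<le> k (s^3 - d)\<close>.\<close>

lemma cube_root_le_sqrt:
  assumes k: "0 < k"
  shows "\<forall>\<^sub>F x in at_top. root 3 x \<le> k * (sqrt x - d)"
proof -
  \<comment> \<open>For \<open>s \<ge> m\<close> the first two entries give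
    \<open>d \<le> s^3 / 2\<close> and the third gives \<open>2 \<le> k s\<close>, so the remaining
    \<open>k s^3 / 2\<close> dominates \<open>s^2\<close>.\<close>
  define m where "m = max 1 (max (2 * \<bar>d\<bar>) (2 / k))"
  have "root 3 x \<le> k * (sqrt x - d)" if x: "m ^ 6 \<le> x" for x
  proof -
    define s where "s = root 6 x"
    have m: "m \<ge> 1" by (simp add: m_def)
    have x0: "0 \<le> x" using x m by (meson order_trans zero_le_power zero_le_one)
    have s6: "s ^ 6 = x" and s0: "0 \<le> s" using x0 by (simp_all add: s_def)
    have sm: "m \<le> s" using x s6 s0 m power_mono_iff[of m s] by (metis order_trans zero_le_one zero_less_numeral)
    have r3: "root 3 x = s\<^sup>2" using s6 s0 by (intro real_root_pos_unique) (auto simp flip: power_mult)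
    have r2: "sqrt x = s ^ 3" using s6 s0 by (intro real_sqrt_unique) (auto simp flip: power_mult)
    have s1: "1 \<le> s" "2 * \<bar>d\<bar> \<le> s" "2 / k \<le> s" using sm by (auto simp: m_def)
    have "s \<le> s ^ 3" using power_increasing[OF _ s1(1), of 1 3] by simp
    then have "d \<le> s ^ 3 / 2" using s1(2) by linarith
    then have "k * (s ^ 3 / 2) \<le> k * (sqrt x - d)" using k by (simp add: r2)
    moreover have "2 \<le> k * s" using s1(3) k by (simp add: field_simps)
    then have "2 * s\<^sup>2 \<le> k * s * s\<^sup>2" by (intro mult_right_mono) auto
    ultimately show ?thesis by (simp add: r3 power2_eq_square power3_eq_cube)
  qed
  then show ?thesis unfolding eventually_at_top_linorder by blast
qed

lemma compact_bounded_real: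
  fixes f :: "'b::topological_space \<Rightarrow> real"
  assumes "compact K" "continuous_on K f"
  obtains B where "\<And>y. y \<in> K \<Longrightarrow> \<bar>f y\<bar> \<le> B"
  using compact_imp_bounded[OF compact_continuous_image[OF assms(2,1)]] unfolding bounded_iff by auto

text \<open>The boundary data are reduced to one function of time, its growth law and its
  divergence, the last being what the lower barrier \<open>ln \<xi>\<close> contributes.\<close>

locale dirichlet = evolution +
  fixes \<Phi> \<Phi>' :: "real \<Rightarrow> real" and T\<^sub>3 :: real
  assumes T3: "0 < T\<^sub>3"
    and pde: "\<And>p t. p \<in> surface_interior X A \<Longrightarrow> 0 \<le> t \<Longrightarrow> time_deriv u p t =
        exp (- 2 * u p t) * (laplacian A G (\<lambda>q. u q t) p - gauss_curvature A G p) - 1"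
    and u_boundary: "\<And>p t. p \<in> surface_boundary A \<Longrightarrow> T\<^sub>3 \<le> t \<Longrightarrow> u p t = \<Phi> t"
    and \<Phi>_deriv: "\<And>t. T\<^sub>3 \<le> t \<Longrightarrow> (\<Phi> has_real_derivative \<Phi>' t) (at t within {T\<^sub>3..})"
    and \<Phi>_growth: "\<And>t. T\<^sub>3 \<le> t \<Longrightarrow> 3 * \<Phi> t + 1 \<le> \<Phi>' t"
    and \<Phi>_lim: "filterlim \<Phi> at_top at_top"
begin

lemma \<Phi>_ge: "\<exists>T\<ge>T'. \<forall>t\<ge>T. c \<le> \<Phi> t"
proof -
  obtain N where "\<forall>t\<ge>N. c \<le> \<Phi> t"
    using \<Phi>_lim unfolding filterlim_at_top eventually_at_top_linorder by blast
  then show ?thesis by (intro exI[of _ "max N T'"]) auto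
qed

lemma \<Phi>_mono:
  assumes "T\<^sub>3 \<le> s" "s \<le> t" "\<And>x. s \<le> x \<Longrightarrow> 0 \<le> \<Phi> x"
  shows "\<Phi> s \<le> \<Phi> t"
proof -
  have "(\<Phi> has_derivative (\<lambda>h. \<Phi>' x * h)) (at x within {s..t})" if "x \<in> {s..t}" for x
    using DERIV_subset[OF \<Phi>_deriv, of x "{s..t}"] that assms(1) by (auto simp: has_field_derivative_def)
  from mvt_very_simple[OF assms(2) this] obtain x where x: "x \<in> {s..t}" "\<Phi> t - \<Phi> s = \<Phi>' x * (t - s)"
    by auto
  have "0 \<le> \<Phi>' x" using \<Phi>_growth[of x] assms(1) assms(3)[of x] x(1) by auto
  then have "0 \<le> \<Phi>' x * (t - s)" using assms(2) by simp
  with x(2) show ?thesis by simp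
qed

lemma chart_inv_topspace:
  assumes "c \<in> A" "y \<in> chart_range c"
  shows "chart_inv c y \<in> topspace X"
  using subsetD[OF chart_subset_topspace[OF assms(1)] chart_inv_in[OF assms(2)]] .

lemma curvature_bound: "\<exists>B\<ge>0. \<forall>p\<in>surface_interior X A. - B \<le> gauss_curvature A G p"
proof -
  obtain B where B: "\<And>p. p \<in> topspace X \<Longrightarrow> p \<in> surface_interior X A \<Longrightarrow> - B \<le> gauss_curvature A G p"
    using gauss_curvature_bounded_below[OF pde[OF _ order_refl]] by blast
  have "- max B 0 \<le> gauss_curvature A G p" if "p \<in> surface_interior X A" for p
    using B[OF _ that] that by (force simp: surface_interior_def)
  then show ?thesis by (intro exI[of _ "max B 0"]) auto
qed

text \<open>At an interior maximum after the initial time the equation forces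
  \<open>exp (2 u) \<le> B\<close>, where \<open>- B\<close> bounds the curvature from below. A
  value above \<open>\<Phi> t\<close> violates this once \<Phi> has passed
  \<open>B + 1\<close>.\<close>

lemma global_bound: "\<exists>T\<ge>T\<^sub>3. \<forall>t\<ge>T. \<forall>p\<in>topspace X. u p t \<le> \<Phi> t"
proof (cases "topspace X = {}")
  case False
  obtain B where B: "B \<ge> 0" "\<And>p. p \<in> surface_interior X A \<Longrightarrow> - B \<le> gauss_curvature A G p"
    using curvature_bound by blast
  obtain T0 where T0: "T0 \<ge> T\<^sub>3" "\<And>t. t \<ge> T0 \<Longrightarrow> 0 \<le> \<Phi> t" using \<Phi>_ge by meson
  have T0p: "0 \<le> T0" using T0 T3 by simp
  obtain m where m: "\<And>q. q \<in> topspace X \<Longrightarrow> u q T0 \<le> m"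
    using u_attains_max[OF False T0p order_refl] by fastforce
  \<comment> \<open>The bound \<open>m\<close> excludes a maximum at the initial time
    \<open>T0\<close>, the bound \<open>B + 1\<close> one in the interior.\<close>
  obtain T where T: "T \<ge> T0" "\<And>t. t \<ge> T \<Longrightarrow> max m (B + 1) \<le> \<Phi> t" using \<Phi>_ge by meson
  have "u p' t \<le> \<Phi> t" if t: "t \<ge> T" and p': "p' \<in> topspace X" for t p'
  proof -
    have T0t: "T0 \<le> t" using T t by simp
    obtain p s where p: "p \<in> topspace X" and s: "s \<in> {T0..t}"
      and max: "\<And>q s'. q \<in> topspace X \<Longrightarrow> s' \<in> {T0..t} \<Longrightarrow> u q s' \<le> u p s"
      using u_attains_max[OF False T0p T0t] by blast
    have "u p s \<le> \<Phi> t"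
    proof (rule ccontr)
      assume not: "\<not> u p s \<le> \<Phi> t"
      \<comment> \<open>The comparison is with the constant \<open>\<Phi> t\<close>, the largest
        boundary value up to time \<open>t\<close>; so the maximum cannot lie on the
        boundary.\<close>
      have "\<Phi> s \<le> \<Phi> t" using s T0 by (intro \<Phi>_mono) auto
      then have "p \<notin> surface_boundary A" using not u_boundary[of p s] s T0 by auto
      then have int: "p \<in> surface_interior X A" using p by (simp add: surface_interior_def)
      have "s \<noteq> T0" using m[OF p] T(2)[OF t] not by auto
      then have sT: "T0 < s" using s by simp
      have s0: "0 \<le> s" using s T0p by simp
      have td: "0 \<le> time_deriv u p s"
        by (rule derivative_nonneg_at_right_end[OF u_time_derivative[OF p s0] sT])
           (use T0p max[OF p] s in auto)
      obtain c where c: "c \<in> A" "p \<in> fst c" by (rule chart_covers[OF p])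
      let ?W = "chart_range c" and ?y = "snd c p"
      have y: "?y \<in> ?W" by (rule chart_range_in[OF c(2)])
      have y2: "0 < ?y $ 2" using surface_interior_iff[OF c] int by simp
      obtain e where e: "e > 0" "ball ?y e \<subseteq> ?W"
        using at_within_hopen_interior(2)[OF chart_range_hopen[OF c(1)] y y2] by blast
      let ?U = "ball ?y e"
      have Uh: "?U \<subseteq> half_plane" using e(2) hopen_nonneg[OF chart_range_hopen[OF c(1)]] by (auto simp: half_plane_def)
      have U: "hopen ?U" using Uh by (auto simp: openin_open)
      have yU: "?y \<in> ?U" using e by simp
      note gU = metric_on_subset[OF chart_metric[OF c(1)] U e(2)]
      have v: "Ck_on 2 ?U (loc_u c s)"
        by (rule Ck_on_subset[OF U chart_range_hopen[OF c(1)] e(2) loc_u_Ck2[OF c(1) s0]])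
      have vmax: "loc_u c s z \<le> loc_u c s ?y" if "z \<in> ?U" for z
        using max[OF chart_inv_topspace[OF c(1) subsetD[OF e(2) that]] s] by (simp add: chart_inv_left[OF c])
      note sm = spatial_max[OF open_ball Uh yU Ck2D(1)[OF v] Ck2D(2)[OF v yU] vmax
          spd_matrix_inv[OF metric_onD(2)[OF gU yU]]]
      have "laplacian A G (\<lambda>q. u q s) p = laplace_coord ?U (G c) (loc_u c s) ?y"
        unfolding laplacian_u[OF c s0]
        by (rule laplace_coord_local[OF U chart_range_hopen[OF c(1)] e(2) yU refl])
      also have "\<dots> \<le> 0"
        unfolding laplace_coord_expand[OF gU yU Ck2D(2)[OF v yU]] using sm by simp
      finally have "laplacian A G (\<lambda>q. u q s) p - gauss_curvature A G p \<le> B"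
        using B(2)[OF int] by simp
      then have "exp (- 2 * u p s) * (laplacian A G (\<lambda>q. u q s) p - gauss_curvature A G p) \<le> exp (- 2 * u p s) * B"
        by (intro mult_left_mono) auto
      with td pde[OF int s0] have "1 \<le> exp (- 2 * u p s) * B" by linarith
      then have "exp (2 * u p s) * 1 \<le> exp (2 * u p s) * (exp (- 2 * u p s) * B)"
        by (intro mult_left_mono) auto
      also have "\<dots> = B" by (simp add: mult.assoc[symmetric] flip: exp_add)
      finally have "exp (2 * u p s) \<le> B" by simp
      moreover have "1 + 2 * u p s \<le> exp (2 * u p s)" by (rule exp_ge_add_one_self)
      moreover have "B + 1 \<le> \<Phi> t" using T(2)[OF t] by simp
      ultimately show False using not B(1) by linarith
    qed
    moreover have "u p' t \<le> u p s" using max[OF p', of t] T0t by simp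
    ultimately show ?thesis by simp
  qed
  then show ?thesis using T(1) T0(1) by (intro exI[of _ T]) auto
qed auto

text \<open>Suppose \<open>u\<close> exceeded the barrier somewhere. Then a positive space-time
  maximum of the difference \<open>H\<close> lies off the edge and after \<open>T\<close>, and there
  the equation bounds \<open>u_t\<close> by \<open>\<Phi> / 2\<close> while the moving barrier
  forces it above \<open>3/4 \<Phi>\<close>.\<close>

lemma half_disc_barrier:
  assumes c: "c \<in> A" and y0: "y\<^sub>0 $ 2 = 0" and r: "0 < r" "r \<le> 1"
    and K: "cball y\<^sub>0 r \<inter> half_plane \<subseteq> chart_range c"
  shows "\<exists>T\<ge>T\<^sub>3. \<exists>\<gamma>>0. \<forall>t\<ge>T. \<Phi> T \<le> \<Phi> t \<and> 1 \<le> \<Phi> t \<and> (\<forall>y\<in>cball y\<^sub>0 r \<inter> half_plane.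
    loc_u c t y + ln ((exp (- \<Phi> t))\<^sup>2 + 2 * (exp (- \<Phi> t) * (\<gamma> * (sqrt (\<Phi> t) - sqrt (\<Phi> T)))) * rho y\<^sub>0 r y) / 2 \<le> 0)"
proof -
  let ?W = "chart_range c" and ?K = "cball y\<^sub>0 r \<inter> half_plane" and ?\<rho> = "rho y\<^sub>0 r"
  note W = chart_range_hopen[OF c] and g = chart_metric[OF c] and g2 = chart_metric_Ck2[OF c]
  note \<rho>2 = rho_derivatives(1)[OF W, of y\<^sub>0 r]
  have cK: "compact ?K" by (rule compact_half_disc)
  obtain B1 where B1: "\<And>y. y \<in> ?K \<Longrightarrow> \<bar>laplace_coord ?W (G c) ?\<rho> y\<bar> \<le> B1"
    by (rule compact_bounded_real[OF cK continuous_on_subset[OF continuous_on_laplace_coord[OF g g2 \<rho>2] K]]) blast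
  have "continuous_on ?W (grad_sq ?W (G c) ?\<rho>)"
    unfolding grad_sq_def[abs_def]
    by (intro continuous_intros continuous_on_coefficients[OF g g2] Ck2D(4)[OF \<rho>2])
  then obtain B2 where B2: "\<And>y. y \<in> ?K \<Longrightarrow> \<bar>grad_sq ?W (G c) ?\<rho> y\<bar> \<le> B2"
    using compact_bounded_real[OF cK continuous_on_subset[OF _ K]] by blast
  obtain B3 where B3: "B3 \<ge> 0" "\<And>p. p \<in> surface_interior X A \<Longrightarrow> - B3 \<le> gauss_curvature A G p"
    using curvature_bound by blast
  define B where "B = max B1 (max B2 B3)"
  have B: "B \<ge> 0" "B1 \<le> B" "B2 \<le> B" "B3 \<le> B" using B3(1) by (auto simp: B_def)
  obtain T1 where T1: "T1 \<ge> T\<^sub>3" "\<And>t p. t \<ge> T1 \<Longrightarrow> p \<in> topspace X \<Longrightarrow> u p t \<le> \<Phi> t"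
    using global_bound by blast
  \<comment> \<open>\<open>\<Phi> \<ge> 1\<close> compares square roots with \<Phi> itself, and
    \<open>\<Phi> \<ge> B\<close> makes the curvature term \<open>exp (- 2 \<Phi>) B\<close> at most
    1.\<close>
  obtain T where T: "T \<ge> T1" "\<And>t. t \<ge> T \<Longrightarrow> max 1 B \<le> \<Phi> t" using \<Phi>_ge by meson
  have T3T: "T\<^sub>3 \<le> T" using T(1) T1(1) by simp
  have \<Phi>1: "1 \<le> \<Phi> t" "B \<le> \<Phi> t" "\<Phi> T \<le> \<Phi> t" if "t \<ge> T" for t
    using T(2)[OF that] \<Phi>_mono[OF T3T that] T(2) by (auto intro: order_trans[OF zero_le_one])
  \<comment> \<open>The first bound keeps the reaction terms below tenths of \<Phi>, the second is
    the smallness that \<open>amplitude_growth\<close> asks for at the starting value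
    \<open>\<Phi> T\<close>.\<close>
  define \<gamma> where "\<gamma> = min (1 / (10 * (B + 1))) (exp (- \<Phi> T - 4))"
  have \<gamma>: "0 < \<gamma>" "\<gamma> \<le> exp (- \<Phi> T - 4)" "\<gamma> * (B + 1) \<le> 1 / 10"
  proof -
    show "0 < \<gamma>" "\<gamma> \<le> exp (- \<Phi> T - 4)" using B(1) by (auto simp: \<gamma>_def)
    have "\<gamma> * (B + 1) \<le> 1 / (10 * (B + 1)) * (B + 1)"
      using B(1) by (intro mult_right_mono) (auto simp: \<gamma>_def)
    also have "\<dots> = 1 / 10" using B(1) by simp
    finally show "\<gamma> * (B + 1) \<le> 1 / 10" .
  qed
  define E where "E t = exp (- \<Phi> t)" for t
  define Am where "Am t = \<gamma> * (sqrt (\<Phi> t) - sqrt (\<Phi> T))" for t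
  define P where "P y t = (E t)\<^sup>2 + 2 * (E t * Am t) * ?\<rho> y" for y t
  define H where "H y t = loc_u c t y + ln (P y t) / 2" for y t
  have E: "0 < E t" for t by (simp add: E_def)
  have Am: "0 \<le> Am t" "Am t \<le> \<gamma> * sqrt (\<Phi> t)" if "t \<ge> T" for t
    using \<Phi>1[OF that] \<Phi>1[of T] \<gamma>(1) by (auto simp: Am_def)
  have P: "0 < P y t" if "t \<ge> T" "0 \<le> ?\<rho> y" for y t
    unfolding P_def using E[of t] Am(1)[OF that(1)] that(2) by (intro add_pos_nonneg) auto
  note \<rho>K = rho_bounds[OF y0 r]
  \<comment> \<open>Where \<open>A\<close> or \<open>rho\<close> vanishes the barrier equals \<Phi>,
    so the claim is just \<open>global_bound\<close>. This settles the initial time, the flat side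
    and the arc together.\<close>
  have H0: "H y t \<le> 0" if y: "y \<in> ?K" and t: "t \<ge> T" and z: "Am t = 0 \<or> ?\<rho> y = 0" for y t
  proof -
    have "P y t = (E t)\<^sup>2" using z by (auto simp: P_def)
    then have "ln (P y t) / 2 = - \<Phi> t" by (simp add: E_def ln_realpow)
    moreover have "loc_u c t y \<le> \<Phi> t"
      using T1(2)[OF _ chart_inv_topspace[OF c subsetD[OF K y]]] T(1) t by simp
    ultimately show ?thesis by (simp add: H_def)
  qed
  have "H y1 t1 \<le> 0" if t1: "t1 \<ge> T" and y1: "y1 \<in> ?K" for y1 t1
  proof (rule ccontr)
    assume neg: "\<not> H y1 t1 \<le> 0"
    have c\<Phi>: "continuous_on {T..t1} \<Phi>"
      by (rule DERIV_continuous_on[where D = \<Phi>'], rule DERIV_subset[OF \<Phi>_deriv]) (use T3T in auto)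
    have c\<Phi>': "continuous_on (?K \<times> {T..t1}) (\<lambda>z. \<Phi> (snd z))"
      by (rule continuous_on_compose2[OF c\<Phi> continuous_on_snd[OF continuous_on_id]]) auto
    have c\<rho>: "continuous_on (?K \<times> {T..t1}) (\<lambda>z. ?\<rho> (fst z))"
      by (rule continuous_on_compose2[OF continuous_on_subset[OF Ck2D(5)[OF \<rho>2] K] continuous_on_fst[OF continuous_on_id]]) auto
    have Pne: "P (fst z) (snd z) \<noteq> 0" if "z \<in> ?K \<times> {T..t1}" for z
      using P[of "snd z" "fst z"] \<rho>K(1)[of "fst z"] that by auto
    have cP: "continuous_on (?K \<times> {T..t1}) (\<lambda>z. P (fst z) (snd z))"
      unfolding P_def E_def Am_def by (intro continuous_intros c\<Phi>' c\<rho>)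
    have cH: "continuous_on (?K \<times> {T..t1}) (\<lambda>z. H (fst z) (snd z))"
      unfolding H_def using Pne T3 T3T
      by (intro continuous_on_add continuous_on_divide continuous_on_ln cP u_continuous[OF c cK K] continuous_on_const) auto
    have cKT: "compact (?K \<times> {T..t1})" by (intro compact_Times cK) auto
    have neKT: "?K \<times> {T..t1} \<noteq> {}" using y1 t1 by auto
    from continuous_attains_sup[OF cKT neKT cH] obtain z where z: "z \<in> ?K \<times> {T..t1}"
      "\<And>w. w \<in> ?K \<times> {T..t1} \<Longrightarrow> H (fst w) (snd w) \<le> H (fst z) (snd z)"
      by blast
    define y t where "y = fst z" and "t = snd z"
    have y: "y \<in> ?K" and t: "t \<in> {T..t1}" using z(1) by (auto simp: y_def t_def)
    have max: "H y' t' \<le> H y t" if "y' \<in> ?K" "t' \<in> {T..t1}" for y' t'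
      using z(2)[of "(y', t')"] that by (simp add: y_def t_def)
    have pos: "0 < H y t" using max[OF y1, of t1] t1 neg by simp
    have tT: "T \<le> t" using t by simp
    have t0: "0 \<le> t" using tT T3T T3 by simp
    have \<rho>0: "?\<rho> y \<noteq> 0" and Am0: "Am t \<noteq> 0" using H0[OF y tT] pos by auto
    have "t \<noteq> T" using Am0 by (auto simp: Am_def)
    then have Tt: "T < t" using tT by simp
    note \<rho>y = \<rho>K(1,2)[OF y]
    have yV: "0 < y $ 2" "dist y y\<^sub>0 < r" using \<rho>K(3)[OF y \<rho>0] by auto
    have yW: "y \<in> ?W" using y K by blast
    define p where "p = chart_inv c y"
    have p: "p \<in> fst c" "snd c p = y" "p \<in> topspace X"
      using chart_inv_in[OF yW] chart_inv_right[OF yW] chart_inv_topspace[OF c yW] by (simp_all add: p_def)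
    have int: "p \<in> surface_interior X A" using surface_interior_iff[OF c p(1)] p(2) yV by simp
    have g1: "0 \<le> \<gamma> * (sqrt (\<Phi> t) - sqrt (\<Phi> T))" using Am(1)[OF tT] by (simp add: Am_def)
    have "\<exists>w. ((\<lambda>s. ln (P y s) / 2) has_real_derivative w) (at t within {T\<^sub>3..}) \<and> w \<le> - \<Phi>' t / 4"
      unfolding P_def E_def Am_def
      using \<Phi>1[OF tT] \<Phi>1[of T] \<Phi>_growth[of t] T3T tT
      by (intro barrier_time_derivative \<Phi>_deriv g1 amplitude_growth \<gamma>(1,2) \<rho>y) auto
    then obtain w where w: "((\<lambda>s. ln (P y s) / 2) has_real_derivative w) (at t within {T\<^sub>3..})" "w \<le> - \<Phi>' t / 4"
      by blast
    have "(u p has_real_derivative time_deriv u p t) (at t within {T\<^sub>3..})"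
      using T3 by (intro DERIV_subset[OF u_time_derivative[OF p(3) t0]]) auto
    from DERIV_add[OF this w(1)]
    have "((\<lambda>s. H y s) has_real_derivative time_deriv u p t + w) (at t within {T\<^sub>3..})"
      by (simp add: H_def p_def)
    then have "0 \<le> time_deriv u p t + w"
      by (rule derivative_nonneg_at_right_end[OF _ Tt]) (use max[OF y] t T3T in auto)
    moreover have "3 * \<Phi> t + 1 \<le> \<Phi>' t" by (rule \<Phi>_growth[OF order_trans[OF T3T tT]])
    moreover have "w \<le> - (\<Phi>' t / 4)" using w(2) by simp
    \<comment> \<open>The time derivative of \<open>H\<close> is nonnegative here, so
      \<open>u_t\<close> is at least a quarter of \<open>\<Phi>'\<close>; the growth law gives the
      rest.\<close>
    ultimately have vt: "3 / 4 * \<Phi> t + 1 / 4 \<le> time_deriv u p t" by argo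
    \<comment> \<open>The spatial derivative tests are stated on sets open in the plane, so the flat
      side and the arc are removed; \<open>?\<rho> y \<noteq> 0\<close> keeps \<open>y\<close>
      inside.\<close>
    define V where "V = {z::real^2. 0 < z $ 2} \<inter> ball y\<^sub>0 r"
    have V: "open V" "V \<subseteq> half_plane" "y \<in> V" "V \<subseteq> ?K" "V \<subseteq> ?W"
    proof -
      show "open V" unfolding V_def by (intro open_Int open_ball open_Collect_less continuous_intros)
      show "V \<subseteq> half_plane" "y \<in> V" "V \<subseteq> ?K" using yV by (auto simp: V_def half_plane_def dist_commute)
      then show "V \<subseteq> ?W" using K by blast
    qed
    have Vh: "hopen V" using V(1,2) by (auto simp: openin_open)
    note gV = metric_on_subset[OF g Vh V(5)]
    have v2: "Ck_on 2 V (loc_u c t)" by (rule Ck_on_subset[OF Vh W V(5) loc_u_Ck2[OF c t0]])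
    have "laplace_coord V (G c) (loc_u c t) y \<le> - ((E t * Am t) / ((E t)\<^sup>2 + 2 * (E t * Am t) * ?\<rho> y)) * laplace_coord V (G c) ?\<rho> y
        + 2 * ((E t * Am t) / ((E t)\<^sup>2 + 2 * (E t * Am t) * ?\<rho> y))\<^sup>2 * grad_sq V (G c) ?\<rho> y"
    proof (rule laplace_touching[OF V(1-3) gV v2 rho_derivatives(1)[OF Vh]])
      fix z assume "z \<in> V"
      then have zK: "z \<in> ?K" using V(4) by blast
      show "0 < (E t)\<^sup>2 + 2 * (E t * Am t) * ?\<rho> z" using P[OF tT \<rho>K(1)[OF zK]] by (simp add: P_def)
      show "loc_u c t z + ln ((E t)\<^sup>2 + 2 * (E t * Am t) * ?\<rho> z) / 2
          \<le> loc_u c t y + ln ((E t)\<^sup>2 + 2 * (E t * Am t) * ?\<rho> y) / 2"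
        using max[OF zK t] by (simp add: H_def P_def)
    qed
    moreover have "laplace_coord V (G c) f y = laplace_coord ?W (G c) f y" for f
      by (rule laplace_coord_local[OF Vh W V(5,3) refl, symmetric])
    moreover have "grad_sq V (G c) ?\<rho> y = grad_sq ?W (G c) ?\<rho> y"
      unfolding grad_sq_def partial_local[OF Vh W V(5,3) refl] ..
    ultimately have L: "laplacian A G (\<lambda>q. u q t) p \<le> - ((E t * Am t) / P y t) * laplace_coord ?W (G c) ?\<rho> y
        + 2 * ((E t * Am t) / P y t)\<^sup>2 * grad_sq ?W (G c) ?\<rho> y"
      by (simp add: laplacian_u[OF c p(1) t0] p(2) P_def)
    define b where "b = E t * Am t"
    have Pp: "0 < P y t" by (rule P[OF tT \<rho>y(1)])
    have b: "0 \<le> b" using E[of t] Am(1)[OF tT] by (simp add: b_def)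
    have "- (b / P y t) * laplace_coord ?W (G c) ?\<rho> y \<le> b / P y t * B"
    proof -
      have "- laplace_coord ?W (G c) ?\<rho> y \<le> B" using B1[OF y] B(2) by linarith
      then have "b / P y t * (- laplace_coord ?W (G c) ?\<rho> y) \<le> b / P y t * B"
        using b Pp by (intro mult_left_mono) auto
      then show ?thesis by simp
    qed
    moreover have "2 * (b / P y t)\<^sup>2 * grad_sq ?W (G c) ?\<rho> y \<le> 2 * (b / P y t)\<^sup>2 * B"
      using B2[OF y] B(3) by (intro mult_left_mono) auto
    ultimately have LK: "laplacian A G (\<lambda>q. u q t) p - gauss_curvature A G p \<le> b / P y t * B + 2 * (b / P y t)\<^sup>2 * B + B"
      using L B3(2)[OF int] B(4) unfolding b_def by linarith
    \<comment> \<open>Here positivity of \<open>H\<close> enters: \<open>u\<close> lies above the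
      barrier, so \<open>exp (- 2 u)\<close> lies below \<open>P\<close>. This turns the nonlinear
      factor into one that cancels the denominators of \<open>L\<close>.\<close>
    have ex: "exp (- 2 * u p t) \<le> P y t"
    proof -
      have "- 2 * u p t \<le> ln (P y t)" using pos by (simp add: H_def p_def)
      then have "exp (- 2 * u p t) \<le> exp (ln (P y t))" by (simp only: exp_le_cancel_iff)
      then show ?thesis using Pp by simp
    qed
    have Q0: "0 \<le> b / P y t * B + 2 * (b / P y t)\<^sup>2 * B + B" using b Pp B(1) by simp
    have "time_deriv u p t + 1 = exp (- 2 * u p t) * (laplacian A G (\<lambda>q. u q t) p - gauss_curvature A G p)"
      using pde[OF int t0] by simp
    also have "\<dots> \<le> exp (- 2 * u p t) * (b / P y t * B + 2 * (b / P y t)\<^sup>2 * B + B)"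
      by (intro mult_left_mono LK) auto
    also have "\<dots> \<le> P y t * (b / P y t * B + 2 * (b / P y t)\<^sup>2 * B + B)"
      by (intro mult_right_mono ex Q0)
    also have "\<dots> = b * B + 2 * (b\<^sup>2 / P y t) * B + P y t * B"
      using Pp by (simp add: field_simps power2_eq_square)
    finally have main: "time_deriv u p t + 1 \<le> b * B + 2 * (b\<^sup>2 / P y t) * B + P y t * B" .
    have E1: "E t \<le> 1" using \<Phi>1(1)[OF tT] by (simp add: E_def)
    have bA: "b \<le> Am t" using mult_left_le_one_le[OF Am(1)[OF tT], of "E t"] E[of t] E1 by (simp add: b_def)
    \<comment> \<open>The worst case is the edge, where \<open>P\<close> is \<open>E^2\<close>; the
      factors \<open>E\<close> cancel and the quadratic term is of order \<open>A^2\<close>.\<close>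
    have b2: "b\<^sup>2 / P y t \<le> (Am t)\<^sup>2"
    proof -
      have "(E t)\<^sup>2 \<le> P y t" using b \<rho>y(1) by (simp add: P_def b_def)
      then have "(E t)\<^sup>2 * (Am t)\<^sup>2 \<le> P y t * (Am t)\<^sup>2" by (intro mult_right_mono) auto
      then show ?thesis using Pp by (simp add: b_def power_mult_distrib field_simps)
    qed
    have PE: "P y t \<le> (E t)\<^sup>2 + 2 * b"
      unfolding P_def b_def[symmetric] using mult_left_le[OF \<rho>y(2) b] by simp
    have "b * B + 2 * (b\<^sup>2 / P y t) * B + P y t * B \<le> Am t * B + 2 * (Am t)\<^sup>2 * B + ((E t)\<^sup>2 + 2 * Am t) * B"
      using bA b2 PE B(1) by (intro add_mono mult_right_mono) auto
    also have "\<dots> = 3 * (Am t * B) + 2 * Am t * (Am t * B) + (E t)\<^sup>2 * B"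
      by (simp add: algebra_simps power2_eq_square)
    \<comment> \<open>The budget is \<open>\<Phi> / 2 + 1\<close>:
      \<open>Am B \<le> sqrt \<Phi> / 10 \<le> \<Phi> / 10\<close>, the quadratic product
      \<open>Am Am B\<close> is at most \<open>\<Phi> / 10\<close>, and
      \<open>E^2 B \<le> E \<Phi> \<le> 1\<close>. The lower bound \<open>3/4 \<Phi> + 5/4\<close>
      for \<open>u_t + 1\<close> exceeds it.\<close>
    also have "\<dots> \<le> 3 * (\<Phi> t / 10) + 2 * (\<Phi> t / 10) + 1"
    proof -
      have s: "sqrt (\<Phi> t) * sqrt (\<Phi> t) = \<Phi> t" "1 \<le> sqrt (\<Phi> t)" "sqrt (\<Phi> t) \<le> \<Phi> t"
        using \<Phi>1(1)[OF tT] real_sqrt_le_mono[of "\<Phi> t" "(\<Phi> t)\<^sup>2"] self_le_power[of "\<Phi> t" 2] by auto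
      have \<gamma>B: "\<gamma> * B \<le> 1 / 10" "\<gamma> \<le> 1"
      proof -
        have "\<gamma> * (B + 1) = \<gamma> * B + \<gamma>" "0 \<le> \<gamma> * B" using \<gamma>(1) B(1) by (simp_all add: algebra_simps)
        then show "\<gamma> * B \<le> 1 / 10" "\<gamma> \<le> 1" using \<gamma>(1,3) by linarith+
      qed
      have AB: "Am t * B \<le> sqrt (\<Phi> t) / 10"
      proof -
        have "Am t * B \<le> \<gamma> * sqrt (\<Phi> t) * B" using Am(2)[OF tT] B(1) by (intro mult_right_mono)
        also have "\<dots> = \<gamma> * B * sqrt (\<Phi> t)" by simp
        also have "\<dots> \<le> 1 / 10 * sqrt (\<Phi> t)" using \<gamma>B(1) s(2) by (intro mult_right_mono) auto
        finally show ?thesis by simp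
      qed
      have "Am t \<le> sqrt (\<Phi> t)"
        using Am(2)[OF tT] mult_left_le_one_le[of "sqrt (\<Phi> t)" \<gamma>] \<gamma>B(2) \<gamma>(1) s(2) by linarith
      then have "Am t * (Am t * B) \<le> sqrt (\<Phi> t) * (sqrt (\<Phi> t) / 10)"
        using AB Am(1)[OF tT] B(1) s(2) by (intro mult_mono) auto
      then have AAB: "Am t * (Am t * B) \<le> \<Phi> t / 10" using s(1) by simp
      have "(E t)\<^sup>2 * B \<le> E t * \<Phi> t"
        using E[of t] E1 B(1) \<Phi>1(2)[OF tT] by (intro mult_mono) (auto simp: power2_eq_square)
      also have "\<dots> \<le> E t * exp (\<Phi> t)"
      proof (rule mult_left_mono)
        show "\<Phi> t \<le> exp (\<Phi> t)" using exp_ge_add_one_self[of "\<Phi> t"] by linarith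
      qed (use E[of t] in simp)
      also have "\<dots> = 1" by (simp add: E_def flip: exp_add)
      finally show ?thesis using AB AAB s(3) by linarith
    qed
    finally have "time_deriv u p t + 1 \<le> 3 * (\<Phi> t / 10) + 2 * (\<Phi> t / 10) + 1" using main by linarith
    with vt \<Phi>1(1)[OF tT] show False by linarith
  qed
  then show ?thesis
    using T3T \<gamma>(1) \<Phi>1 unfolding H_def P_def E_def Am_def by blast
qed

end

section \<open>The curvature estimate\<close>

lemma continuous_on_normal_coord:
  assumes g: "metric_on W g" and g2: "\<And>i j. Ck_on 2 W (\<lambda>z. g z $ i $ j)"
  shows "continuous_on W (\<lambda>z. normal_coord g z $ i)"
proof -
  note c = continuous_on_coefficients(1)[OF g g2]
  have pos: "0 < matrix_inv (g z) $ 2 $ 2" if "z \<in> W" for z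
    using spd_pos[OF metric_onD(2)[OF g that]] by (simp add: matrix_inv_nth)
  show ?thesis
    unfolding normal_coord_def vec_lambda_beta
  proof (intro continuous_on_divide continuous_on_minus continuous_on_real_sqrt c ballI)
    fix z assume "z \<in> W"
    from pos[OF this] show "sqrt (matrix_inv (g z) $ 2 $ 2) \<noteq> 0" by simp
  qed
qed

context surface
begin

text \<open>The expression of \<open>geodesic_coord_eq\<close> is continuous on the whole chart
  range, so compact sets bound it; chart independence on the boundary lets one chart serve for all
  points of the compact set.\<close>

lemma geodesic_curvature_bounded_below:
  "\<exists>B. \<forall>p\<in>topspace X. p \<in> surface_boundary A \<longrightarrow> - B \<le> geodesic_curvature A G p"
proof (rule local_to_global_compact)
  fix c K assume c: "c \<in> A" and K: "compact K" "K \<subseteq> chart_range c"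
  note g = chart_metric[OF c] and g2 = chart_metric_Ck2[OF c]
  let ?f = "\<lambda>y. (\<Sum>m\<in>UNIV. normal_coord (G c) y $ m * (partial (chart_range c) m (\<lambda>z. G c z $ 1 $ 1) y / 2
    - partial (chart_range c) 1 (\<lambda>z. G c z $ 1 $ m) y)) / G c y $ 1 $ 1"
  have "continuous_on (chart_range c) ?f"
    unfolding sum_2
  proof (intro continuous_on_divide continuous_on_add continuous_on_diff continuous_on_mult
      continuous_on_const continuous_on_normal_coord[OF g g2] Ck2D(4,5)[OF g2] ballI)
    fix y assume "y \<in> chart_range c"
    from spd_pos(1)[OF metric_onD(2)[OF g this]] show "G c y $ 1 $ 1 \<noteq> 0" by simp
  qed simp_all
  then obtain B where B: "\<And>y. y \<in> K \<Longrightarrow> \<bar>?f y\<bar> \<le> B"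
    using compact_bounded_real[OF K(1) continuous_on_subset[OF _ K(2)]] by blast
  have "- B \<le> geodesic_curvature A G q"
    if q: "q \<in> fst c" "snd c q \<in> K" "q \<in> surface_boundary A" for q
    unfolding geodesic_curvature_eq[OF c q(1,3)] geodesic_coord_eq[OF g subsetD[OF K(2) q(2)]]
    using B[OF q(2)] by linarith
  then show "\<exists>B. \<forall>q\<in>fst c. snd c q \<in> K \<longrightarrow> q \<in> surface_boundary A \<longrightarrow> - B \<le> geodesic_curvature A G q"
    by blast
qed force

end

context dirichlet
begin

text \<open>The solution lies below the barrier and equals it on the flat side, so its outward
  derivative is at least that of the barrier, namely
  \<open>- n_2 (A / \<epsilon>) \<partial>_2 \<rho>\<close>. Multiplication by \<epsilon> leaves a
  multiple of \<open>sqrt \<Phi> - sqrt (\<Phi> T)\<close>.\<close>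

lemma normal_derivative_bound_local:
  assumes c: "c \<in> A" and y0: "y\<^sub>0 $ 2 = 0" and r: "0 < r" "r \<le> 1"
    and K: "cball y\<^sub>0 r \<inter> half_plane \<subseteq> chart_range c"
  shows "\<exists>C. \<forall>q\<in>{q \<in> fst c. snd c q \<in> ball y\<^sub>0 (r / 2)}. q \<in> surface_boundary A \<longrightarrow>
    (\<forall>t\<ge>C. root 3 (\<Phi> t) \<le> exp (- \<Phi> t) * normal_derivative A G (\<lambda>q. u q t) q)"
proof -
  let ?W = "chart_range c" and ?K = "cball y\<^sub>0 r \<inter> half_plane" and ?\<rho> = "rho y\<^sub>0 r"
  note W = chart_range_hopen[OF c] and g = chart_metric[OF c] and g2 = chart_metric_Ck2[OF c]
  obtain T \<gamma> where T: "T \<ge> T\<^sub>3" "0 < \<gamma>" and bar: "\<And>t. t \<ge> T \<Longrightarrow> \<Phi> T \<le> \<Phi> t \<and> 1 \<le> \<Phi> t"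
    "\<And>t y. t \<ge> T \<Longrightarrow> y \<in> ?K \<Longrightarrow> loc_u c t y + ln ((exp (- \<Phi> t))\<^sup>2
      + 2 * (exp (- \<Phi> t) * (\<gamma> * (sqrt (\<Phi> t) - sqrt (\<Phi> T)))) * ?\<rho> y) / 2 \<le> 0"
    using half_disc_barrier[OF c y0 r K] by blast
  have y0K: "y\<^sub>0 \<in> ?K" using y0 r by (auto simp: half_plane_def)
  have "continuous_on ?K (\<lambda>z. - normal_coord (G c) z $ 2)"
    by (intro continuous_on_minus continuous_on_subset[OF continuous_on_normal_coord[OF g g2] K])
  from continuous_attains_inf[OF compact_half_disc _ this] y0K obtain x where x: "x \<in> ?K"
    "\<And>z. z \<in> ?K \<Longrightarrow> - normal_coord (G c) x $ 2 \<le> - normal_coord (G c) z $ 2" by blast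
  define m where "m = - normal_coord (G c) x $ 2"
  have spd: "spd (G c x)" using metric_onD(2)[OF g subsetD[OF K x(1)]] .
  have m: "0 < m" using spd_pos[OF spd] by (simp add: m_def normal_coord_nth[of "G c" x, OF spd])
  \<comment> \<open>\<open>m\<close> is the least inward component of \<open>- n\<close> on the
    half-disc, and \<open>3/4 r^2\<close> is the least inward slope of \<open>rho\<close> on the
    flat side within distance \<open>r / 2\<close> of the centre.\<close>
  define k where "k = m * \<gamma> * (3 / 4 * r\<^sup>2)"
  have k: "0 < k" using m T(2) r by (simp add: k_def)
  obtain N where N: "\<And>x. x \<ge> N \<Longrightarrow> root 3 x \<le> k * (sqrt x - sqrt (\<Phi> T))"
    using cube_root_le_sqrt[OF k] unfolding eventually_at_top_linorder by blast
  obtain C where C: "C \<ge> T" "\<And>t. t \<ge> C \<Longrightarrow> N \<le> \<Phi> t" using \<Phi>_ge by meson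
  have "root 3 (\<Phi> t) \<le> exp (- \<Phi> t) * normal_derivative A G (\<lambda>q. u q t) q"
    if q: "q \<in> fst c" "snd c q \<in> ball y\<^sub>0 (r / 2)" "q \<in> surface_boundary A" and t: "t \<ge> C" for q t
  proof -
    define y where "y = snd c q"
    define e where "e = exp (- \<Phi> t)"
    define a where "a = \<gamma> * (sqrt (\<Phi> t) - sqrt (\<Phi> T))"
    have tT: "t \<ge> T" and t0: "0 \<le> t" and t3: "T\<^sub>3 \<le> t" using t C(1) T(1) T3 by auto
    have e: "0 < e" by (simp add: e_def)
    have a: "0 \<le> a" using bar(1)[OF tT] T(2) by (simp add: a_def)
    have yW: "y \<in> ?W" using chart_range_in[OF q(1)] by (simp add: y_def)
    have y2: "y $ 2 = 0" using surface_boundary_iff[OF c q(1)] q(3) by (simp add: y_def)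
    have dy: "dist y y\<^sub>0 < r / 2" using q(2) by (simp add: y_def dist_commute)
    define U where "U = ball y\<^sub>0 r \<inter> half_plane"
    have U: "hopen U" "U \<subseteq> ?K" "U \<subseteq> ?W" "y \<in> U"
    proof -
      show "hopen U" unfolding U_def openin_open by blast
      show "U \<subseteq> ?K" by (auto simp: U_def)
      then show "U \<subseteq> ?W" using K by blast
      show "y \<in> U" using dy y2 r by (auto simp: U_def half_plane_def dist_commute)
    qed
    have \<rho>0: "?\<rho> y = 0" by (simp add: rho_def y2)
    have uy: "loc_u c t y = \<Phi> t" using u_boundary[OF q(3) t3] chart_inv_left[OF c q(1)] by (simp add: y_def)
    let ?h = "\<lambda>z. loc_u c t z + ln (e\<^sup>2 + 2 * (e * a) * ?\<rho> z) / 2"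
    have hy: "?h y = 0" by (simp add: \<rho>0 uy e_def ln_realpow)
    have hz: "?h z \<le> 0" if "z \<in> U" for z
      using bar(2)[OF tT subsetD[OF U(2) that]] by (simp add: e_def a_def)
    have v2: "Ck_on 2 U (loc_u c t)" by (rule Ck_on_subset[OF U(1) W U(3) loc_u_Ck2[OF c t0]])
    have Py: "0 < e\<^sup>2 + 2 * (e * a) * ?\<rho> y" using e by (simp add: \<rho>0)
    note lb = log_barrier_partial[OF U(1,4) Ck2D(1)[OF v2 U(4)] Ck2D(1)[OF rho_derivatives(1)[OF U(1)] U(4)] Py]
    let ?n = "normal_coord (G c) y"
    have n2: "m \<le> - ?n $ 2" using x(2)[OF subsetD[OF U(2,4)]] by (simp add: m_def)
    \<comment> \<open>The negative of the difference has its minimum 0 at \<open>y\<close>, and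
      \<open>- n\<close> points into the half-plane.\<close>
    have "0 \<le> (- ?n) $ 1 * partial U 1 (\<lambda>z. - ?h z) y + (- ?n) $ 2 * partial U 2 (\<lambda>z. - ?h z) y"
    proof (rule directional_derivative_nonneg[OF U(1,4)])
      show "(\<lambda>z. - ?h z) differentiable (at y within U)" by (intro differentiable_minus lb(1))
      show "- ?h y \<le> - ?h z" if "z \<in> U" for z using hy hz[OF that] by simp
    qed (use n2 m in auto)
    moreover have "partial U j (\<lambda>z. - ?h z) y = - partial U j ?h y" for j
      by (rule partial_arith(4)[OF U(1,4) lb(1) lb(1)])
    ultimately have h0: "0 \<le> ?n $ 1 * partial U 1 ?h y + ?n $ 2 * partial U 2 ?h y" by simp
    have h1: "partial U 1 ?h y = partial U 1 (loc_u c t) y"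
      unfolding lb(2) rho_derivatives(2)[OF U(1,4)] by (simp add: y2)
    have h2: "partial U 2 ?h y = partial U 2 (loc_u c t) y + a / e * (r\<^sup>2 - (dist y y\<^sub>0)\<^sup>2)"
      unfolding lb(2) rho_derivatives(3)[OF U(1,4)] \<rho>0
      using e unfolding dist_vec2 by (simp add: y2 y0 field_simps power2_eq_square)
    have n: "- ?n $ 2 * (a / e * (r\<^sup>2 - (dist y y\<^sub>0)\<^sup>2))
        \<le> ?n $ 1 * partial U 1 (loc_u c t) y + ?n $ 2 * partial U 2 (loc_u c t) y"
      using h0 unfolding h1 h2 by (simp add: algebra_simps)
    have "normal_derivative A G (\<lambda>q. u q t) q = (\<Sum>i\<in>UNIV. ?n $ i * partial ?W i (loc_u c t) y)"
    proof -
      have "((\<lambda>q. u q t) \<circ> chart_inv d) differentiable (at z within chart_range d)"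
        if "d \<in> A" "z \<in> chart_range d" for d z
        unfolding comp_loc_u by (rule Ck2D(1)[OF loc_u_Ck2[OF that(1) t0] that(2)])
      from normal_derivative_eq[OF c q(1,3) this] show ?thesis by (simp only: comp_loc_u y_def)
    qed
    also have "\<dots> = ?n $ 1 * partial U 1 (loc_u c t) y + ?n $ 2 * partial U 2 (loc_u c t) y"
      by (simp add: sum_2 partial_local[OF U(1) W U(3,4) refl])
    finally have nd: "- ?n $ 2 * (a / e * (r\<^sup>2 - (dist y y\<^sub>0)\<^sup>2)) \<le> normal_derivative A G (\<lambda>q. u q t) q"
      using n by simp
    have "(dist y y\<^sub>0)\<^sup>2 \<le> (r / 2)\<^sup>2" using dy by (intro power_mono) auto
    then have f: "3 / 4 * r\<^sup>2 \<le> r\<^sup>2 - (dist y y\<^sub>0)\<^sup>2" by (simp add: power_divide)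
    have "root 3 (\<Phi> t) \<le> k * (sqrt (\<Phi> t) - sqrt (\<Phi> T))" by (rule N[OF C(2)[OF t]])
    also have "\<dots> = e * (m * (a / e * (3 / 4 * r\<^sup>2)))" using e by (simp add: k_def a_def)
    also have "\<dots> \<le> e * (- ?n $ 2 * (a / e * (r\<^sup>2 - (dist y y\<^sub>0)\<^sup>2)))"
      using e a f n2 m by (intro mult_left_mono mult_mono) auto
    also have "\<dots> \<le> e * normal_derivative A G (\<lambda>q. u q t) q"
      using nd e by (intro mult_left_mono) auto
    finally show ?thesis by (simp add: e_def)
  qed
  then show ?thesis by (intro exI[of _ C]) auto
qed

text \<open>The constant passed through \<open>local_to_global\<close> is a starting time. Enlarging
  it weakens the statement, so finitely many half-discs yield one time for the whole
  boundary.\<close>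

lemma normal_derivative_bound:
  "\<exists>C. \<forall>q\<in>topspace X. q \<in> surface_boundary A \<longrightarrow>
    (\<forall>t\<ge>C. root 3 (\<Phi> t) \<le> exp (- \<Phi> t) * normal_derivative A G (\<lambda>q. u q t) q)"
proof (rule local_to_global)
  fix p assume "p \<in> topspace X"
  then obtain c where c: "c \<in> A" "p \<in> fst c" by (rule chart_covers)
  show "\<exists>U. openin X U \<and> p \<in> U \<and> (\<exists>C. \<forall>q\<in>U. q \<in> surface_boundary A \<longrightarrow>
    (\<forall>t\<ge>C. root 3 (\<Phi> t) \<le> exp (- \<Phi> t) * normal_derivative A G (\<lambda>q. u q t) q))"
  proof (cases "snd c p $ 2 = 0")
    case True
    obtain r where r: "0 < r" "r \<le> 1" "cball (snd c p) r \<inter> half_plane \<subseteq> chart_range c"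
      by (rule half_disc[OF c])
    from normal_derivative_bound_local[OF c(1) True r] show ?thesis
      using openin_chart_ball[OF c(1), of "snd c p" "r / 2"] c(2) r(1)
      by (intro exI[of _ "{q \<in> fst c. snd c q \<in> ball (snd c p) (r / 2)}"]) auto
  next
    case False
    \<comment> \<open>A ball whose radius is the height of its centre misses the boundary line, so
      the claim is vacuous on this neighbourhood.\<close>
    let ?U = "{q \<in> fst c. snd c q \<in> ball (snd c p) (snd c p $ 2)}"
    have pos: "0 < snd c p $ 2" using False chart_nonneg[OF c] by simp
    have "q \<notin> surface_boundary A" if q: "q \<in> ?U" for q
    proof -
      have "\<bar>snd c p $ 2 - snd c q $ 2\<bar> < snd c p $ 2"
        using component_le_norm_cart[of "snd c p - snd c q" 2] q by (simp add: dist_norm)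
      then show ?thesis using surface_boundary_iff[OF c(1)] q by auto
    qed
    then show ?thesis
      using openin_chart_ball[OF c(1)] c(2) pos by (intro exI[of _ ?U]) auto
  qed
qed (meson order_trans)

end

theorem theorem5p4:
  fixes X :: "'a topology" and A :: "'a chart set" and G :: "'a metric_coeffs"
    and \<alpha> T\<^sub>3 :: real and u0 :: "'a \<Rightarrow> real" and \<phi> u :: "'a \<Rightarrow> real \<Rightarrow> real"
  assumes "compact_riemannian_surface X A G"
    and "0 < \<alpha>" "\<alpha> < 1"
    and "admissible_pair A G \<alpha> u0 \<phi>"
    and "T\<^sub>3 > 0"
    and "\<And>p q t. p \<in> surface_boundary A \<Longrightarrow> q \<in> surface_boundary A \<Longrightarrow> t \<ge> T\<^sub>3 \<Longrightarrow> \<phi> p t = \<phi> q t"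
    and "\<And>p t. p \<in> surface_boundary A \<Longrightarrow> t \<ge> T\<^sub>3 \<Longrightarrow> time_deriv \<phi> p t \<ge> 3 * \<phi> p t + 1"
    and "cauchy_dirichlet_solution X A G \<alpha> u0 \<phi> u"
  shows "\<exists>C>0. \<exists>T\<^sub>4\<ge>T\<^sub>3. \<forall>p\<in>surface_boundary A. \<forall>t\<ge>T\<^sub>4.
    geodesic_curvature A (conformal_metric (\<lambda>q. u q t) G) p =
      exp (- u p t) * (normal_derivative A G (\<lambda>q. u q t) p + geodesic_curvature A G p) \<and>
    geodesic_curvature A (conformal_metric (\<lambda>q. u q t) G) p
      \<ge> root 3 (\<phi> p t) - 1 - C * exp (- \<phi> p t)"
proof (cases "surface_boundary A = {}")
  case True
  then show ?thesis by (intro exI[of _ 1] conjI exI[of _ T\<^sub>3]) auto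
next
  case False
  then obtain p\<^sub>1 where p1: "p\<^sub>1 \<in> surface_boundary A" by blast
  note sol = assms(8)[unfolded cauchy_dirichlet_solution_def]
  interpret evolution X A G \<alpha> u
    using assms(1,2) sol by unfold_locales auto
  have bX: "p \<in> topspace X" if "p \<in> surface_boundary A" for p
    using that chart_subset_topspace unfolding surface_boundary_def by blast
  have u\<phi>: "u p t = \<phi> p t" if "p \<in> surface_boundary A" "0 \<le> t" for p t
    using sol that by blast
  \<comment> \<open>Time regularity of the boundary datum is read off from \<open>u\<close>, which
    agrees with it at \<open>p\<^sub>1\<close> for all nonnegative times.\<close>
  have d\<phi>: "(\<phi> p\<^sub>1 has_real_derivative time_deriv \<phi> p\<^sub>1 t) (at t within {0..})" if "0 \<le> t" for t
  proof -
    have "(u p\<^sub>1 has_real_derivative time_deriv u p\<^sub>1 t) (at t within {0..})"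
      by (rule u_time_derivative[OF bX[OF p1] that])
    then have "(\<phi> p\<^sub>1 has_real_derivative time_deriv u p\<^sub>1 t) (at t within {0..})"
      unfolding has_field_derivative_def
      by (rule has_derivative_transform[rotated 2]) (use u\<phi>[OF p1] that in auto)
    then have "\<phi> p\<^sub>1 differentiable (at t within {0..})"
      by (auto simp: has_field_derivative_def intro: differentiableI)
    then show ?thesis
      by (simp add: time_deriv_def vector_derivative_works has_real_derivative_iff_has_vector_derivative)
  qed
  interpret dirichlet X A G \<alpha> u "\<phi> p\<^sub>1" "time_deriv \<phi> p\<^sub>1" T\<^sub>3
  proof
    show "0 < T\<^sub>3" by (rule assms(5))
    show "time_deriv u p t = exp (- 2 * u p t) * (laplacian A G (\<lambda>q. u q t) p - gauss_curvature A G p) - 1"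
      if "p \<in> surface_interior X A" "0 \<le> t" for p t using sol that by blast
    show "u p t = \<phi> p\<^sub>1 t" if "p \<in> surface_boundary A" "T\<^sub>3 \<le> t" for p t
      using u\<phi>[OF that(1), of t] assms(5) assms(6)[OF that(1) p1 that(2)] that(2) by simp
    show "(\<phi> p\<^sub>1 has_real_derivative time_deriv \<phi> p\<^sub>1 t) (at t within {T\<^sub>3..})" if "T\<^sub>3 \<le> t" for t
      using that assms(5) by (intro DERIV_subset[OF d\<phi>]) auto
    show "3 * \<phi> p\<^sub>1 t + 1 \<le> time_deriv \<phi> p\<^sub>1 t" if "T\<^sub>3 \<le> t" for t
      using assms(7)[OF p1 that] .
    obtain T\<^sub>1 \<xi> where \<xi>: "filterlim \<xi> at_top at_top" "\<And>t. T\<^sub>1 \<le> t \<Longrightarrow> ln (\<xi> t) \<le> \<phi> p\<^sub>1 t"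
      using assms(4) p1 unfolding admissible_pair_def low_speed_increasing_def by blast
    have "filterlim (\<lambda>t. ln (\<xi> t)) at_top at_top"
      by (rule filterlim_compose[OF ln_at_top \<xi>(1)])
    then show "filterlim (\<phi> p\<^sub>1) at_top at_top"
      by (rule filterlim_at_top_mono) (use \<xi>(2) in \<open>auto simp: eventually_at_top_linorder\<close>)
  qed
  obtain C where C: "\<And>q t. q \<in> surface_boundary A \<Longrightarrow> t \<ge> C \<Longrightarrow>
      root 3 (\<phi> p\<^sub>1 t) \<le> exp (- \<phi> p\<^sub>1 t) * normal_derivative A G (\<lambda>q. u q t) q"
    using normal_derivative_bound bX by blast
  obtain B where B: "\<And>q. q \<in> surface_boundary A \<Longrightarrow> - B \<le> geodesic_curvature A G q"
    using geodesic_curvature_bounded_below bX by blast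
  \<comment> \<open>\<open>C\<close> is a starting time and becomes part of the final time; the
    constant of the estimate is \<open>max B 1\<close>, where \<open>- B\<close> bounds the geodesic
    curvature of \<open>G\<close> from below and the 1 secures positivity.\<close>
  have "\<forall>p\<in>surface_boundary A. \<forall>t\<ge>max C T\<^sub>3.
    geodesic_curvature A (conformal_metric (\<lambda>q. u q t) G) p =
      exp (- u p t) * (normal_derivative A G (\<lambda>q. u q t) p + geodesic_curvature A G p) \<and>
    geodesic_curvature A (conformal_metric (\<lambda>q. u q t) G) p
      \<ge> root 3 (\<phi> p t) - 1 - max B 1 * exp (- \<phi> p t)"
  proof (intro conjI ballI allI impI)
    fix p t assume p: "p \<in> surface_boundary A" and t: "max C T\<^sub>3 \<le> t"
    have t0: "0 \<le> t" using t assms(5) by simp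
    have "((\<lambda>q. u q t) \<circ> chart_inv d) differentiable (at z within chart_range d)"
      if "d \<in> A" "z \<in> chart_range d" for d z
      unfolding comp_loc_u by (rule Ck2D(1)[OF loc_u_Ck2[OF that(1) t0] that(2)])
    from geodesic_curvature_conformal[OF bX[OF p] this]
    show eq: "geodesic_curvature A (conformal_metric (\<lambda>q. u q t) G) p =
      exp (- u p t) * (normal_derivative A G (\<lambda>q. u q t) p + geodesic_curvature A G p)" .
    have \<phi>: "u p t = \<phi> p t" "\<phi> p\<^sub>1 t = \<phi> p t"
      using u\<phi>[OF p t0] assms(6)[OF p1 p] t by auto
    have "- max B 1 * exp (- \<phi> p t) \<le> geodesic_curvature A G p * exp (- \<phi> p t)"
      using B[OF p] by (intro mult_right_mono) auto
    moreover have "root 3 (\<phi> p t) \<le> exp (- \<phi> p t) * normal_derivative A G (\<lambda>q. u q t) p"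
      using C[OF p, of t] t \<phi>(2) by simp
    ultimately show "root 3 (\<phi> p t) - 1 - max B 1 * exp (- \<phi> p t)
        \<le> geodesic_curvature A (conformal_metric (\<lambda>q. u q t) G) p"
      unfolding eq \<phi>(1) by (simp add: algebra_simps)
  qed
  moreover have "0 < max B 1" "T\<^sub>3 \<le> max C T\<^sub>3" by auto
  ultimately show ?thesis by blast
qed

end
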